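(* Let $\bullet\in\{*,\mathrm{sh}\}$. For every nonnegative integer $n$, \[ \zeta_{\mathcal{S}_3}^{\bullet}(\{1,3\}^n,1)\equiv-(-4)^{-n}\zeta(4n+3)\,t^2\pmod{\pi^2}, \] i.e. for each of $t^0,t^1,t^2$ the coefficients of the two sides differ by an element of $\pi^2\mathcal{Z}$.
   Context: An index is a finite (possibly empty) sequence of positive integers; it is admissible if it is empty or its last component is greater than $1$. $\{a,b\}^n$ denotes the $n$-fold repetition of $a,b$ (e.g. $(\{1,3\}^2,1)=(1,3,1,3,1)$). For an admissible index, $\zeta(k_1,\dots,k_r)=\sum_{1\le n_1<\dots<n_r}\frac{1}{n_1^{k_1}\cdots n_r^{k_r}}$, with $\zeta(\emptyset)=1$. $\mathcal{Z}\subset\mathbb{R}$ is the $\mathbb{Q}$-span of all these values; it is a $\mathbb{Q}$-algebra containing $\pi^2=6\zeta(2)$, and $\pi^2\mathcal{Z}$ is the ideal generated by $\pi^2$. Harmonic regularization $\zeta^*$: on the $\mathbb{Q}$-vector space $\mathcal{I}$ freely generated by all indices, define the bilinear product $*$ by $\boldsymbol{k}*\emptyset=\emptyset*\boldsymbol{k}=\boldsymbol{k}$ and $(\boldsymbol{k},k)*(\boldsymbol{l},l)=(\boldsymbol{k}*(\boldsymbol{l},l),k)+(\boldsymbol{k}*\boldsymbol{l},k+l)+((\boldsymbol{k},k)*\boldsymbol{l},l)$. Then $\zeta^*:\mathcal{I}\to\mathbb{R}$ is the unique $\mathbb{Q}$-linear map that is multiplicative for $*$, equals $\zeta$ on admissible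 indices, and satisfies $\zeta^*(1)=0$. Shuffle regularization $\zeta^{\mathrm{sh}}$: identify the index $(k_1,\dots,k_r)$ with the word $yx^{k_1-1}\cdots yx^{k_r-1}$ in $\mathbb{Q}+y\mathbb{Q}\langle x,y\rangle$, equipped with the shuffle product. Then $\zeta^{\mathrm{sh}}$ is the unique $\mathbb{Q}$-linear map that is multiplicative for the shuffle product, equals $\zeta$ on admissible indices, and satisfies $\zeta^{\mathrm{sh}}(1)=0$. Both maps take values in $\mathcal{Z}$. For $\bullet\in\{*,\mathrm{sh}\}$, an index $(k_1,\dots,k_r)$ and $m\ge0$ put \[\zeta_m^{\bullet}(k_1,\dots,k_r)=\sum_{\substack{l_1,\dots,l_r\ge0\\l_1+\dots+l_r=m}}\zeta^{\bullet}(k_1+l_1,\dots,k_r+l_r)\prod_{i=1}^r\binom{k_i+l_i-1}{l_i}\] (so $\zeta_0^\bullet(\emptyset)=1$ and $\zeta_m^\bullet(\emptyset)=0$ for $m\ge1$), and \[\zeta_{\widehat{\mathcal{S}}}^{\bullet}(k_1,\dots,k_r)=\sum_{i=0}^r(-1)^{k_{i+1}+\dots+k_r}\zeta^{\bullet}(k_1,\dots,k_i)\sum_{m\ge0}\zeta_m^{\bullet}(k_r,\dots,k_{i+1})t^m\in\mathcal{Z}[[t]].\] For $m\ge1$, $\zeta_{\mathcal{S}_m}^{\bullet}(\boldsymbol{k})$ is the image of $\zeta_{\widehat{\mathcal{S}}}^{\bullet}(\boldsymbol{k})$ in $\mathcal{Z}[[t]]/t^m$. *)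

theory Defs
  imports
    "HOL-Analysis.Analysis"
    "HOL-Library.Poly_Mapping"
    "HOL-Library.FuncSet"
    "HOL-Computational_Algebra.Formal_Power_Series"
begin

section \<open>Indices and multiple zeta values\<close>

definition is_index :: "nat list \<Rightarrow> bool" where
  "is_index ks \<longleftrightarrow> (\<forall>k\<in>set ks. 1 \<le> k)"

definition admissible :: "nat list \<Rightarrow> bool" where
  "admissible ks \<longleftrightarrow> is_index ks \<and> (ks = [] \<or> 1 < last ks)"

text \<open>The summation variables \<open>n\<^sub>1 < \<dots> < n\<^sub>r\<close> form a strictly increasing list
  of positive integers. For the empty index the only such list is \<open>[]\<close>, so the value is 1.\<close>

definition mzv :: "nat list \<Rightarrow> real" where
  "mzv ks = (\<Sum>\<^sub>\<infinity>ns\<in>{ns. length ns = length ks \<and> sorted_wrt (<) ns \<and> (\<forall>n\<in>set ns. 1 \<le> n)}.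
               \<Prod>i<length ks. 1 / real (ns ! i) ^ (ks ! i))"

definition mzv_space :: "real set" where
  "mzv_space = module.span (\<lambda>(q::rat) (x::real). of_rat q * x) {mzv ks | ks. admissible ks}"

definition pi_squared_ideal :: "real set" where
  "pi_squared_ideal = {pi\<^sup>2 * z | z. z \<in> mzv_space}"


section \<open>Free rational vector spaces\<close>

text \<open>\<open>'a \<Rightarrow>\<^sub>0 rat\<close> is the rational vector space with basis \<open>'a\<close>; the basis vectors are
  \<open>single a 1\<close>.\<close>

abbreviation basis :: "'a \<Rightarrow> ('a \<Rightarrow>\<^sub>0 rat)" where
  "basis a \<equiv> Poly_Mapping.single a 1"

definition scale :: "rat \<Rightarrow> ('a \<Rightarrow>\<^sub>0 rat) \<Rightarrow> ('a \<Rightarrow>\<^sub>0 rat)" where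
  "scale q v = Poly_Mapping.map (\<lambda>c. q * c) v"

definition lin_ext :: "('a \<Rightarrow> ('b \<Rightarrow>\<^sub>0 rat)) \<Rightarrow> ('a \<Rightarrow>\<^sub>0 rat) \<Rightarrow> ('b \<Rightarrow>\<^sub>0 rat)" where
  "lin_ext g v = (\<Sum>a\<in>Poly_Mapping.keys v. scale (Poly_Mapping.lookup v a) (g a))"

definition bilin_ext ::
  "('a \<Rightarrow> 'a \<Rightarrow> ('b \<Rightarrow>\<^sub>0 rat)) \<Rightarrow> ('a \<Rightarrow>\<^sub>0 rat) \<Rightarrow> ('a \<Rightarrow>\<^sub>0 rat) \<Rightarrow> ('b \<Rightarrow>\<^sub>0 rat)" where
  "bilin_ext g v w = lin_ext (\<lambda>a. lin_ext (g a) w) v"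

definition index_space :: "(nat list \<Rightarrow>\<^sub>0 rat) set" where
  "index_space = {v. \<forall>ks\<in>Poly_Mapping.keys v. is_index ks}"


section \<open>The harmonic product\<close>

function harmonic_index :: "nat list \<Rightarrow> nat list \<Rightarrow> (nat list \<Rightarrow>\<^sub>0 rat)" where
  "harmonic_index ks ls =
     (if ks = [] then basis ls
      else if ls = [] then basis ks
      else lin_ext (\<lambda>ms. basis (ms @ [last ks])) (harmonic_index (butlast ks) ls)
         + lin_ext (\<lambda>ms. basis (ms @ [last ks + last ls])) (harmonic_index (butlast ks) (butlast ls))
         + lin_ext (\<lambda>ms. basis (ms @ [last ls])) (harmonic_index ks (butlast ls)))"
  by pat_completeness auto
termination
  by (relation "Wellfounded.measure (\<lambda>(ks, ls). length ks + length ls)") (auto simp flip: length_greater_0_conv)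

declare harmonic_index.simps [simp del]

definition harmonic_prod ::
  "(nat list \<Rightarrow>\<^sub>0 rat) \<Rightarrow> (nat list \<Rightarrow>\<^sub>0 rat) \<Rightarrow> (nat list \<Rightarrow>\<^sub>0 rat)" where
  "harmonic_prod = bilin_ext harmonic_index"


section \<open>The shuffle product\<close>

datatype letter = Letter_x | Letter_y

definition word_of_index :: "nat list \<Rightarrow> letter list" where
  "word_of_index ks = concat (map (\<lambda>k. Letter_y # replicate (k - 1) Letter_x) ks)"

fun shuffle_word :: "'a list \<Rightarrow> 'a list \<Rightarrow> ('a list \<Rightarrow>\<^sub>0 rat)" where
  "shuffle_word [] w = basis w"
| "shuffle_word v [] = basis v"
| "shuffle_word (a # v) (b # w) =
     lin_ext (\<lambda>u. basis (a # u)) (shuffle_word v (b # w))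
   + lin_ext (\<lambda>u. basis (b # u)) (shuffle_word (a # v) w)"

text \<open>The linear extension of \<open>word_of_index\<close> identifies \<open>index_space\<close> with the subspace
  \<open>\<rat> + y \<rat>\<langle>x,y\<rangle>\<close> of the free algebra, which is closed under the shuffle product. The
  shuffle product of indices is the one transported back along this identification.\<close>

definition to_words :: "(nat list \<Rightarrow>\<^sub>0 rat) \<Rightarrow> (letter list \<Rightarrow>\<^sub>0 rat)" where
  "to_words = lin_ext (\<lambda>ks. basis (word_of_index ks))"

definition shuffle_prod ::
  "(nat list \<Rightarrow>\<^sub>0 rat) \<Rightarrow> (nat list \<Rightarrow>\<^sub>0 rat) \<Rightarrow> (nat list \<Rightarrow>\<^sub>0 rat)" where
  "shuffle_prod v w =
     the_inv_into index_space to_words (bilin_ext shuffle_word (to_words v) (to_words w))"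


section \<open>Regularizations\<close>

text \<open>The map is only meant to be defined on \<open>index_space\<close>; requiring it to be extensional
  (\<open>undefined\<close> elsewhere) makes it unique as a HOL function.\<close>

definition is_regularization ::
  "((nat list \<Rightarrow>\<^sub>0 rat) \<Rightarrow> (nat list \<Rightarrow>\<^sub>0 rat) \<Rightarrow> (nat list \<Rightarrow>\<^sub>0 rat)) \<Rightarrow>
   ((nat list \<Rightarrow>\<^sub>0 rat) \<Rightarrow> real) \<Rightarrow> bool" where
  "is_regularization prd f \<longleftrightarrow>
     f \<in> extensional index_space \<and>
     (\<forall>v\<in>index_space. \<forall>w\<in>index_space. f (v + w) = f v + f w) \<and>
     (\<forall>q. \<forall>v\<in>index_space. f (scale q v) = of_rat q * f v) \<and>
     (\<forall>v\<in>index_space. \<forall>w\<in>index_space. f (prd v w) = f v * f w) \<and>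
     (\<forall>ks. admissible ks \<longrightarrow> f (basis ks) = mzv ks) \<and>
     f (basis [1]) = 0"

datatype reg_kind = Harmonic | Shuffle

fun reg_prod ::
  "reg_kind \<Rightarrow> (nat list \<Rightarrow>\<^sub>0 rat) \<Rightarrow> (nat list \<Rightarrow>\<^sub>0 rat) \<Rightarrow> (nat list \<Rightarrow>\<^sub>0 rat)" where
  "reg_prod Harmonic = harmonic_prod"
| "reg_prod Shuffle = shuffle_prod"

definition reg_map :: "reg_kind \<Rightarrow> (nat list \<Rightarrow>\<^sub>0 rat) \<Rightarrow> real" where
  "reg_map b = (THE f. is_regularization (reg_prod b) f)"

definition zeta_reg :: "reg_kind \<Rightarrow> nat list \<Rightarrow> real" where
  "zeta_reg b ks = reg_map b (basis ks)"


section \<open>Symmetric multiple zeta values\<close>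

definition zeta_reg_shift :: "reg_kind \<Rightarrow> nat \<Rightarrow> nat list \<Rightarrow> real" where
  "zeta_reg_shift b m ks =
     (\<Sum>ls | length ls = length ks \<and> sum_list ls = m.
        zeta_reg b (map2 (+) ks ls) *
        (\<Prod>i<length ks. real ((ks ! i + ls ! i - 1) choose (ls ! i))))"

definition zeta_S_hat :: "reg_kind \<Rightarrow> nat list \<Rightarrow> real fps" where
  "zeta_S_hat b ks =
     (\<Sum>i\<le>length ks.
        fps_const ((- 1) ^ sum_list (drop i ks) * zeta_reg b (take i ks)) *
        Abs_fps (\<lambda>m. zeta_reg_shift b m (rev (drop i ks))))"

text \<open>A class modulo \<open>t\<^sup>m\<close> is represented by its unique polynomial of degree less than \<open>m\<close>.\<close>

definition zeta_S :: "nat \<Rightarrow> reg_kind \<Rightarrow> nat list \<Rightarrow> real fps" where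
  "zeta_S m b ks = fps_cutoff m (zeta_S_hat b ks)"

end

theory Submission
  imports
    Defs
    "HOL-Real_Asymp.Real_Asymp"
    "HOL-Complex_Analysis.Cauchy_Integral_Formula"
begin

text \<open>Both regularizations are realized analytically: truncated sums (for \<open>*\<close>) and multiple
  polylogarithms near \<open>1\<close> (for the shuffle product) are multiplicative and have asymptotic expansions
  that are polynomials in a divergent quantity, and the constant term of the polynomial is the
  regularized value. For all indices that occur here the two values agree, so it suffices to treat
  the shuffle regularization, extended to a character \<open>Z\<close> on all words in \<open>x\<close> and \<open>y\<close>; then
  \<open>\<zeta>\<^sub>m(w) = (-1)\<^sup>m Z(x\<^sup>m w)\<close>.

  Shuffling alternating words with weights \<open>\<i>\<^sup>j\<close> leaves only the words with the periodic pattern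
  \<open>yyxx\<close>, i.e. the index \<open>{1,3}\<^sup>n\<close>. Together with the antipode relation this evaluates the coefficients
  of \<open>t\<close> and \<open>t\<^sup>2\<close> exactly, up to a factor \<open>2 (-4)\<^sup>n\<close>, as \<open>- \<Sum> A\<^sub>i A\<^sub>j\<close> and \<open>\<Sum> A\<^sub>i C\<^sub>j\<close> over
  \<open>i + j = 2n + 1\<close>, where \<open>A\<^sub>k = \<zeta>({2}\<^sup>k)\<close> is a rational multiple of \<open>\<pi>\<^bsup>2k\<^esup>\<close> and \<open>C\<^sub>k = Z(x(yx)\<^sup>k)\<close>. Modulo
  \<open>\<pi>\<^sup>2\<close> only \<open>C\<^bsub>2n+1\<^esub>\<close> survives, and it is congruent to \<open>-2\<zeta>(4n+3)\<close>.\<close>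

section \<open>Linear extension of functions on a basis\<close>

text \<open>Since \<open>reg_map\<close> is a definite description, nothing can be computed before
  existence and uniqueness of both regularizations are known; the analytic construction gives
  existence and, at the same time, values for words with leading \<open>x\<close>. The two
  regularizations agree here because the initial pieces and the reversed tails of ({1,3}^n,1) never
  end in two ones, and raising components preserves this. The weight \<open>\<i>\<close> is chosen
  because \<open>\<i> * \<i> = - 1\<close>: unwanted contributions cancel, the others double, so two
  letters cost a factor \<open>2 * \<i>\<close> and a full period \<open>yyxx\<close> costs -4.
  Separating even from odd exponents \<open>j\<close> turns each evaluation into a quadratic
  relation between the generating functions of (yx)^k, (yx)^k y, x(yx)^k and (xy)^k, taken at q and
  at -q. The coefficients of the symmetric values are convolutions of the quantities so evaluated.
  The series of (yx)^k y and (xy)^k enter these convolutions only through the antipode relation,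
  which says that a determinant equals 1; what remains is the odd part of a product of two series,
  so the result is exact before any reduction modulo pi^2.\<close>

abbreviation (input) keys :: "('a \<Rightarrow>\<^sub>0 rat) \<Rightarrow> 'a set" where "keys \<equiv> Poly_Mapping.keys"
abbreviation (input) coefficient :: "('a \<Rightarrow>\<^sub>0 rat) \<Rightarrow> 'a \<Rightarrow> rat" where "coefficient \<equiv> Poly_Mapping.lookup"

definition ev :: "('a \<Rightarrow> real) \<Rightarrow> ('a \<Rightarrow>\<^sub>0 rat) \<Rightarrow> real" where
  "ev f v = (\<Sum>a\<in>keys v. of_rat (coefficient v a) * f a)"

lemma lookup_scale [simp]: "coefficient (scale q v) a = q * coefficient v a"
  unfolding scale_def by transfer (auto simp: when_def)

lemma keys_scale: "keys (scale q v) \<subseteq> keys v"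
  by (auto simp: in_keys_iff)

lemma ev_superset:
  assumes "finite A" "keys v \<subseteq> A"
  shows "ev f v = (\<Sum>a\<in>A. of_rat (coefficient v a) * f a)"
  unfolding ev_def using assms by (intro sum.mono_neutral_left) (auto simp: in_keys_iff)

lemma ev_add [simp]: "ev f (v + w) = ev f v + ev f w"
proof -
  let ?A = "keys v \<union> keys w"
  have "ev f (v + w) = (\<Sum>a\<in>?A. of_rat (coefficient (v + w) a) * f a)"
    using keys_add[of v w] by (intro ev_superset) auto
  also have "\<dots> = (\<Sum>a\<in>?A. of_rat (coefficient v a) * f a)
      + (\<Sum>a\<in>?A. of_rat (coefficient w a) * f a)"
    by (simp add: lookup_add of_rat_add distrib_right sum.distrib)
  also have "\<dots> = ev f v + ev f w"
    by (simp add: ev_superset[of ?A v] ev_superset[of ?A w])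
  finally show ?thesis .
qed

lemma ev_scale [simp]: "ev f (scale q v) = of_rat q * ev f v"
  by (subst ev_superset[OF finite_keys keys_scale])
    (simp add: ev_def sum_distrib_left of_rat_mult mult.assoc)

lemma ev_zero [simp]: "ev f 0 = 0"
  by (simp add: ev_def)

lemma ev_basis [simp]: "ev f (basis a) = f a"
  by (simp add: ev_def)

lemma ev_sum: "ev f (sum g A) = (\<Sum>a\<in>A. ev f (g a))"
  by (induction A rule: infinite_finite_induct) auto

lemma ev_cong: "(\<And>a. a \<in> keys v \<Longrightarrow> f a = g a) \<Longrightarrow> ev f v = ev g v"
  by (simp add: ev_def)

lemma ev_fun_add: "ev (\<lambda>a. f a + g a) v = ev f v + ev g v"
  by (simp add: ev_def algebra_simps sum.distrib)

lemma ev_fun_mult: "ev (\<lambda>a. c * f a) v = c * ev f v"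
  by (simp add: ev_def algebra_simps sum_distrib_left)

lemma ev_lin_ext [simp]: "ev f (lin_ext g v) = ev (\<lambda>a. ev f (g a)) v"
  by (simp add: lin_ext_def ev_sum) (simp add: ev_def)

lemma ev_bilin_ext: "ev f (bilin_ext g v w) = ev (\<lambda>a. ev (\<lambda>b. ev f (g a b)) w) v"
  by (simp add: bilin_ext_def)

text \<open>Indicator functions of single basis elements recover the coefficients. Identities
  between formal combinations can therefore be checked under an arbitrary functional, where the simp
  rules for \<open>ev\<close> apply.\<close>

lemma ev_eqI:
  fixes v w :: "'a \<Rightarrow>\<^sub>0 rat"
  assumes "\<And>f. ev f v = ev f w"
  shows "v = w"
proof (rule poly_mapping_eqI)
  fix a :: 'a
  have *: "ev (\<lambda>b. if b = a then 1 else 0) u = of_rat (coefficient u a)"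
    for u :: "'a \<Rightarrow>\<^sub>0 rat"
    by (simp add: ev_def in_keys_iff if_distrib[where f = "\<lambda>x. _ * x"] sum.delta cong: if_cong)
  show "coefficient v a = coefficient w a"
    using assms[of "\<lambda>b. if b = a then 1 else 0"] by (simp add: *)
qed

lemma lin_ext_basis [simp]: "lin_ext g (basis a) = g a"
  by (rule ev_eqI) simp

lemma bilin_ext_basis [simp]: "bilin_ext g (basis a) (basis b) = g a b"
  by (simp add: bilin_ext_def)

lemma keys_lin_ext: "keys (lin_ext g v) \<subseteq> (\<Union>a\<in>keys v. keys (g a))"
proof -
  have "keys (lin_ext g v) \<subseteq>
      (\<Union>a\<in>keys v. keys (scale (coefficient v a) (g a)))"
    unfolding lin_ext_def by (rule keys_sum)
  also have "\<dots> \<subseteq> (\<Union>a\<in>keys v. keys (g a))"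
    by (intro UN_mono order.refl keys_scale)
  finally show ?thesis .
qed

lemma keys_bilin_ext:
  "keys (bilin_ext g v w) \<subseteq>
     (\<Union>a\<in>keys v. \<Union>b\<in>keys w. keys (g a b))"
  unfolding bilin_ext_def
  by (rule order.trans[OF keys_lin_ext]) (intro UN_mono order.refl keys_lin_ext)

lemma keys_plusD: "a \<in> keys (v + w) \<Longrightarrow> a \<in> keys v \<or> a \<in> keys w"
  using keys_add[of v w] by auto

lemma keys_lin_ext_basisD:
  "b \<in> keys (lin_ext (\<lambda>a. basis (h a)) v) \<Longrightarrow> \<exists>a\<in>keys v. b = h a"
  using keys_lin_ext[of "\<lambda>a. basis (h a)" v] by auto

lemma ev_product_character:
  assumes "\<And>a b. a \<in> keys v \<Longrightarrow> b \<in> keys w \<Longrightarrow> ev f (g a b) = f a * f b"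
  shows "ev f (bilin_ext g v w) = ev f v * ev f w"
proof -
  have "ev f (bilin_ext g v w) = ev (\<lambda>a. ev (\<lambda>b. f a * f b) w) v"
    unfolding ev_bilin_ext by (intro ev_cong) (use assms in auto)
  also have "\<dots> = ev f v * ev f w"
    by (simp add: ev_fun_mult) (simp add: ev_def sum_distrib_right mult.assoc)
  finally show ?thesis .
qed


section \<open>The shuffle product of words\<close>

lemma shuffle_word_Nil2 [simp]: "shuffle_word v [] = basis v"
  by (cases v) auto

lemma ev_shuffle_commute: "ev f (shuffle_word v w) = ev f (shuffle_word w v)"
  by (induction v w arbitrary: f rule: shuffle_word.induct) auto

text \<open>\<open>shuffle_word\<close> recurses on first letters, whereas differentiating an
  iterated integral removes the last letter; this is the bridge. When one factor is a single letter,
  the recursion runs along the other factor alone, hence the separate inductions.\<close>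

lemma ev_shuffle_snoc:
  "ev f (shuffle_word (v @ [a]) (w @ [b])) =
     ev (\<lambda>u. f (u @ [a])) (shuffle_word v (w @ [b])) + ev (\<lambda>u. f (u @ [b])) (shuffle_word (v @ [a]) w)"
proof (induction v w arbitrary: f rule: shuffle_word.induct)
  case (1 w)
  show ?case
    by (induction w arbitrary: f) (auto simp: algebra_simps)
next
  case (2 c v)
  show ?case
    by (induction v arbitrary: c f) (auto simp: algebra_simps)
next
  case (3 c v d w)
  show ?case
    using 3[of "\<lambda>u. f (c # u)"] 3(2)[of "\<lambda>u. f (d # u)"]
    by (simp add: algebra_simps)
qed

lemma shuffle_word_snoc:
  "shuffle_word (v @ [a]) (w @ [b]) =
     lin_ext (\<lambda>u. basis (u @ [a])) (shuffle_word v (w @ [b]))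
   + lin_ext (\<lambda>u. basis (u @ [b])) (shuffle_word (v @ [a]) w)"
  by (rule ev_eqI) (simp add: ev_shuffle_snoc)

lemma mset_shuffle_word:
  "u \<in> keys (shuffle_word v w) \<Longrightarrow> mset u = mset v + mset w"
  by (induction v w arbitrary: u rule: shuffle_word.induct)
    (auto dest!: keys_plusD keys_lin_ext_basisD split: if_splits)

text \<open>With \<open>a\<close> the letter \<open>y\<close>, this is closure of the words of
  indices under the shuffle product, on which the meaning of \<open>shuffle_prod\<close>
  depends.\<close>

lemma hd_shuffle_word:
  assumes "u \<in> keys (shuffle_word v w)"
    "v = [] \<or> hd v = a" "w = [] \<or> hd w = a"
  shows "u = [] \<or> hd u = a"
  using assms
  by (cases "(v, w)" rule: shuffle_word.cases)
    (auto dest!: keys_plusD keys_lin_ext_basisD split: if_splits)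


section \<open>Indices and words\<close>

text \<open>Scanning a word from the left yields the number of leading letters \<open>x\<close> and the
  index, in reversed order, of the remaining word.\<close>

fun parse_step :: "nat \<times> nat list \<Rightarrow> letter \<Rightarrow> nat \<times> nat list" where
  "parse_step (m, []) Letter_x = (Suc m, [])"
| "parse_step (m, k # ks) Letter_x = (m, Suc k # ks)"
| "parse_step (m, ks) Letter_y = (m, 1 # ks)"

definition parse :: "letter list \<Rightarrow> nat \<times> nat list" where
  "parse w = foldl parse_step (0, []) w"

lemma parse_Nil [simp]: "parse [] = (0, [])"
  by (simp add: parse_def)

lemma parse_snoc [simp]: "parse (w @ [a]) = parse_step (parse w) a"
  by (simp add: parse_def)

definition index_of_word :: "letter list \<Rightarrow> nat list" where
  "index_of_word w = rev (snd (parse w))"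

lemma parse_step_replicate_x: "foldl parse_step (m, k # ks) (replicate j Letter_x) = (m, (k + j) # ks)"
  by (induction j arbitrary: k) auto

lemma parse_replicate_x: "parse (replicate m Letter_x) = (m, [])"
proof -
  have "foldl parse_step (i, []) (replicate m Letter_x) = (i + m, [])" for i
    by (induction m arbitrary: i) auto
  thus ?thesis by (simp add: parse_def)
qed

lemma foldl_parse_word_of_index:
  assumes "is_index ks"
  shows "foldl parse_step (m, ls) (word_of_index ks) = (m, rev ks @ ls)"
  using assms
proof (induction ks arbitrary: ls)
  case (Cons k ks)
  have "foldl parse_step (m, 1 # ls) (replicate (k - 1) Letter_x) = (m, k # ls)"
    using Cons.prems parse_step_replicate_x[of m 1 ls "k - 1"] by (simp add: is_index_def)
  moreover have "parse_step (m, ls) Letter_y = (m, 1 # ls)" by (cases ls) auto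
  ultimately show ?case
    using Cons by (simp add: word_of_index_def is_index_def)
qed (simp add: word_of_index_def)

lemma parse_word_of_index: "is_index ks \<Longrightarrow> parse (replicate m Letter_x @ word_of_index ks) = (m, rev ks)"
  using foldl_parse_word_of_index[of ks m "[]"] parse_replicate_x[of m] by (simp add: parse_def)

lemma index_of_word_of_index [simp]: "is_index ks \<Longrightarrow> index_of_word (word_of_index ks) = ks"
  using parse_word_of_index[of ks 0] by (simp add: index_of_word_def)

lemma word_of_index_append [simp]: "word_of_index (ks @ ls) = word_of_index ks @ word_of_index ls"
  by (simp add: word_of_index_def)

lemma word_of_index_Nil [simp]: "word_of_index [] = []"
  by (simp add: word_of_index_def)

lemma word_of_index_Cons: "word_of_index (k # ks) = Letter_y # replicate (k - 1) Letter_x @ word_of_index ks"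
  by (simp add: word_of_index_def)

lemma parse_is_index: "is_index (snd (parse w))"
proof (induction w rule: rev_induct)
  case (snoc a w)
  then show ?case
    by (cases "(parse w, a)" rule: parse_step.cases) (auto simp: is_index_def)
qed (simp add: is_index_def)

lemma is_index_of_word [simp]: "is_index (index_of_word w)"
  using parse_is_index[of w] by (simp add: index_of_word_def is_index_def)

lemma word_eq_parse:
  "replicate (fst (parse w)) Letter_x @ word_of_index (rev (snd (parse w))) = w"
proof (induction w rule: rev_induct)
  case (snoc a w)
  have ind: "is_index (snd (parse w))" by (rule parse_is_index)
  show ?case
  proof (cases "(parse w, a)" rule: parse_step.cases)
    case (1 m)
    then show ?thesis using snoc by (auto simp: replicate_append_same)
  next
    case (2 m k ks)
    have "k \<ge> 1" using ind 2 by (auto simp: is_index_def)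
    hence *: "replicate k Letter_x = replicate (k - 1) Letter_x @ [Letter_x]"
      by (cases k) (auto simp: replicate_append_same)
    have "replicate m Letter_x @ word_of_index (rev (k # ks)) = w"
      using snoc 2 by auto
    then show ?thesis using 2 by (auto simp: word_of_index_Cons *)
  next
    case (3 m ks)
    then show ?thesis using snoc by (auto simp: word_of_index_Cons)
  qed
qed simp

lemma word_of_index_of_word:
  assumes "w = [] \<or> hd w = Letter_y"
  shows "word_of_index (index_of_word w) = w"
proof -
  have "fst (parse w) = 0"
    using assms word_eq_parse[of w] by (cases "fst (parse w)"; cases w) auto
  thus ?thesis using word_eq_parse[of w] by (simp add: index_of_word_def)
qed

lemma hd_word_of_index: "word_of_index ks = [] \<or> hd (word_of_index ks) = Letter_y"
  by (cases ks) (auto simp: word_of_index_Cons)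

lemma to_words_ev: "ev f (to_words v) = ev (\<lambda>ks. f (word_of_index ks)) v"
  by (simp add: to_words_def)

lemma keys_to_words:
  "u \<in> keys (to_words v) \<Longrightarrow> \<exists>ks\<in>keys v. u = word_of_index ks"
  unfolding to_words_def by (rule keys_lin_ext_basisD)

definition from_words :: "(letter list \<Rightarrow>\<^sub>0 rat) \<Rightarrow> (nat list \<Rightarrow>\<^sub>0 rat)" where
  "from_words = lin_ext (\<lambda>w. basis (index_of_word w))"

lemma from_words_ev: "ev f (from_words v) = ev (\<lambda>w. f (index_of_word w)) v"
  by (simp add: from_words_def)

lemma from_to_words: "v \<in> index_space \<Longrightarrow> from_words (to_words v) = v"
  by (rule ev_eqI) (auto simp: from_words_ev to_words_ev index_space_def intro!: ev_cong)

lemma to_from_words: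
  assumes "\<And>u. u \<in> keys w \<Longrightarrow> u = [] \<or> hd u = Letter_y"
  shows "to_words (from_words w) = w"
  by (rule ev_eqI)
    (auto simp: from_words_ev to_words_ev word_of_index_of_word assms intro!: ev_cong)

lemma keys_from_words:
  "ks \<in> keys (from_words v) \<Longrightarrow> \<exists>u\<in>keys v. ks = index_of_word u"
  unfolding from_words_def by (rule keys_lin_ext_basisD)

lemma from_words_in_index_space: "from_words w \<in> index_space"
  by (auto simp: index_space_def dest!: keys_from_words)

text \<open>Words occurring in the product again start with \<open>y\<close> or are empty, so the
  product lies in the image of \<open>to_words\<close>, and there the abstract inverse is the
  explicit map \<open>from_words\<close>.\<close>

lemma shuffle_prod_eq:
  "shuffle_prod v w = from_words (bilin_ext shuffle_word (to_words v) (to_words w))"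
  and to_words_shuffle_prod:
  "to_words (shuffle_prod v w) = bilin_ext shuffle_word (to_words v) (to_words w)"
proof -
  let ?p = "bilin_ext shuffle_word (to_words v) (to_words w)"
  have inj: "inj_on to_words index_space"
    by (rule inj_on_inverseI[of _ from_words]) (rule from_to_words)
  have keys: "u = [] \<or> hd u = Letter_y" if asm: "u \<in> keys ?p" for u
  proof -
    obtain a b where ab: "a \<in> keys (to_words v)" "b \<in> keys (to_words w)"
      and u: "u \<in> keys (shuffle_word a b)"
      using asm keys_bilin_ext[of shuffle_word "to_words v" "to_words w"] by auto
    have "a = [] \<or> hd a = Letter_y" "b = [] \<or> hd b = Letter_y"
      using keys_to_words[OF ab(1)] keys_to_words[OF ab(2)] hd_word_of_index by auto
    thus ?thesis by (rule hd_shuffle_word[OF u])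
  qed
  have eq: "to_words (from_words ?p) = ?p"
    using keys by (rule to_from_words)
  show 1: "shuffle_prod v w = from_words ?p"
    unfolding shuffle_prod_def
    by (intro the_inv_into_f_eq inj eq from_words_in_index_space)
  show "to_words (shuffle_prod v w) = ?p"
    unfolding 1 by (rule eq)
qed

lemma double_rev_induct [case_names Nil1 Nil2 snoc]:
  assumes "\<And>ls. P [] ls" "\<And>ks. P ks []"
    "\<And>ks k ls l. P ks (ls @ [l]) \<Longrightarrow> P ks ls \<Longrightarrow> P (ks @ [k]) ls \<Longrightarrow> P (ks @ [k]) (ls @ [l])"
  shows "P ks ls"
proof (induction "length ks + length ls" arbitrary: ks ls rule: less_induct)
  case less
  show ?case
  proof (cases "ks = [] \<or> ls = []")
    case True
    thus ?thesis using assms(1,2) by auto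
  next
    case False
    then obtain ks' k ls' l where eq: "ks = ks' @ [k]" "ls = ls' @ [l]"
      by (metis append_butlast_last_id)
    show ?thesis unfolding eq by (rule assms(3)) (rule less; simp add: eq)+
  qed
qed

section \<open>Uniqueness of the regularizations\<close>

lemma harmonic_index_Nil [simp]: "harmonic_index [] ls = basis ls" "harmonic_index ks [] = basis ks"
  by (subst harmonic_index.simps; simp)+

lemma harmonic_index_snoc:
  "harmonic_index (ks @ [k]) (ls @ [l]) =
     lin_ext (\<lambda>ms. basis (ms @ [k])) (harmonic_index ks (ls @ [l]))
   + lin_ext (\<lambda>ms. basis (ms @ [k + l])) (harmonic_index ks ls)
   + lin_ext (\<lambda>ms. basis (ms @ [l])) (harmonic_index (ks @ [k]) ls)"
  by (subst harmonic_index.simps) simp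

lemma is_index_simps [simp]:
  "is_index []" "is_index (k # ks) \<longleftrightarrow> 1 \<le> k \<and> is_index ks"
  "is_index (ks @ ls) \<longleftrightarrow> is_index ks \<and> is_index ls" "is_index (rev ks) \<longleftrightarrow> is_index ks"
  "is_index (replicate n k) \<longleftrightarrow> n = 0 \<or> 1 \<le> k"
  by (auto simp: is_index_def)

lemma admissible_Nil [simp]: "admissible []"
  by (simp add: admissible_def)

lemma admissible_snoc [simp]: "admissible (ks @ [k]) \<longleftrightarrow> is_index ks \<and> 1 < k"
  by (auto simp: admissible_def)

lemma is_index_harmonic_index:
  assumes "is_index ks" "is_index ls" "ms \<in> keys (harmonic_index ks ls)"
  shows "is_index ms"
  using assms
proof (induction ks ls arbitrary: ms rule: double_rev_induct)
  case (snoc ks k ls l)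
  from snoc.prems(3) consider
      u where "u \<in> keys (harmonic_index ks (ls @ [l]))" "ms = u @ [k]"
    | u where "u \<in> keys (harmonic_index ks ls)" "ms = u @ [k + l]"
    | u where "u \<in> keys (harmonic_index (ks @ [k]) ls)" "ms = u @ [l]"
    unfolding harmonic_index_snoc by (auto dest!: keys_plusD keys_lin_ext_basisD)
  thus ?case
  proof cases
    case 1
    with snoc.IH(1)[of u] snoc.prems(1,2) show ?thesis by simp
  next
    case 2
    with snoc.IH(2)[of u] snoc.prems(1,2) show ?thesis by simp
  next
    case 3
    with snoc.IH(3)[of u] snoc.prems(1,2) show ?thesis by simp
  qed
qed auto

text \<open>The last component of each term is \<open>k\<close>, \<open>l\<close> or
  \<open>k + l\<close>, all greater than 1.\<close>

lemma admissible_harmonic_index: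
  assumes "admissible ks" "admissible ls" "ms \<in> keys (harmonic_index ks ls)"
  shows "admissible ms"
proof (cases ks rule: rev_cases)
  case 1: (snoc ks' k)
  show ?thesis
  proof (cases ls rule: rev_cases)
    case (snoc ls' l)
    have "is_index ks" "is_index ls" using assms by (auto simp: admissible_def)
    hence "is_index ms" using assms is_index_harmonic_index by blast
    thus ?thesis
      using assms unfolding 1 snoc
      by (auto simp: harmonic_index_snoc dest!: keys_plusD keys_lin_ext_basisD)
  qed (use assms in simp)
qed (use assms in simp)

lemma index_space_basis [simp]: "basis ks \<in> index_space \<longleftrightarrow> is_index ks"
  by (simp add: index_space_def)

lemma index_space_add [intro]: "v \<in> index_space \<Longrightarrow> w \<in> index_space \<Longrightarrow> v + w \<in> index_space"
  by (auto simp: index_space_def dest!: keys_plusD)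

lemma index_space_scale [intro]: "v \<in> index_space \<Longrightarrow> scale q v \<in> index_space"
  using keys_scale[of q v] by (auto simp: index_space_def)

lemma index_space_0 [simp]: "0 \<in> index_space"
  by (simp add: index_space_def)

lemma harmonic_prod_in_index_space:
  assumes "v \<in> index_space" "w \<in> index_space"
  shows "harmonic_prod v w \<in> index_space"
  using assms keys_bilin_ext[of harmonic_index v w] is_index_harmonic_index
  unfolding harmonic_prod_def index_space_def by blast

section \<open>Recursion on the number of trailing ones\<close>

definition trailing_ones :: "nat \<Rightarrow> nat list set" where
  "trailing_ones j = {ks @ replicate i 1 | ks i. admissible ks \<and> i \<le> j}"

lemma index_eq_trailing_ones:
  assumes "is_index ks"
  shows "\<exists>ls j. admissible ls \<and> ks = ls @ replicate j 1"
  using assms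
proof (induction ks rule: rev_induct)
  case (snoc k ks)
  show ?case
  proof (cases "k = 1")
    case True
    from snoc obtain ls j where "admissible ls" "ks = ls @ replicate j 1" by auto
    thus ?thesis using True by (intro exI[of _ ls] exI[of _ "Suc j"]) (auto simp: replicate_append_same)
  next
    case False
    thus ?thesis using snoc.prems by (intro exI[of _ "ks @ [k]"] exI[of _ 0]) auto
  qed
qed auto

lemma trailing_ones_is_index: "ks \<in> trailing_ones j \<Longrightarrow> is_index ks"
  by (auto simp: trailing_ones_def admissible_def)

text \<open>A regularization sends the left side to 0, because it sends \<open>basis [1]\<close> to
  0. The equation then expresses the value with \<open>Suc j\<close> trailing ones through values
  with at most \<open>j\<close> of them; the factor \<open>Suc j\<close> counts the places where the
  new 1 joins the final block.\<close>

definition regularizable :: "((nat list \<Rightarrow>\<^sub>0 rat) \<Rightarrow> (nat list \<Rightarrow>\<^sub>0 rat) \<Rightarrow> (nat list \<Rightarrow>\<^sub>0 rat)) \<Rightarrow> bool" where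
  "regularizable prd \<longleftrightarrow> (\<forall>ks j. admissible ks \<longrightarrow> (\<exists>r. keys r \<subseteq> trailing_ones j \<and>
     prd (basis [1]) (basis (ks @ replicate j 1)) =
       scale (of_nat (Suc j)) (basis (ks @ replicate (Suc j) 1)) + r))"

lemma replicate_snoc: "replicate (Suc j) a = replicate j a @ [a]"
  by (simp add: replicate_append_same)

text \<open>Common core of both products: \<open>h\<close> multiplies by the single letter
  \<open>e\<close>, \<open>c\<close> collects the merged terms (\<open>basis (w @ [1 + a])\<close>
  for the harmonic product, 0 for the shuffle product), and \<open>P\<close> describes the words
  allowed in front of the final block of \<open>e\<close>.\<close>

lemma insertion_expansion:
  fixes h :: "'a list \<Rightarrow> ('a list \<Rightarrow>\<^sub>0 rat)"
  assumes h: "h [] = basis [e]"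
      "\<And>w a. h (w @ [a]) = basis (w @ [a, e]) + c w a + lin_ext (\<lambda>u. basis (u @ [a])) (h w)"
    and P: "\<And>w a u. P (w @ [a]) \<Longrightarrow> u \<in> keys (h w) \<Longrightarrow> P (u @ [a])"
      "\<And>w a u. P (w @ [a]) \<Longrightarrow> u \<in> keys (c w a) \<Longrightarrow> P u"
      "\<And>w j u. P w \<Longrightarrow> u \<in> keys (c (w @ replicate j e) e) \<Longrightarrow> P u"
    and w: "P w"
  shows "\<exists>r. keys r \<subseteq> {v @ replicate i e | v i. P v \<and> i \<le> j} \<and>
     h (w @ replicate j e) = scale (of_nat (Suc j)) (basis (w @ replicate (Suc j) e)) + r"
proof (induction j)
  case 0
  show ?case
  proof (cases w rule: rev_cases)
    case Nil
    thus ?thesis using h(1) by (intro exI[of _ 0]) (auto intro!: ev_eqI)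
  next
    case (snoc v a)
    let ?r = "c v a + lin_ext (\<lambda>u. basis (u @ [a])) (h v)"
    have "P u" if "u \<in> keys ?r" for u
      using that P(1,2)[OF w[unfolded snoc]] by (auto dest!: keys_plusD keys_lin_ext_basisD)
    hence "keys ?r \<subseteq> {v @ replicate i e | v i. P v \<and> i \<le> 0}" by auto
    moreover have "h w = scale 1 (basis (w @ [e])) + ?r"
      unfolding snoc h(2) by (rule ev_eqI) simp
    ultimately show ?thesis by auto
  qed
next
  case (Suc j)
  then obtain r where r: "keys r \<subseteq> {v @ replicate i e | v i. P v \<and> i \<le> j}"
    "h (w @ replicate j e) = scale (of_nat (Suc j)) (basis (w @ replicate (Suc j) e)) + r" by blast
  let ?v = "w @ replicate j e"
  let ?r = "c ?v e + lin_ext (\<lambda>u. basis (u @ [e])) r"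
  have "keys ?r \<subseteq> {v @ replicate i e | v i. P v \<and> i \<le> Suc j}"
  proof
    fix u assume "u \<in> keys ?r"
    then consider "P u" | u' where "u' \<in> keys r" "u = u' @ [e]"
      using P(3)[OF w] by (auto dest!: keys_plusD keys_lin_ext_basisD)
    thus "u \<in> {v @ replicate i e | v i. P v \<and> i \<le> Suc j}"
    proof cases
      case 1
      thus ?thesis by force
    next
      case 2
      then obtain v i where "u' = v @ replicate i e" "P v" "i \<le> j" using r(1) by blast
      hence "u = v @ replicate (Suc i) e" "P v" "Suc i \<le> Suc j"
        using 2 by (simp_all add: replicate_snoc del: replicate.simps)
      thus ?thesis by blast
    qed
  qed
  moreover have "w @ replicate (Suc j) e = ?v @ [e]" by (simp add: replicate_snoc del: replicate.simps)
  hence "h (w @ replicate (Suc j) e) = scale (of_nat (Suc (Suc j))) (basis (w @ replicate (Suc (Suc j)) e)) + ?r"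
    by (simp only: h(2) r(2))
      (rule ev_eqI, simp add: replicate_snoc algebra_simps of_rat_add del: replicate.simps)
  ultimately show ?case by blast
qed

lemma regularizable_harmonic: "regularizable harmonic_prod"
  unfolding regularizable_def harmonic_prod_def bilin_ext_basis trailing_ones_def
proof (intro allI impI insertion_expansion[where c = "\<lambda>w a. basis (w @ [1 + a])"])
  show "harmonic_index [1] (w @ [a]) =
      basis (w @ [a, 1]) + basis (w @ [1 + a]) + lin_ext (\<lambda>u. basis (u @ [a])) (harmonic_index [1] w)" for w a
    using harmonic_index_snoc[of "[]" 1 w a] by simp
  show "admissible (u @ [a])" if "admissible (w @ [a])" "u \<in> keys (harmonic_index [1] w)" for u w a
    using that is_index_harmonic_index[of "[1]" w] by simp
qed (auto simp: admissible_def)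

lemma index_of_word_snoc_y:
  "index_of_word (v @ replicate i Letter_y) = index_of_word v @ replicate i 1"
proof (induction i)
  case (Suc i)
  have "index_of_word (u @ [Letter_y]) = index_of_word u @ [1]" for u
    by (cases "parse u" rule: prod.exhaust) (auto simp: index_of_word_def)
  from this[of "v @ replicate i Letter_y"] Suc show ?case
    by (simp flip: replicate_append_same)
qed simp

lemma admissible_index_of_word: "admissible (index_of_word (v @ [Letter_x]))"
proof (cases "parse v")
  case (Pair m ks)
  thus ?thesis using parse_is_index[of v] by (cases ks) (auto simp: index_of_word_def)
qed

lemma word_of_index_ones: "word_of_index (replicate i 1) = replicate i Letter_y"
  by (induction i) (auto simp: word_of_index_Cons)

lemma word_of_index_snoc: "2 \<le> k \<Longrightarrow> word_of_index (ks @ [k]) = word_of_index (ks @ [k - 1]) @ [Letter_x]"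
  by (cases k rule: nat.exhaust; cases "k - 1")
    (auto simp: word_of_index_Cons replicate_append_same)

lemma regularizable_shuffle: "regularizable shuffle_prod"
  unfolding regularizable_def
proof (intro allI impI)
  define P where "P v \<longleftrightarrow> v = [] \<or> (\<exists>u. v = u @ [Letter_x])" for v
  have adm: "admissible (index_of_word v)" if "P v" for v
    using that admissible_index_of_word by (auto simp: P_def index_of_word_def)
  fix ks :: "nat list" and j assume ks: "admissible ks"
  have "P (word_of_index ks)"
    unfolding P_def using ks word_of_index_snoc by (cases ks rule: rev_cases) auto
  hence "\<exists>r. keys r \<subseteq> {v @ replicate i Letter_y | v i. P v \<and> i \<le> j} \<and>
     shuffle_word [Letter_y] (word_of_index ks @ replicate j Letter_y) =
       scale (of_nat (Suc j)) (basis (word_of_index ks @ replicate (Suc j) Letter_y)) + r"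
  proof (intro insertion_expansion[where c = "\<lambda>w a. 0"])
    show "shuffle_word [Letter_y] (w @ [a]) =
        basis (w @ [a, Letter_y]) + 0 + lin_ext (\<lambda>u. basis (u @ [a])) (shuffle_word [Letter_y] w)" for w a
      using shuffle_word_snoc[of "[]" Letter_y w a] by simp
  qed (auto simp: P_def)
  then obtain r where r: "keys r \<subseteq> {v @ replicate i Letter_y | v i. P v \<and> i \<le> j}"
    "shuffle_word [Letter_y] (word_of_index ks @ replicate j Letter_y) =
       scale (of_nat (Suc j)) (basis (word_of_index ks @ replicate (Suc j) Letter_y)) + r" by blast
  have "shuffle_prod (basis [1]) (basis (ks @ replicate j 1)) =
    from_words (shuffle_word [Letter_y] (word_of_index ks @ replicate j Letter_y))"
    by (simp add: shuffle_prod_eq to_words_def word_of_index_ones[unfolded One_nat_def] word_of_index_Cons)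
  also have "\<dots> = scale (of_nat (Suc j)) (basis (ks @ replicate (Suc j) 1)) + from_words r"
    unfolding r(2) using ks
    by (intro ev_eqI) (simp add: from_words_ev index_of_word_snoc_y admissible_def del: replicate.simps)
  finally have "shuffle_prod (basis [1]) (basis (ks @ replicate j 1)) =
       scale (of_nat (Suc j)) (basis (ks @ replicate (Suc j) 1)) + from_words r" .
  moreover have "keys (from_words r) \<subseteq> trailing_ones j"
  proof
    fix ls assume "ls \<in> keys (from_words r)"
    then obtain v i where "ls = index_of_word v @ replicate i 1" "P v" "i \<le> j"
      using r(1) by (auto dest!: keys_from_words simp: index_of_word_snoc_y)
    thus "ls \<in> trailing_ones j" unfolding trailing_ones_def using adm by blast
  qed
  ultimately show "\<exists>r. keys r \<subseteq> trailing_ones j \<and>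
     shuffle_prod (basis [1]) (basis (ks @ replicate j 1)) =
       scale (of_nat (Suc j)) (basis (ks @ replicate (Suc j) 1)) + r" by blast
qed

lemma regularization_ev:
  assumes "is_regularization prd f" "v \<in> index_space"
  shows "f v = ev (\<lambda>ks. f (basis ks)) v"
proof -
  have add: "f (v + w) = f v + f w" if "v \<in> index_space" "w \<in> index_space" for v w
    using assms that by (auto simp: is_regularization_def)
  have scale: "f (scale q v) = of_rat q * f v" if "v \<in> index_space" for q v
    using assms that by (auto simp: is_regularization_def)
  have zero: "f 0 = 0" using add[of 0 0] by simp
  have "f (\<Sum>ks\<in>A. scale (coefficient v ks) (basis ks)) =
        (\<Sum>ks\<in>A. of_rat (coefficient v ks) * f (basis ks)) \<and>
        (\<Sum>ks\<in>A. scale (coefficient v ks) (basis ks)) \<in> index_space"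
    if "finite A" "A \<subseteq> keys v" for A
    using that
  proof (induction A rule: finite_induct)
    case (insert ks A)
    have "basis ks \<in> index_space" using insert.prems assms(2) by (auto simp: index_space_def)
    thus ?case using insert by (simp add: add scale index_space_add index_space_scale)
  qed (simp add: zero)
  from this[of "keys v"]
  have "f (\<Sum>ks\<in>keys v. scale (coefficient v ks) (basis ks)) = ev (\<lambda>ks. f (basis ks)) v"
    by (simp add: ev_def)
  also have "(\<Sum>ks\<in>keys v. scale (coefficient v ks) (basis ks)) = v"
    by (rule ev_eqI) (simp add: ev_sum, simp add: ev_def)
  finally show ?thesis .
qed

text \<open>Strong induction on the number of trailing ones: \<open>regularizable\<close> gives the
  same linear equation for \<open>f\<close> and \<open>g\<close>, with the nonzero leading
  coefficient \<open>Suc i\<close> and a remainder on which both agree already.\<close>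

lemma regularization_unique:
  assumes "regularizable prd" "is_regularization prd f" "is_regularization prd g"
  shows "f = g"
proof -
  have mult: "h (prd v w) = h v * h w"
    if "is_regularization prd h" "v \<in> index_space" "w \<in> index_space" for h v w
    using that by (auto simp: is_regularization_def)
  have eq: "f (basis (ks @ replicate j 1)) = g (basis (ks @ replicate j 1))" if "admissible ks" for ks j
    using that
  proof (induction j arbitrary: ks rule: less_induct)
    case (less j)
    show ?case
    proof (cases j)
      case 0
      thus ?thesis using assms less.prems by (simp add: is_regularization_def)
    next
      case (Suc i)
      from assms(1) less.prems obtain r where r: "keys r \<subseteq> trailing_ones i"
        "prd (basis [1]) (basis (ks @ replicate i 1)) =
           scale (of_nat (Suc i)) (basis (ks @ replicate (Suc i) 1)) + r"
        unfolding regularizable_def by blast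
      have r_space: "r \<in> index_space"
        using r(1) trailing_ones_is_index by (auto simp: index_space_def)
      have ind: "is_index ks" using less.prems by (simp add: admissible_def)
      have *: "of_nat (Suc i) * h (basis (ks @ replicate j 1)) + ev (\<lambda>ks. h (basis ks)) r = 0"
        if h: "is_regularization prd h" for h
      proof -
        have "h (prd (basis [1]) (basis (ks @ replicate i 1))) = 0"
          using ind h by (subst mult[OF h]) (auto simp: is_regularization_def)
        moreover have sp: "scale (of_nat (Suc i)) (basis (ks @ replicate (Suc i) 1)) + r \<in> index_space"
          using ind r_space by (intro index_space_add index_space_scale) auto
        ultimately show ?thesis
          unfolding r(2) regularization_ev[OF h sp] Suc
          by (simp add: of_rat_add del: replicate.simps)
      qed
      have "ev (\<lambda>ks. f (basis ks)) r = ev (\<lambda>ks. g (basis ks)) r"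
        using r(1) less.IH Suc by (intro ev_cong) (fastforce simp: trailing_ones_def)
      with *[OF assms(2)] *[OF assms(3)]
      have "real (Suc i) * f (basis (ks @ replicate j 1)) = real (Suc i) * g (basis (ks @ replicate j 1))"
        by linarith
      thus ?thesis by (simp del: of_nat_Suc)
    qed
  qed
  show ?thesis
  proof (rule extensionalityI[of _ index_space])
    fix v assume v: "v \<in> index_space"
    show "f v = g v"
      unfolding regularization_ev[OF assms(2) v] regularization_ev[OF assms(3) v]
    proof (rule ev_cong)
      fix ks assume "ks \<in> keys v"
      hence "is_index ks" using v by (auto simp: index_space_def)
      thus "f (basis ks) = g (basis ks)"
        using eq index_eq_trailing_ones by blast
    qed
  qed (use assms in \<open>auto simp: is_regularization_def\<close>)
qed

section \<open>Regularized limits\<close>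

text \<open>The error has to be negligible against all powers of \<open>L\<close> to make regularized limits
  multiplicative.\<close>

definition reg_limit :: "'a filter \<Rightarrow> ('a \<Rightarrow> real) \<Rightarrow> ('a \<Rightarrow> real) \<Rightarrow> real \<Rightarrow> bool" where
  "reg_limit F L f c \<longleftrightarrow>
     (\<exists>p. poly p 0 = c \<and> (\<forall>j. ((\<lambda>x. (f x - poly p (L x)) * L x ^ j) \<longlongrightarrow> 0) F))"

lemma negligible_times_poly:
  assumes "\<And>j. ((\<lambda>x. e x * L x ^ j) \<longlongrightarrow> (0::real)) F"
  shows "((\<lambda>x. e x * poly p (L x) * L x ^ j) \<longlongrightarrow> 0) F"
proof (induction p arbitrary: j)
  case (pCons a p)
  have "((\<lambda>x. a * (e x * L x ^ j) + e x * poly p (L x) * L x ^ Suc j) \<longlongrightarrow> a * 0 + 0) F"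
    by (intro tendsto_intros assms pCons.IH)
  thus ?case by (simp add: algebra_simps)
qed simp

lemma reg_limit_poly: "reg_limit F L (\<lambda>x. poly p (L x)) (poly p 0)"
  unfolding reg_limit_def by (intro exI[of _ p]) auto

lemma reg_limit_const: "reg_limit F L (\<lambda>x. c) c"
  using reg_limit_poly[of F L "[:c:]"] by simp

lemma reg_limit_base: "reg_limit F L L 0"
  using reg_limit_poly[of F L "[:0, 1:]"] by simp

lemma reg_limit_add:
  assumes "reg_limit F L f c" "reg_limit F L g d"
  shows "reg_limit F L (\<lambda>x. f x + g x) (c + d)"
proof -
  from assms obtain p q where p: "poly p 0 = c" "\<And>j. ((\<lambda>x. (f x - poly p (L x)) * L x ^ j) \<longlongrightarrow> 0) F"
    and q: "poly q 0 = d" "\<And>j. ((\<lambda>x. (g x - poly q (L x)) * L x ^ j) \<longlongrightarrow> 0) F"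
    unfolding reg_limit_def by blast
  have "((\<lambda>x. (f x + g x - poly (p + q) (L x)) * L x ^ j) \<longlongrightarrow> 0) F" for j
    using tendsto_add[OF p(2)[of j] q(2)[of j]] by (simp add: algebra_simps)
  thus ?thesis unfolding reg_limit_def using p(1) q(1) by (intro exI[of _ "p + q"]) auto
qed

lemma reg_limit_mult:
  assumes "reg_limit F L f c" "reg_limit F L g d"
  shows "reg_limit F L (\<lambda>x. f x * g x) (c * d)"
proof -
  from assms obtain p q where p: "poly p 0 = c" "\<And>j. ((\<lambda>x. (f x - poly p (L x)) * L x ^ j) \<longlongrightarrow> 0) F"
    and q: "poly q 0 = d" "\<And>j. ((\<lambda>x. (g x - poly q (L x)) * L x ^ j) \<longlongrightarrow> 0) F"
    unfolding reg_limit_def by blast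
  have "((\<lambda>x. (f x * g x - poly (p * q) (L x)) * L x ^ j) \<longlongrightarrow> 0) F" for j
  proof -
    have "((\<lambda>x. ((f x - poly p (L x)) * L x ^ 0) * ((g x - poly q (L x)) * L x ^ j)
        + (f x - poly p (L x)) * poly q (L x) * L x ^ j
        + (g x - poly q (L x)) * poly p (L x) * L x ^ j) \<longlongrightarrow> 0 * 0 + 0 + 0) F"
      by (intro tendsto_add tendsto_mult p(2) q(2) negligible_times_poly)
    thus ?thesis by (simp add: algebra_simps)
  qed
  thus ?thesis unfolding reg_limit_def using p(1) q(1) by (intro exI[of _ "p * q"]) auto
qed

lemma reg_limit_cmult: "reg_limit F L f c \<Longrightarrow> reg_limit F L (\<lambda>x. a * f x) (a * c)"
  by (intro reg_limit_mult reg_limit_const)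

lemma reg_limit_sum:
  "(\<And>a. a \<in> A \<Longrightarrow> reg_limit F L (f a) (c a)) \<Longrightarrow> reg_limit F L (\<lambda>x. \<Sum>a\<in>A. f a x) (\<Sum>a\<in>A. c a)"
proof (induction A rule: infinite_finite_induct)
  case (insert a A)
  thus ?case by (simp add: reg_limit_add)
qed (simp_all add: reg_limit_const)

lemma reg_limit_ev:
  assumes "\<And>a. a \<in> keys v \<Longrightarrow> reg_limit F L (f a) (c a)"
  shows "reg_limit F L (\<lambda>x. ev (\<lambda>a. f a x) v) (ev c v)"
  unfolding ev_def by (intro reg_limit_sum reg_limit_cmult assms)

lemma reg_limit_cong:
  assumes "reg_limit F L f c" "eventually (\<lambda>x. f x = g x) F"
  shows "reg_limit F L g c"
proof -
  from assms obtain p where p: "poly p 0 = c" "\<And>j. ((\<lambda>x. (f x - poly p (L x)) * L x ^ j) \<longlongrightarrow> 0) F"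
    unfolding reg_limit_def by blast
  have "((\<lambda>x. (g x - poly p (L x)) * L x ^ j) \<longlongrightarrow> 0) F" for j
    by (rule Lim_transform_eventually[OF p(2)[of j]]) (use assms(2) in eventually_elim, simp)
  thus ?thesis unfolding reg_limit_def using p(1) by auto
qed

text \<open>With its leading coefficient made positive, a nonzero polynomial eventually stays above
  that coefficient. This is what makes asymptotic polynomials, and hence regularized limits,
  unique.\<close>

lemma poly_tendsto_0_imp_0:
  fixes p :: "real poly"
  assumes F: "F \<noteq> bot" "filterlim L at_top F" and lim: "((\<lambda>x. poly p (L x)) \<longlongrightarrow> 0) F"
  shows "p = 0"
proof (rule ccontr)
  assume "p \<noteq> 0"
  define q where "q = smult (sgn (lead_coeff p)) p"
  have q: "lead_coeff q > 0"
    using leading_coeff_neq_0[OF \<open>p \<noteq> 0\<close>] by (auto simp: q_def sgn_if not_less order_le_less)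
  have lim_q: "((\<lambda>x. poly q (L x)) \<longlongrightarrow> 0) F"
    using tendsto_mult[OF tendsto_const[of "sgn (lead_coeff p)"] lim] by (simp add: q_def)
  obtain n where n: "\<And>x. x \<ge> n \<Longrightarrow> poly q x \<ge> lead_coeff q"
    using poly_pinfty_gt_lc[OF q] by blast
  have "eventually (\<lambda>x. L x \<ge> n) F"
    using F(2) by (simp add: filterlim_at_top)
  hence "eventually (\<lambda>x. poly q (L x) \<ge> lead_coeff q) F"
    by eventually_elim (use n in auto)
  hence "0 \<ge> lead_coeff q"
    using tendsto_lowerbound[OF lim_q _ F(1)] by blast
  thus False using q by simp
qed

text \<open>The second expansion comes without any rate: plain convergence of the error already
  identifies the polynomial.\<close>

lemma reg_limit_eqI:
  assumes F: "F \<noteq> bot" "filterlim L at_top F"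
    and "reg_limit F L f c" "((\<lambda>x. f x - poly q (L x)) \<longlongrightarrow> 0) F"
  shows "c = poly q 0"
proof -
  from assms obtain p where p: "poly p 0 = c" "\<And>j. ((\<lambda>x. (f x - poly p (L x)) * L x ^ j) \<longlongrightarrow> 0) F"
    unfolding reg_limit_def by blast
  have "((\<lambda>x. poly (p - q) (L x)) \<longlongrightarrow> 0) F"
    using tendsto_diff[OF assms(4) p(2)[of 0]] by simp
  from poly_tendsto_0_imp_0[OF F this] p(1) show ?thesis by simp
qed

lemma reg_limit_unique:
  assumes F: "F \<noteq> bot" "filterlim L at_top F" and "reg_limit F L f c" "reg_limit F L f d"
  shows "c = d"
proof -
  from assms obtain p where p: "poly p 0 = d" "\<And>j. ((\<lambda>x. (f x - poly p (L x)) * L x ^ j) \<longlongrightarrow> 0) F"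
    unfolding reg_limit_def by blast
  from p(2)[of 0] have "((\<lambda>x. f x - poly p (L x)) \<longlongrightarrow> 0) F" by simp
  from reg_limit_eqI[OF F assms(3) this] p(1) show ?thesis by simp
qed

lemma reg_limit_tendsto:
  assumes "F \<noteq> bot" "filterlim L at_top F" "reg_limit F L f c" "(f \<longlongrightarrow> d) F"
  shows "c = d"
proof -
  have "((\<lambda>x. f x - poly [:d:] (L x)) \<longlongrightarrow> 0) F"
    using tendsto_diff[OF assms(4) tendsto_const[of d]] by simp
  from reg_limit_eqI[OF assms(1-3) this] show ?thesis by simp
qed

lemma reg_limit_strong:
  assumes "\<And>j. ((\<lambda>x. e x * L x ^ j) \<longlongrightarrow> 0) F"
    and "eventually (\<lambda>x. \<bar>f x - poly p (L x)\<bar> \<le> K * \<bar>e x\<bar>) F"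
  shows "reg_limit F L f (poly p 0)"
proof -
  have "((\<lambda>x. (f x - poly p (L x)) * L x ^ j) \<longlongrightarrow> 0) F" for j
  proof (rule Lim_null_comparison)
    have "((\<lambda>x. K * \<bar>e x * L x ^ j\<bar>) \<longlongrightarrow> K * 0) F"
      by (intro tendsto_mult tendsto_const tendsto_rabs_zero assms)
    thus "((\<lambda>x. K * \<bar>e x * L x ^ j\<bar>) \<longlongrightarrow> 0) F" by simp
    show "eventually (\<lambda>x. norm ((f x - poly p (L x)) * L x ^ j) \<le> K * \<bar>e x * L x ^ j\<bar>) F"
      using assms(2)
    proof eventually_elim
      case (elim x)
      have "\<bar>f x - poly p (L x)\<bar> * \<bar>L x ^ j\<bar> \<le> K * \<bar>e x\<bar> * \<bar>L x ^ j\<bar>"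
        using elim by (intro mult_right_mono) auto
      thus ?case by (simp add: abs_mult mult.assoc)
    qed
  qed
  thus ?thesis unfolding reg_limit_def by auto
qed

lemma exp_decay_negligible:
  assumes "filterlim L at_top F" "a > 0"
  shows "((\<lambda>x. exp (- a * L x) * L x ^ j) \<longlongrightarrow> (0::real)) F"
proof -
  have lim: "filterlim (\<lambda>x. a * L x) at_top F"
    by (rule filterlim_tendsto_pos_mult_at_top[OF tendsto_const assms(2,1)])
  have "((\<lambda>x. (1 / a) ^ j * ((a * L x) ^ j / exp (a * L x))) \<longlongrightarrow> (1 / a) ^ j * 0) F"
    by (intro tendsto_mult tendsto_const filterlim_compose[OF tendsto_power_div_exp_0 lim])
  moreover have "(1 / a) ^ j * ((a * L x) ^ j / exp (a * L x)) = exp (- a * L x) * L x ^ j" for x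
    using assms(2) by (simp add: power_mult_distrib exp_minus field_simps)
  ultimately show ?thesis by simp
qed

text \<open>Each power is a single term of the exponential series at \<open>x / 4\<close>. For
  \<open>x\<close> a harmonic number or \<open>Lam u\<close> the bound grows at most like the square
  root of \<open>N\<close> or of \<open>1 / (1 - u)\<close>, so the error sums and integrals below
  converge.\<close>

lemma poly_le_exp:
  fixes p :: "real poly"
  obtains K where "K \<ge> 0" "\<And>x. x \<ge> 0 \<Longrightarrow> \<bar>poly p x\<bar> \<le> K * exp (x / 4)"
proof -
  have pow: "x ^ i \<le> fact i * 4 ^ i * exp (x / 4)" if "x \<ge> 0" for x :: real and i
  proof -
    have "(\<Sum>n\<in>{i}. (x / 4) ^ n /\<^sub>R fact n) \<le> exp (x / 4)"
      unfolding exp_def by (rule sum_le_suminf) (use that summable_exp_generic[of "x / 4"] in auto)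
    thus ?thesis by (simp add: field_simps)
  qed
  define K where "K = (\<Sum>i\<le>degree p. \<bar>coeff p i\<bar> * (fact i * 4 ^ i))"
  have "\<bar>poly p x\<bar> \<le> K * exp (x / 4)" if "x \<ge> 0" for x
  proof -
    have "\<bar>poly p x\<bar> \<le> (\<Sum>i\<le>degree p. \<bar>coeff p i * x ^ i\<bar>)"
      unfolding poly_altdef by (rule sum_abs)
    also have "\<dots> \<le> (\<Sum>i\<le>degree p. \<bar>coeff p i\<bar> * (fact i * 4 ^ i * exp (x / 4)))"
      using pow[OF that] that by (intro sum_mono) (auto simp: abs_mult intro!: mult_left_mono)
    also have "\<dots> = K * exp (x / 4)"
      by (simp add: K_def sum_distrib_right mult.assoc)
    finally show ?thesis .
  qed
  moreover have "K \<ge> 0" by (auto simp: K_def intro!: sum_nonneg)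
  ultimately show ?thesis using that by blast
qed

lemma poly_antiderivative:
  fixes p :: "real poly"
  obtains P where "pderiv P = p"
proof
  have "pderiv (\<Sum>i\<in>A. monom (coeff p i / real (Suc i)) (Suc i)) = (\<Sum>i\<in>A. monom (coeff p i) i)" for A
    by (induction A rule: infinite_finite_induct) (simp_all add: pderiv_add pderiv_monom del: of_nat_Suc)
  thus "pderiv (\<Sum>i\<le>degree p. monom (coeff p i / real (Suc i)) (Suc i)) = p"
    by (simp add: poly_as_sum_of_monoms)
qed

section \<open>Truncated multiple harmonic sums\<close>

text \<open>The index is given in reversed order, so that the largest summation variable is \<open>n + 1\<close>
  and belongs to the head of the list.\<close>

fun hs :: "nat list \<Rightarrow> nat \<Rightarrow> real" where
  "hs [] N = 1"
| "hs (k # ks) N = (\<Sum>n<N. hs ks n / real (Suc n) ^ k)"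

lemma hs_nonneg: "hs ks N \<ge> 0"
  by (induction ks arbitrary: N) (auto intro!: sum_nonneg)

lemma hs_le: "is_index ks \<Longrightarrow> hs ks N \<le> real (Suc N)"
proof (induction ks arbitrary: N)
  case (Cons k ks)
  have "hs ks n / real (Suc n) ^ k \<le> 1" for n
  proof -
    have "hs ks n \<le> real (Suc n) ^ 1" using Cons by simp
    also have "\<dots> \<le> real (Suc n) ^ k"
      using Cons.prems by (intro power_increasing) auto
    finally show ?thesis by (simp add: divide_le_eq_1 del: of_nat_Suc)
  qed
  hence "hs (k # ks) N \<le> (\<Sum>n<N. 1)" unfolding hs.simps by (intro sum_mono)
  thus ?case by simp
qed simp

text \<open>The pairs of outermost variables are split into smaller, equal and larger, which is the
  recursion of the harmonic product.\<close>

lemma hs_mult: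
  "hs (k # ks) N * hs (l # ls) N =
     (\<Sum>n<N. (hs ks n * hs (l # ls) n) / real (Suc n) ^ k + (hs ks n * hs ls n) / real (Suc n) ^ (k + l)
           + (hs (k # ks) n * hs ls n) / real (Suc n) ^ l)"
proof (induction N)
  case (Suc N)
  define a where "a = real (Suc N)"
  have a: "a \<noteq> 0" by (simp add: a_def)
  have "hs (k # ks) (Suc N) = hs (k # ks) N + hs ks N / a ^ k"
    "hs (l # ls) (Suc N) = hs (l # ls) N + hs ls N / a ^ l" by (simp_all add: a_def)
  moreover have "(p + q / a ^ k) * (r + s / a ^ l) =
      p * r + ((q * r) / a ^ k + (q * s) / a ^ (k + l) + (p * s) / a ^ l)" for p q r s
    using a by (simp add: field_simps power_add)
  ultimately have "hs (k # ks) (Suc N) * hs (l # ls) (Suc N) = hs (k # ks) N * hs (l # ls) N +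
     ((hs ks N * hs (l # ls) N) / a ^ k + (hs ks N * hs ls N) / a ^ (k + l)
           + (hs (k # ks) N * hs ls N) / a ^ l)"
    by (simp only:)
  thus ?case using Suc by (simp add: a_def del: hs.simps of_nat_Suc)
qed simp

lemma ev_sum_fun: "ev (\<lambda>a. \<Sum>i\<in>I. f i a) v = (\<Sum>i\<in>I. ev (f i) v)"
  by (induction I rule: infinite_finite_induct) (auto simp: ev_fun_add, auto simp: ev_def)

lemma ev_fun_divide: "ev (\<lambda>a. f a / c) v = ev f v / c"
  using ev_fun_mult[of "1 / c" f v] by simp

lemma hs_harmonic_index:
  "ev (\<lambda>ms. hs (rev ms) N) (harmonic_index ks ls) = hs (rev ks) N * hs (rev ls) N"
proof (induction ks ls arbitrary: N rule: double_rev_induct)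
  case (snoc ks k ls l)
  have "ev (\<lambda>ms. hs (rev ms) N) (harmonic_index (ks @ [k]) (ls @ [l])) =
     (\<Sum>n<N. (hs (rev ks) n * hs (rev (ls @ [l])) n) / real (Suc n) ^ k
           + (hs (rev ks) n * hs (rev ls) n) / real (Suc n) ^ (k + l)
           + (hs (rev (ks @ [k])) n * hs (rev ls) n) / real (Suc n) ^ l)"
    by (simp only: harmonic_index_snoc ev_add ev_lin_ext ev_basis rev_append rev.simps append.simps
        hs.simps ev_sum_fun ev_fun_divide sum.distrib snoc.IH[unfolded rev_append rev.simps append.simps])
  also have "\<dots> = hs (rev (ks @ [k])) N * hs (rev (ls @ [l])) N"
    using hs_mult[of k "rev ks" N l "rev ls"] by (simp del: hs.simps)
  finally show ?case .
qed simp_all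

section \<open>Expansions in the harmonic number with error of order N^(-1/2)\<close>

lemma harm_le_ln: "harm (Suc n) \<le> 1 + ln (real (Suc n))"
proof (induction n)
  case (Suc n)
  have "ln (1 - 1 / real (Suc (Suc n))) \<le> - (1 / real (Suc (Suc n)))"
    using ln_add_one_self_le_self2[of "- (1 / real (Suc (Suc n)))"] by (simp add: field_simps)
  moreover have "1 - 1 / real (Suc (Suc n)) = real (Suc n) / real (Suc (Suc n))"
    by (simp add: field_simps)
  hence "ln (1 - 1 / real (Suc (Suc n))) = ln (real (Suc n)) - ln (real (Suc (Suc n)))"
    by (simp add: ln_div)
  moreover have "harm (Suc (Suc n)) = harm (Suc n) + 1 / real (Suc (Suc n))"
    by (simp add: harm_Suc field_simps)
  ultimately show ?case using Suc by linarith
qed (simp add: harm_def)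

lemma ln_le_harm': "ln (real (Suc n)) \<le> harm n"
  using ln_le_harm[of n] by (simp add: add.commute)

text \<open>Translation between decay in \<open>harm n\<close> and in \<open>sqrt (Suc n)\<close>,
  from the logarithmic bounds on both sides; the constant 2 absorbs
  \<open>exp (1/2)\<close>.\<close>

lemma exp_harm_bounds:
  "exp (- (1/2) * harm n) \<le> 1 / sqrt (real (Suc n))"
  "1 / sqrt (real (Suc n)) \<le> 2 * exp (- (1/2) * harm n)"
  "exp (harm (Suc n) / 4) \<le> 2 * sqrt (real (Suc n))"
proof -
  have e: "exp (ln x / 2) = sqrt x" if "x > 0" for x :: real
    using that by (simp add: ln_sqrt[symmetric])
  have "exp (- (1/2) * harm n) \<le> exp (- (ln (real (Suc n)) / 2))"
    using ln_le_harm'[of n] by simp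
  also have "\<dots> = 1 / sqrt (real (Suc n))"
    using e[of "real (Suc n)"] by (simp add: exp_minus inverse_eq_divide)
  finally show "exp (- (1/2) * harm n) \<le> 1 / sqrt (real (Suc n))" .
  have e2: "exp (1/2) \<le> (2::real)"
  proof -
    have "exp (1/2) ^ 2 = exp (1::real)" by (simp add: power2_eq_square flip: exp_add)
    also have "\<dots> \<le> 2 ^ 2" using exp_le by simp
    finally show ?thesis by (rule power2_le_imp_le) simp
  qed
  have "harm n \<le> 1 + ln (real (Suc n))"
  proof (rule order.trans[OF _ harm_le_ln])
    show "harm n \<le> (harm (Suc n) :: real)" by (simp add: harm_Suc)
  qed
  hence le: "exp (- (1/2) * (1 + ln (real (Suc n)))) \<le> exp (- (1/2) * harm n)"
    by simp
  have "exp (- (1/2) * (1 + ln (real (Suc n)))) = 1 / (exp (1/2) * sqrt (real (Suc n)))"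
  proof -
    have "- (1/2) * (1 + ln (real (Suc n))) = - (1/2 + ln (real (Suc n)) / 2)" by (simp add: field_simps)
    thus ?thesis using e[of "real (Suc n)"] by (simp add: exp_minus exp_diff inverse_eq_divide del: of_nat_Suc)
  qed
  hence "1 / sqrt (real (Suc n)) = exp (1/2) * exp (- (1/2) * (1 + ln (real (Suc n))))" by simp
  also have "\<dots> \<le> exp (1/2) * exp (- (1/2) * harm n)" by (rule mult_left_mono[OF le]) simp
  also have "\<dots> \<le> 2 * exp (- (1/2) * harm n)" using e2 by (intro mult_right_mono) auto
  finally show "1 / sqrt (real (Suc n)) \<le> 2 * exp (- (1/2) * harm n)" .
  have "exp (harm (Suc n) / 4) \<le> exp (harm (Suc n) / 2 :: real)"
    using harm_nonneg[of "Suc n", where 'a = real] by simp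
  also have "\<dots> \<le> exp (1 / 2 + ln (real (Suc n)) / 2)"
    using harm_le_ln[of n] by simp
  also have "\<dots> = exp (1/2) * sqrt (real (Suc n))" using e[of "real (Suc n)"] by (simp add: exp_add)
  also have "\<dots> \<le> 2 * sqrt (real (Suc n))" using e2 by (intro mult_right_mono) auto
  finally show "exp (harm (Suc n) / 4) \<le> 2 * sqrt (real (Suc n))" .
qed

text \<open>Terms of order n^(-3/2) are dominated by the differences of
  \<open>6 * K / sqrt (real (Suc n))\<close>, so a telescoping series gives summability and the tail
  estimate together.\<close>

lemma sum_tail_bound:
  fixes e :: "nat \<Rightarrow> real"
  assumes e: "\<And>n. \<bar>e n\<bar> \<le> K / (real (Suc n) * sqrt (real (Suc n)))"
  shows "summable (\<lambda>n. \<bar>e n\<bar>)" "\<bar>(\<Sum>n<N. e n) - suminf e\<bar> \<le> 6 * K / sqrt (real (Suc N))"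
proof -
  have K: "K \<ge> 0" using e[of 0] by simp
  define g where "g n = 6 * K / sqrt (real (Suc n))" for n
  have bound: "\<bar>e n\<bar> \<le> g n - g (Suc n)" for n
  proof -
    define a b where "a = sqrt (real (Suc n))" and "b = sqrt (real (Suc (Suc n)))"
    have ab: "a \<ge> 1" "b \<ge> a" "b\<^sup>2 = a\<^sup>2 + 1" "a\<^sup>2 = real (Suc n)" by (auto simp: a_def b_def)
    have "b\<^sup>2 \<le> (3/2 * a)\<^sup>2"
    proof -
      have "1 \<le> a\<^sup>2" using ab by simp
      thus ?thesis using ab(3) by (simp add: power_mult_distrib power2_eq_square)
    qed
    hence b: "b \<le> 3/2 * a" using ab by (intro power2_le_imp_le[of b]) auto
    have "(b - a) * (b + a) = 1" using ab(3) by (simp add: power2_eq_square algebra_simps)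
    hence "b - a = 1 / (b + a)" using ab by (simp add: field_simps)
    moreover have "1 / (5/2 * a) \<le> 1 / (b + a)" using b ab by (intro frac_le) auto
    ultimately have ge: "b - a \<ge> 1 / (5/2 * a)" by simp
    \<comment> \<open>The constant 6 is large enough because the estimates
      \<open>b - a \<ge> 1 / (5/2 * a)\<close> and \<open>b \<le> 3/2 * a\<close> leave 6 / (5/2 *
      3/2) = 8/5, which is at least 1.\<close>
    have "1 / (a\<^sup>2 * a) \<le> 6 * ((b - a) / (a * b))"
    proof -
      have "1 / (a\<^sup>2 * a) \<le> 8/5 * (1 / (a\<^sup>2 * a))"
        using mult_right_mono[of 1 "8/5" "1 / (a\<^sup>2 * a)"] ab(1) by simp
      also have "\<dots> = 6 * ((1 / (5/2 * a)) / (a * (3/2 * a)))"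
        by (simp add: power2_eq_square)
      also have "\<dots> \<le> 6 * ((b - a) / (a * b))"
        using ge b ab by (intro mult_left_mono frac_le) (auto intro!: mult_pos_pos mult_left_mono)
      finally show ?thesis .
    qed
    hence "K * (1 / (a\<^sup>2 * a)) \<le> K * (6 * ((b - a) / (a * b)))" using K by (intro mult_left_mono)
    also have "\<dots> = g n - g (Suc n)"
    proof -
      have "a > 0" "b > 0" using ab by linarith+
      thus ?thesis unfolding g_def a_def[symmetric] b_def[symmetric] by (simp add: field_simps)
    qed
    finally show ?thesis using e[of n] ab(4) by (simp add: a_def del: of_nat_Suc)
  qed
  have "(\<lambda>n. 6 * K / sqrt (real (Suc n))) \<longlonglongrightarrow> 0" by real_asymp
  hence g0: "g \<longlonglongrightarrow> 0" by (simp add: g_def[abs_def])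
  have gs: "(\<lambda>n. g (n + M) - g (Suc (n + M))) sums (g M)" for M
  proof -
    have "(\<lambda>n. g (n + M)) \<longlonglongrightarrow> 0" using LIMSEQ_ignore_initial_segment[OF g0] .
    from telescope_sums'[OF this] show ?thesis by simp
  qed
  show s: "summable (\<lambda>n. \<bar>e n\<bar>)"
    by (rule summable_comparison_test'[OF sums_summable[OF gs[of 0]], of 0]) (use bound in simp)
  have s': "summable (\<lambda>n. \<bar>e (n + N)\<bar>)" using s by (rule summable_ignore_initial_segment)
  have "suminf e = suminf (\<lambda>n. e (n + N)) + (\<Sum>n<N. e n)"
    using suminf_split_initial_segment[OF summable_rabs_cancel[OF s]] .
  hence "\<bar>(\<Sum>n<N. e n) - suminf e\<bar> = \<bar>suminf (\<lambda>n. e (n + N))\<bar>" by simp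
  also have "\<dots> \<le> suminf (\<lambda>n. \<bar>e (n + N)\<bar>)" by (rule summable_rabs[OF s'])
  also have "\<dots> \<le> g N"
    unfolding sums_unique[OF gs[of N]]
    by (rule suminf_le[OF _ s' sums_summable[OF gs]]) (use bound in simp)
  finally show "\<bar>(\<Sum>n<N. e n) - suminf e\<bar> \<le> 6 * K / sqrt (real (Suc N))" by (simp add: g_def)
qed


lemma hs_bound_of_expansion:
  assumes "\<And>N. \<bar>hs ks N - poly p (harm N)\<bar> \<le> K / sqrt (real (Suc N))"
  obtains C where "C \<ge> 0" "\<And>N. \<bar>hs ks N\<bar> \<le> C * sqrt (real (Suc N))"
proof -
  have K: "K \<ge> 0" using assms[of 0] by simp
  obtain C where C: "C \<ge> 0" "\<And>x. x \<ge> 0 \<Longrightarrow> \<bar>poly p x\<bar> \<le> C * exp (x / 4)"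
    using poly_le_exp by blast
  have "\<bar>hs ks N\<bar> \<le> (2 * C + K) * sqrt (real (Suc N))" for N
  proof -
    have "harm N \<le> (harm (Suc N) :: real)" by (simp add: harm_Suc)
    hence "exp (harm N / 4) \<le> 2 * sqrt (real (Suc N))"
      using exp_harm_bounds(3)[of N] by (intro order.trans[OF _ exp_harm_bounds(3)]) simp
    hence "C * exp (harm N / 4) \<le> C * (2 * sqrt (real (Suc N)))" using C by (intro mult_left_mono)
    moreover have "\<bar>poly p (harm N)\<bar> \<le> C * exp (harm N / 4)" by (rule C(2)[OF harm_nonneg])
    moreover have "K / sqrt (real (Suc N)) \<le> K * sqrt (real (Suc N))"
    proof -
      have "1 \<le> sqrt (real (Suc N))" by simp
      hence "1 / sqrt (real (Suc N)) \<le> sqrt (real (Suc N))"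
        by (metis div_by_1 divide_self dual_order.trans le_numeral_extra(1) frac_le not_one_le_zero order.refl zero_le_one zero_less_one)
      thus ?thesis using mult_left_mono[OF _ K, of "1 / sqrt (real (Suc N))" "sqrt (real (Suc N))"] by simp
    qed
    ultimately show ?thesis using assms[of N] by (simp add: algebra_simps)
  qed
  moreover have "2 * C + K \<ge> 0" using C K by simp
  ultimately show ?thesis using that by blast
qed

text \<open>Inner sums of order sqrt n divided by a power of at least n^2 have order
  n^(-3/2).\<close>

lemma hs_expansion_step_convergent:
  assumes "2 \<le> k" "\<And>N. \<bar>hs ks N\<bar> \<le> C * sqrt (real (Suc N))"
  shows "\<bar>hs (k # ks) N - suminf (\<lambda>n. hs ks n / real (Suc n) ^ k)\<bar> \<le> 6 * C / sqrt (real (Suc N))"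
    and "summable (\<lambda>n. hs ks n / real (Suc n) ^ k)"
proof -
  have C: "C \<ge> 0" using assms(2)[of 0] by simp
  have bound: "\<bar>hs ks n / real (Suc n) ^ k\<bar> \<le> C / (real (Suc n) * sqrt (real (Suc n)))" for n
  proof -
    define s where "s = sqrt (real (Suc n))"
    have s: "s > 0" "s\<^sup>2 = real (Suc n)" by (auto simp: s_def)
    have "\<bar>hs ks n / real (Suc n) ^ k\<bar> = \<bar>hs ks n\<bar> / real (Suc n) ^ k" by simp
    also have "\<dots> \<le> C * s / real (Suc n) ^ 2"
      using assms C s by (intro frac_le power_increasing) (auto simp: s_def)
    also have "\<dots> = C / (real (Suc n) * s)"
      unfolding s(2)[symmetric] using s(1) by (simp add: field_simps power2_eq_square)
    finally show ?thesis by (simp add: s_def)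
  qed
  from sum_tail_bound(2)[OF bound, of N]
  show "\<bar>hs (k # ks) N - suminf (\<lambda>n. hs ks n / real (Suc n) ^ k)\<bar> \<le> 6 * C / sqrt (real (Suc N))"
    by simp
  show "summable (\<lambda>n. hs ks n / real (Suc n) ^ k)"
    using sum_tail_bound(1)[OF bound] by (rule summable_rabs_cancel)
qed

text \<open>With \<open>P\<close> an antiderivative of \<open>p\<close>, the term
  \<open>p (harm n) / (n + 1)\<close> is nearly the increment of \<open>P\<close> along the harmonic
  numbers. Two applications of the mean value theorem bound the discrepancy by order n^(-3/2), and
  the constant of the new polynomial is the sum of these discrepancies.\<close>

lemma hs_expansion_step_divergent:
  assumes "\<And>N. \<bar>hs ks N - poly p (harm N)\<bar> \<le> K / sqrt (real (Suc N))"
  shows "\<exists>q K. \<forall>N. \<bar>hs (1 # ks) N - poly q (harm N)\<bar> \<le> K / sqrt (real (Suc N))"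
proof -
  obtain P where P: "pderiv P = p" using poly_antiderivative by blast
  obtain C where C: "C \<ge> 0" "\<And>x. x \<ge> 0 \<Longrightarrow> \<bar>poly (pderiv p) x\<bar> \<le> C * exp (x / 4)"
    using poly_le_exp by blast
  define e where "e n = hs ks n / real (Suc n) - (poly P (harm (Suc n)) - poly P (harm n))" for n
  have bound: "\<bar>e n\<bar> \<le> (K + 2 * C) / (real (Suc n) * sqrt (real (Suc n)))" for n
  proof -
    define d where "d = 1 / real (Suc n)"
    define s where "s = sqrt (real (Suc n))"
    have s: "s > 0" "s\<^sup>2 = real (Suc n)" by (auto simp: s_def)
    have d: "d > 0" by (simp add: d_def)
    have h: "harm (Suc n) = harm n + d" by (simp add: harm_Suc d_def field_simps)
    obtain x where x: "harm n < x" "x < harm n + d"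
      "poly P (harm n + d) - poly P (harm n) = d * poly p x"
      using MVT2[of "harm n" "harm n + d" "poly P" "poly p"] d P poly_DERIV[of P] by auto
    obtain y where y: "harm n < y" "y < x" "poly p x - poly p (harm n) = (x - harm n) * poly (pderiv p) y"
      using MVT2[of "harm n" x "poly p" "poly (pderiv p)"] x poly_DERIV[of p] by auto
    have "y \<ge> 0" using y(1) harm_nonneg[of n, where 'a = real] by linarith
    hence "\<bar>poly (pderiv p) y\<bar> \<le> C * exp (y / 4)" by (rule C(2))
    also have "\<dots> \<le> C * exp (harm (Suc n) / 4)"
      using C(1) x y h by (intro mult_left_mono) auto
    also have "\<dots> \<le> C * (2 * s)" using C(1) exp_harm_bounds(3)[of n] by (intro mult_left_mono) (auto simp: s_def)
    finally have pd: "\<bar>poly (pderiv p) y\<bar> \<le> 2 * C * s" by simp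
    have "\<bar>poly p x - poly p (harm n)\<bar> \<le> d * (2 * C * s)"
      unfolding y(3) abs_mult using x y d pd by (intro mult_mono) auto
    moreover have "\<bar>hs ks n - poly p (harm n)\<bar> \<le> K / s" using assms[of n] by (simp add: s_def)
    ultimately have "\<bar>hs ks n - poly p x\<bar> \<le> K / s + d * (2 * C * s)" by linarith
    also have "\<dots> = (K + 2 * C) / s"
      unfolding d_def s(2)[symmetric] using s(1) by (simp add: field_simps power2_eq_square)
    finally have "d * \<bar>hs ks n - poly p x\<bar> \<le> d * ((K + 2 * C) / s)"
      using d by (intro mult_left_mono) auto
    moreover have "e n = d * (hs ks n - poly p x)"
      unfolding e_def h x(3) by (simp add: d_def algebra_simps diff_divide_distrib)
    ultimately show ?thesis using d by (simp add: abs_mult d_def s_def)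
  qed
  have sum_e: "(\<Sum>n<N. e n) = hs (1 # ks) N - (poly P (harm N) - poly P 0)" for N
  proof -
    have "(\<Sum>n<N. poly P (harm (Suc n)) - poly P (harm n)) = poly P (harm N) - poly P (harm 0)"
      by (rule sum_lessThan_telescope)
    thus ?thesis unfolding e_def by (subst sum_subtractf) (simp add: harm_def)
  qed
  have "\<bar>hs (1 # ks) N - poly (P + [:suminf e - poly P 0:]) (harm N)\<bar> \<le> 6 * (K + 2 * C) / sqrt (real (Suc N))" for N
    using sum_tail_bound(2)[OF bound, of N] unfolding sum_e by (simp add: algebra_simps)
  thus ?thesis by blast
qed

lemma hs_expansion:
  assumes "is_index ks"
  shows "\<exists>p K. \<forall>N. \<bar>hs ks N - poly p (harm N)\<bar> \<le> K / sqrt (real (Suc N))"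
  using assms
proof (induction ks)
  case Nil
  show ?case by (intro exI[of _ 1] exI[of _ 0]) auto
next
  case (Cons k ks)
  then obtain p K where pK: "\<And>N. \<bar>hs ks N - poly p (harm N)\<bar> \<le> K / sqrt (real (Suc N))" by auto
  show ?case
  proof (cases "k = 1")
    case True
    thus ?thesis using hs_expansion_step_divergent[OF pK] by blast
  next
    case False
    hence k: "2 \<le> k" using Cons.prems by simp
    from hs_bound_of_expansion[OF pK] obtain C where C: "\<And>N. \<bar>hs ks N\<bar> \<le> C * sqrt (real (Suc N))" by blast
    from hs_expansion_step_convergent(1)[OF k C] show ?thesis
      by (intro exI[of _ "[:suminf (\<lambda>n. hs ks n / real (Suc n) ^ k):]"] exI[of _ "6 * C"]) simp
  qed
qed

lemma hs_bound:
  assumes "is_index ks"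
  obtains C where "C \<ge> 0" "\<And>N. \<bar>hs ks N\<bar> \<le> C * sqrt (real (Suc N))"
  using hs_expansion[OF assms] hs_bound_of_expansion by metis

lemma harm_at_top: "filterlim (harm :: nat \<Rightarrow> real) at_top sequentially"
proof (rule filterlim_at_top_mono)
  show "filterlim (\<lambda>n. ln (real (Suc n))) at_top sequentially" by real_asymp
  show "eventually (\<lambda>n. ln (real (Suc n)) \<le> harm n) sequentially"
    by (intro always_eventually allI ln_le_harm')
qed

lemma reg_limit_of_hs_expansion:
  assumes "\<And>N. \<bar>f N - poly p (harm N)\<bar> \<le> K / sqrt (real (Suc N))"
  shows "reg_limit sequentially harm f (poly p 0)"
proof (rule reg_limit_strong[OF exp_decay_negligible[OF harm_at_top, of "1/2"]])
  have K: "K \<ge> 0" using assms[of 0] by simp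
  show "\<forall>\<^sub>F N in sequentially. \<bar>f N - poly p (harm N)\<bar> \<le> 2 * K * \<bar>exp (- (1 / 2) * harm N)\<bar>"
  proof (intro always_eventually allI)
    fix N
    have "K * (1 / sqrt (real (Suc N))) \<le> K * (2 * exp (- (1/2) * harm N))"
      using K exp_harm_bounds(2) by (intro mult_left_mono)
    thus "\<bar>f N - poly p (harm N)\<bar> \<le> 2 * K * \<bar>exp (- (1 / 2) * harm N)\<bar>"
      using assms[of N] by simp
  qed
qed simp

text \<open>Expanding in \<open>harm\<close> instead of the logarithm builds in the normalization:
  \<open>hs [1]\<close> equals \<open>harm\<close>, a polynomial without constant term, so no Euler
  constant enters.\<close>

definition zeta_harm :: "nat list \<Rightarrow> real" where
  "zeta_harm ks = (THE c. reg_limit sequentially harm (hs (rev ks)) c)"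

lemma reg_limit_zeta_harm:
  assumes "is_index ks"
  shows "reg_limit sequentially harm (hs (rev ks)) (zeta_harm ks)"
proof -
  from hs_expansion[of "rev ks"] assms obtain p K
    where "\<And>N. \<bar>hs (rev ks) N - poly p (harm N)\<bar> \<le> K / sqrt (real (Suc N))" by auto
  from reg_limit_of_hs_expansion[OF this]
  have "\<exists>!c. reg_limit sequentially harm (hs (rev ks)) c"
    using reg_limit_unique[OF sequentially_bot harm_at_top] by blast
  thus ?thesis unfolding zeta_harm_def by (rule theI')
qed

section \<open>Multiple zeta values as limits\<close>

definition mzv_indices :: "nat \<Rightarrow> nat list set" where
  "mzv_indices r = {ns. length ns = r \<and> sorted_wrt (<) ns \<and> (\<forall>n\<in>set ns. 1 \<le> n)}"

definition mzv_term :: "nat list \<Rightarrow> nat list \<Rightarrow> real" where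
  "mzv_term ks ns = (\<Prod>i<length ks. 1 / real (ns ! i) ^ (ks ! i))"

lemma finite_mzv_indices_le: "finite {ns \<in> mzv_indices r. set ns \<subseteq> {..N}}"
  by (rule finite_subset[OF _ finite_lists_length_eq[of "{..N}" r]]) (auto simp: mzv_indices_def)

text \<open>The largest variable is \<open>Suc n\<close> with \<open>n < N\<close>, and the others
  then lie in \<open>{..n}\<close>; splitting it off gives the bijection.\<close>

lemma hs_eq_sum: "hs (rev ks) N = (\<Sum>ns\<in>{ns \<in> mzv_indices (length ks). set ns \<subseteq> {..N}}. mzv_term ks ns)"
proof (induction ks arbitrary: N rule: rev_induct)
  case Nil
  have "{ns \<in> mzv_indices (length []). set ns \<subseteq> {..N}} = {[]}" by (auto simp: mzv_indices_def)
  thus ?case by (simp add: mzv_term_def)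
next
  case (snoc k ks)
  let ?S = "\<lambda>n. {ns \<in> mzv_indices (length ks). set ns \<subseteq> {..n}}"
  let ?T = "{ns \<in> mzv_indices (length (ks @ [k])). set ns \<subseteq> {..N}}"
  have bij: "bij_betw (\<lambda>(n, ns). ns @ [Suc n]) (Sigma {..<N} ?S) ?T"
  proof (rule bij_betw_imageI)
    show "inj_on (\<lambda>(n, ns). ns @ [Suc n]) (Sigma {..<N} ?S)" by (auto simp: inj_on_def)
    show "(\<lambda>(n, ns). ns @ [Suc n]) ` Sigma {..<N} ?S = ?T"
    proof (intro equalityI subsetI)
      fix ms assume "ms \<in> (\<lambda>(n, ns). ns @ [Suc n]) ` Sigma {..<N} ?S"
      thus "ms \<in> ?T" by (force simp: mzv_indices_def sorted_wrt_append)
    next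
      fix ms assume ms: "ms \<in> ?T"
      then obtain ns m where eq: "ms = ns @ [m]" by (cases ms rule: rev_cases) (auto simp: mzv_indices_def)
      from ms have m: "1 \<le> m" "m \<le> N" by (auto simp: eq mzv_indices_def)
      have "ns \<in> ?S (m - 1)" using ms by (fastforce simp: eq mzv_indices_def sorted_wrt_append)
      moreover have "m - 1 \<in> {..<N}" "ms = ns @ [Suc (m - 1)]" using m by (auto simp: eq)
      ultimately show "ms \<in> (\<lambda>(n, ns). ns @ [Suc n]) ` Sigma {..<N} ?S" by force
    qed
  qed
  have "hs (rev (ks @ [k])) N = (\<Sum>n<N. \<Sum>ns\<in>?S n. mzv_term ks ns / real (Suc n) ^ k)"
    by (simp add: snoc.IH sum_divide_distrib)
  also have "\<dots> = (\<Sum>(n, ns)\<in>Sigma {..<N} ?S. mzv_term ks ns / real (Suc n) ^ k)"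
    by (intro sum.Sigma) (auto intro: finite_mzv_indices_le)
  also have "\<dots> = (\<Sum>(n, ns)\<in>Sigma {..<N} ?S. mzv_term (ks @ [k]) (ns @ [Suc n]))"
    by (intro sum.cong) (auto simp: mzv_term_def mzv_indices_def nth_append intro!: prod.cong)
  also have "\<dots> = (\<Sum>ns\<in>?T. mzv_term (ks @ [k]) ns)"
    using sum.reindex_bij_betw[OF bij, of "mzv_term (ks @ [k])"] by (simp add: case_prod_unfold)
  finally show ?case .
qed

text \<open>\<open>mzv\<close> is an unordered sum of nonnegative terms. A bound on the truncations
  bounds every finite partial sum, which gives summability, and the truncations exhaust the index
  set.\<close>

lemma hs_tendsto_mzv:
  assumes bounded: "\<And>N. hs (rev ks) N \<le> C"
  shows "hs (rev ks) \<longlonglongrightarrow> mzv ks"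
proof -
  let ?A = "mzv_indices (length ks)"
  let ?S = "\<lambda>N. {ns \<in> ?A. set ns \<subseteq> {..N}}"
  have exhaust: "\<exists>N. F \<subseteq> ?S N" if "finite F" "F \<subseteq> ?A" for F
  proof -
    have "finite (\<Union>ns\<in>F. set ns)" using that by auto
    then obtain N where "\<forall>n\<in>(\<Union>ns\<in>F. set ns). n \<le> N" using finite_nat_set_iff_bounded_le by blast
    thus ?thesis using that by (intro exI[of _ N]) auto
  qed
  have nonneg: "mzv_term ks ns \<ge> 0" for ns by (auto simp: mzv_term_def intro!: prod_nonneg)
  have "mzv_term ks summable_on ?A"
  proof (rule nonneg_bdd_above_summable_on)
    show "bdd_above (sum (mzv_term ks) ` {F. F \<subseteq> ?A \<and> finite F})"
    proof (rule bdd_aboveI)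
      fix x assume "x \<in> sum (mzv_term ks) ` {F. F \<subseteq> ?A \<and> finite F}"
      then obtain F where F: "finite F" "F \<subseteq> ?A" "x = sum (mzv_term ks) F" by auto
      obtain N where "F \<subseteq> ?S N" using exhaust F by blast
      hence "x \<le> hs (rev ks) N"
        unfolding F(3) hs_eq_sum using finite_mzv_indices_le nonneg by (intro sum_mono2) auto
      thus "x \<le> C" using bounded[of N] by simp
    qed
  qed (use nonneg in auto)
  hence "(mzv_term ks has_sum mzv ks) ?A"
    unfolding mzv_def mzv_term_def[symmetric] mzv_indices_def[symmetric] by (rule has_sum_infsum)
  hence lim: "(sum (mzv_term ks) \<longlongrightarrow> mzv ks) (finite_subsets_at_top ?A)"
    by (simp add: has_sum_def)
  have "filterlim ?S (finite_subsets_at_top ?A) sequentially"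
    unfolding filterlim_finite_subsets_at_top
  proof (intro allI impI)
    fix F assume "finite F \<and> F \<subseteq> ?A"
    then obtain N where N: "F \<subseteq> ?S N" using exhaust by blast
    show "\<forall>\<^sub>F M in sequentially. finite (?S M) \<and> F \<subseteq> ?S M \<and> ?S M \<subseteq> ?A"
      using eventually_ge_at_top[of N]
    proof eventually_elim
      case (elim M)
      have "?S N \<subseteq> ?S M" using elim by force
      thus ?case using N finite_mzv_indices_le by blast
    qed
  qed
  from filterlim_compose[OF lim this] show ?thesis by (simp add: hs_eq_sum[abs_def])
qed

lemma mzv_Nil [simp]: "mzv [] = 1"
proof -
  have "hs (rev []) \<longlonglongrightarrow> mzv []" by (rule hs_tendsto_mzv[of _ 1]) simp
  moreover have "hs (rev []) = (\<lambda>N. 1)" by auto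
  ultimately show ?thesis by (simp add: LIMSEQ_const_iff)
qed

lemma mzv_expansion:
  assumes "admissible ks"
  obtains K where "\<And>N. \<bar>hs (rev ks) N - mzv ks\<bar> \<le> K / sqrt (real (Suc N))" "hs (rev ks) \<longlonglongrightarrow> mzv ks"
proof -
  have "\<exists>c K. \<forall>N. \<bar>hs (rev ks) N - c\<bar> \<le> K / sqrt (real (Suc N))"
  proof (cases ks rule: rev_cases)
    case Nil
    thus ?thesis by (intro exI[of _ 1] exI[of _ 0]) auto
  next
    case (snoc ls k)
    hence "is_index (rev ls)" "2 \<le> k" using assms by auto
    then obtain C where C: "\<And>N. \<bar>hs (rev ls) N\<bar> \<le> C * sqrt (real (Suc N))"
      using hs_bound by blast
    show ?thesis
      using hs_expansion_step_convergent(1)[OF \<open>2 \<le> k\<close> C] unfolding snoc rev_append by auto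
  qed
  then obtain c K where cK: "\<And>N. \<bar>hs (rev ks) N - c\<bar> \<le> K / sqrt (real (Suc N))" by blast
  have K: "K \<ge> 0" using cK[of 0] by simp
  have "hs (rev ks) N \<le> \<bar>c\<bar> + K" for N
  proof -
    have "K / sqrt (real (Suc N)) \<le> K / 1" using K by (intro frac_le) auto
    thus ?thesis using cK[of N] by linarith
  qed
  hence lim: "hs (rev ks) \<longlonglongrightarrow> mzv ks" by (rule hs_tendsto_mzv)
  have "(\<lambda>N. K / sqrt (real (Suc N))) \<longlonglongrightarrow> 0" by real_asymp
  hence "(\<lambda>N. hs (rev ks) N - c) \<longlonglongrightarrow> 0"
    by (rule Lim_null_comparison[rotated]) (use cK in auto)
  hence "hs (rev ks) \<longlonglongrightarrow> c" using LIM_zero_cancel by blast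
  hence "c = mzv ks" using lim LIMSEQ_unique by blast
  with cK lim that show ?thesis by blast
qed

lemma mzv_product:
  assumes "admissible ks" "admissible ls"
  shows "ev mzv (harmonic_index ks ls) = mzv ks * mzv ls"
proof (rule LIMSEQ_unique)
  have lim: "hs (rev ms) \<longlonglongrightarrow> mzv ms" if "admissible ms" for ms
    using mzv_expansion[OF that] by blast
  show "(\<lambda>N. hs (rev ks) N * hs (rev ls) N) \<longlonglongrightarrow> mzv ks * mzv ls"
    by (intro tendsto_mult lim assms)
  have "(\<lambda>N. ev (\<lambda>ms. hs (rev ms) N) (harmonic_index ks ls)) \<longlonglongrightarrow> ev mzv (harmonic_index ks ls)"
    unfolding ev_def using admissible_harmonic_index[OF assms]
    by (intro tendsto_sum tendsto_mult tendsto_const lim) auto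
  thus "(\<lambda>N. hs (rev ks) N * hs (rev ls) N) \<longlonglongrightarrow> ev mzv (harmonic_index ks ls)"
    by (simp add: hs_harmonic_index)
qed

section \<open>The harmonic regularization\<close>

lemma zeta_harm_admissible:
  assumes "admissible ks"
  shows "zeta_harm ks = mzv ks"
proof (rule reg_limit_tendsto[OF sequentially_bot harm_at_top])
  show "reg_limit sequentially harm (hs (rev ks)) (zeta_harm ks)"
    using assms by (intro reg_limit_zeta_harm) (simp add: admissible_def)
  show "hs (rev ks) \<longlonglongrightarrow> mzv ks"
    using mzv_expansion[OF assms] by blast
qed

lemma hs_1: "hs [1] N = harm N"
  by (induction N) (simp_all add: harm_Suc harm_def inverse_eq_divide)

lemma zeta_harm_1: "zeta_harm [1] = 0"
proof (rule reg_limit_unique[OF sequentially_bot harm_at_top reg_limit_zeta_harm])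
  have "hs (rev [1]) = harm" by (rule ext) (simp only: rev.simps append.simps hs_1)
  thus "reg_limit sequentially harm (hs (rev [1])) 0" by (simp add: reg_limit_base)
qed simp

lemma zeta_harm_product:
  assumes "is_index ks" "is_index ls"
  shows "ev zeta_harm (harmonic_index ks ls) = zeta_harm ks * zeta_harm ls"
proof (rule reg_limit_unique[OF sequentially_bot harm_at_top])
  show "reg_limit sequentially harm (\<lambda>N. hs (rev ks) N * hs (rev ls) N) (zeta_harm ks * zeta_harm ls)"
    by (intro reg_limit_mult reg_limit_zeta_harm assms)
  have "reg_limit sequentially harm (\<lambda>N. ev (\<lambda>ms. hs (rev ms) N) (harmonic_index ks ls))
      (ev zeta_harm (harmonic_index ks ls))"
    by (intro reg_limit_ev reg_limit_zeta_harm is_index_harmonic_index[OF assms])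
  thus "reg_limit sequentially harm (\<lambda>N. hs (rev ks) N * hs (rev ls) N) (ev zeta_harm (harmonic_index ks ls))"
    by (simp add: hs_harmonic_index)
qed

text \<open>Existence half: a function on indices whose linear extension is multiplicative and has
  the prescribed values yields, restricted to \<open>index_space\<close>, a regularization.
  Uniqueness then resolves the description in \<open>reg_map\<close>.\<close>

lemma reg_map_eqI:
  assumes "regularizable (reg_prod b)"
    and "\<And>v w. v \<in> index_space \<Longrightarrow> w \<in> index_space \<Longrightarrow>
        reg_prod b v w \<in> index_space \<and> ev z (reg_prod b v w) = ev z v * ev z w"
    and "\<And>ks. admissible ks \<Longrightarrow> z ks = mzv ks" "z [1] = 0" "is_index ks"
  shows "zeta_reg b ks = z ks"
proof -
  define f where "f = restrict (ev z) index_space"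
  have "is_regularization (reg_prod b) f"
    using assms(2-4) by (auto simp: is_regularization_def f_def index_space_add index_space_scale admissible_def)
  hence "reg_map b = f"
    unfolding reg_map_def using regularization_unique[OF assms(1)] by (intro the_equality) auto
  thus ?thesis using assms(5) by (simp add: zeta_reg_def f_def)
qed

lemma zeta_reg_Harmonic: "is_index ks \<Longrightarrow> zeta_reg Harmonic ks = zeta_harm ks"
proof (rule reg_map_eqI)
  fix v w :: "nat list \<Rightarrow>\<^sub>0 rat" assume "v \<in> index_space" "w \<in> index_space"
  moreover from this have "ev zeta_harm (harmonic_prod v w) = ev zeta_harm v * ev zeta_harm w"
    unfolding harmonic_prod_def index_space_def
    by (intro ev_product_character zeta_harm_product) auto
  ultimately show "reg_prod Harmonic v w \<in> index_space \<and>
      ev zeta_harm (reg_prod Harmonic v w) = ev zeta_harm v * ev zeta_harm w"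
    using harmonic_prod_in_index_space by simp
qed (use regularizable_harmonic zeta_harm_admissible zeta_harm_1 in auto)

section \<open>Multiple polylogarithms\<close>

text \<open>The one-variable multiple polylogarithm: the power of \<open>u\<close> is the largest
  summation variable \<open>Suc n\<close>, and the index is reversed as for
  \<open>hs\<close>.\<close>

fun Lis :: "nat list \<Rightarrow> real \<Rightarrow> real" where
  "Lis [] u = 1"
| "Lis (k # ks) u = suminf (\<lambda>n. hs ks n / real (Suc n) ^ k * u ^ Suc n)"

declare Lis.simps(2) [simp del]

lemma hs_coeff_bounds:
  assumes "is_index (k # ks)"
  shows "0 \<le> hs ks n / real (Suc n) ^ k" "hs ks n / real (Suc n) ^ k \<le> 1"
proof -
  show "0 \<le> hs ks n / real (Suc n) ^ k" by (simp add: hs_nonneg)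
  have "hs ks n \<le> real (Suc n) ^ 1" using hs_le[of ks n] assms by simp
  also have "\<dots> \<le> real (Suc n) ^ k"
    using assms by (intro power_increasing) auto
  finally show "hs ks n / real (Suc n) ^ k \<le> 1" by (simp add: divide_le_eq_1 del: of_nat_Suc)
qed

lemma hs_coeff_abs: "is_index (k # ks) \<Longrightarrow> \<bar>hs ks n / real (Suc n) ^ k\<bar> \<le> 1"
  using hs_coeff_bounds[of k ks n] by (simp only: abs_of_nonneg)

lemma bounded_powser_summable:
  fixes a :: "nat \<Rightarrow> real"
  assumes "\<And>n. \<bar>a n\<bar> \<le> 1" "\<bar>u\<bar> < 1"
  shows "summable (\<lambda>n. a n * u ^ n)"
proof (rule summable_comparison_test'[of "\<lambda>n. \<bar>u\<bar> ^ n" 0])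
  show "summable (\<lambda>n. \<bar>u\<bar> ^ n)" using assms by (intro summable_geometric) auto
  show "norm (a n * u ^ n) \<le> \<bar>u\<bar> ^ n" for n
    using mult_right_mono[OF assms(1)[of n], of "\<bar>u\<bar> ^ n"] by (simp add: abs_mult power_abs)
qed

lemma Lis_summable:
  assumes "is_index (k # ks)" "\<bar>u\<bar> < 1"
  shows "summable (\<lambda>n. hs ks n / real (Suc n) ^ k * u ^ Suc n)"
proof -
  have "summable (\<lambda>n. u * (hs ks n / real (Suc n) ^ k * u ^ n))"
    by (intro summable_mult bounded_powser_summable hs_coeff_abs assms)
  thus ?thesis by (simp add: mult_ac)
qed

lemma Lis_bounds:
  assumes "is_index (k # ks)" "0 < u" "u < 1"
  shows "0 \<le> Lis (k # ks) u" "Lis (k # ks) u \<le> u / (1 - u)"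
proof -
  note s = Lis_summable[OF assms(1), of u]
  show "0 \<le> Lis (k # ks) u"
    using assms hs_coeff_bounds[OF assms(1)] unfolding Lis.simps
    by (intro suminf_nonneg s mult_nonneg_nonneg) auto
  have g: "(\<lambda>n. u * u ^ n) sums (u * (1 / (1 - u)))"
    using assms by (intro sums_mult geometric_sums) auto
  have "Lis (k # ks) u \<le> suminf (\<lambda>n. u * u ^ n)"
    unfolding Lis.simps
  proof (intro suminf_le s sums_summable[OF g])
    show "hs ks n / real (Suc n) ^ k * u ^ Suc n \<le> u * u ^ n" for n
      using mult_right_mono[OF hs_coeff_bounds(2)[OF assms(1), of n], of "u ^ Suc n"] assms by simp
  qed (use assms in auto)
  also have "\<dots> = u / (1 - u)" using sums_unique[OF g] by simp
  finally show "Lis (k # ks) u \<le> u / (1 - u)" .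
qed

lemma Lis_has_derivative:
  assumes "is_index (k # ks)" "\<bar>u\<bar> < 1"
  shows "summable (\<lambda>n. hs ks n / real (Suc n) ^ (k - 1) * u ^ n)"
    and "(Lis (k # ks) has_real_derivative suminf (\<lambda>n. hs ks n / real (Suc n) ^ (k - 1) * u ^ n)) (at u)"
proof -
  \<comment> \<open>Shifting by one turns the powers \<open>u ^ Suc n\<close> into an ordinary power
    series, which can be differentiated termwise.\<close>
  define c where "c n = (case n of 0 \<Rightarrow> 0 | Suc n \<Rightarrow> hs ks n / real (Suc n) ^ k)" for n
  have c: "\<bar>c n\<bar> \<le> 1" for n
    using hs_coeff_abs[OF assms(1)] by (cases n) (simp_all add: c_def del: of_nat_Suc)
  have sum: "summable (\<lambda>n. c n * z ^ n)" if "norm z < 1" for z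
    using bounded_powser_summable[of c z] c that by simp
  have "k \<ge> 1" using assms(1) by simp
  hence "real (Suc n) * (hs ks n / real (Suc n) ^ k) = hs ks n / real (Suc n) ^ (k - 1)" for n
    by (cases k) (simp_all del: of_nat_Suc)
  hence diffs: "diffs c = (\<lambda>n. hs ks n / real (Suc n) ^ (k - 1))"
    by (auto simp: diffs_def c_def fun_eq_iff simp del: of_nat_Suc)
  have eq: "suminf (\<lambda>n. c n * z ^ n) = Lis (k # ks) z" if "norm z < 1" for z
    using suminf_split_head[OF sum[OF that]] by (simp add: c_def Lis.simps del: of_nat_Suc)
  show "summable (\<lambda>n. hs ks n / real (Suc n) ^ (k - 1) * u ^ n)"
    using termdiff_converges[of u 1 c] sum assms(2) unfolding diffs by auto
  have "((\<lambda>z. suminf (\<lambda>n. c n * z ^ n)) has_real_derivative suminf (\<lambda>n. diffs c n * u ^ n)) (at u)"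
    by (rule termdiffs_strong'[OF sum]) (use assms in auto)
  moreover have "eventually (\<lambda>z. suminf (\<lambda>n. c n * z ^ n) = Lis (k # ks) z) (nhds u)"
  proof (rule eventually_nhds_in_open[THEN eventually_mono])
    show "open {-1<..<1::real}" "u \<in> {-1<..<1}" using assms by auto
  qed (auto simp: eq)
  ultimately show "(Lis (k # ks) has_real_derivative suminf (\<lambda>n. hs ks n / real (Suc n) ^ (k - 1) * u ^ n)) (at u)"
    unfolding diffs by (subst (asm) DERIV_cong_ev[OF refl _ refl]) auto
qed

lemma Lis_deriv_Suc:
  assumes "is_index (k # ks)" "0 < u" "u < 1"
  shows "(Lis (Suc k # ks) has_real_derivative Lis (k # ks) u / u) (at u)"
proof -
  have ind: "is_index (Suc k # ks)" using assms by simp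
  have u: "\<bar>u\<bar> < 1" using assms by simp
  have "Lis (k # ks) u = suminf (\<lambda>n. u * (hs ks n / real (Suc n) ^ k * u ^ n))"
    by (simp add: mult_ac Lis.simps)
  also have "\<dots> = u * suminf (\<lambda>n. hs ks n / real (Suc n) ^ k * u ^ n)"
    using Lis_has_derivative(1)[OF ind u] by (intro suminf_mult) simp
  finally have "suminf (\<lambda>n. hs ks n / real (Suc n) ^ (Suc k - 1) * u ^ n) = Lis (k # ks) u / u"
    using assms by simp
  thus ?thesis using Lis_has_derivative(2)[OF ind u] by simp
qed

text \<open>Multiplying the generating function of the partial sums \<open>hs ks n\<close> by
  \<open>1 - u\<close> yields that of their increments, which is \<open>Lis ks u\<close>.\<close>

lemma Lis_deriv_1:
  assumes "is_index ks" "0 < u" "u < 1"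
  shows "(Lis (1 # ks) has_real_derivative Lis ks u / (1 - u)) (at u)"
proof -
  have ind: "is_index (1 # ks)" using assms by simp
  have u: "\<bar>u\<bar> < 1" using assms by simp
  let ?S = "suminf (\<lambda>n. hs ks n * u ^ n)"
  have s: "summable (\<lambda>n. hs ks n * u ^ n)" using Lis_has_derivative(1)[OF ind u] by simp
  have "?S = hs ks 0 + suminf (\<lambda>n. hs ks (Suc n) * u ^ Suc n)"
    using suminf_split_head[OF s] by simp
  moreover have "u * ?S = suminf (\<lambda>n. hs ks n * u ^ Suc n)"
    using suminf_mult[OF s, of u] by (simp add: mult_ac)
  moreover have "suminf (\<lambda>n. hs ks (Suc n) * u ^ Suc n) - suminf (\<lambda>n. hs ks n * u ^ Suc n) =
      suminf (\<lambda>n. hs ks (Suc n) * u ^ Suc n - hs ks n * u ^ Suc n)"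
    using summable_Suc_iff[THEN iffD2, OF s] summable_mult[OF s, of u]
    by (intro suminf_diff) (simp_all add: mult_ac)
  ultimately have "(1 - u) * ?S = hs ks 0 + suminf (\<lambda>n. (hs ks (Suc n) - hs ks n) * u ^ Suc n)"
    by (simp add: algebra_simps)
  also have "\<dots> = Lis ks u"
    by (cases ks) (simp_all add: Lis.simps)
  finally have "?S = Lis ks u / (1 - u)" using assms by (simp add: field_simps)
  thus ?thesis using Lis_has_derivative(2)[OF ind u] by simp
qed

section \<open>Raising the components of an index\<close>

text \<open>For an index in reversed order, \<open>raise_index m ks\<close> is the combination of indices on which
  \<open>\<zeta>\<close> takes the value \<open>\<zeta>\<^sub>m\<close>.\<close>

fun raise_index :: "nat \<Rightarrow> nat list \<Rightarrow> (nat list \<Rightarrow>\<^sub>0 rat)" where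
  "raise_index m [] = (if m = 0 then basis [] else 0)"
| "raise_index m (k # ks) = (\<Sum>l\<le>m. scale (of_nat ((k + l - 1) choose l))
     (lin_ext (\<lambda>qs. basis ((k + l) # qs)) (raise_index (m - l) ks)))"

declare raise_index.simps(2) [simp del]

lemma ev_raise_index_Cons:
  "ev f (raise_index m (k # ks)) =
     (\<Sum>l\<le>m. real ((k + l - 1) choose l) * ev (\<lambda>qs. f ((k + l) # qs)) (raise_index (m - l) ks))"
  by (simp add: ev_sum raise_index.simps)

lemma raise_index_le:
  "qs \<in> keys (raise_index m ks) \<Longrightarrow> list_all2 (\<le>) ks qs"
proof (induction ks arbitrary: m qs)
  case Nil
  thus ?case by (cases "m = 0") simp_all
next
  case (Cons k ks)
  from Cons.prems
  have "qs \<in> (\<Union>l\<in>{..m}. keys (scale (of_nat ((k + l - 1) choose l))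
     (lin_ext (\<lambda>qs. basis ((k + l) # qs)) (raise_index (m - l) ks))))"
    unfolding raise_index.simps by (rule subsetD[OF keys_sum])
  then obtain l where "qs \<in> keys (scale (of_nat ((k + l - 1) choose l))
     (lin_ext (\<lambda>qs. basis ((k + l) # qs)) (raise_index (m - l) ks)))" by (rule UN_E)
  from keys_lin_ext_basisD[OF subsetD[OF keys_scale this]]
  obtain qs' where "qs' \<in> keys (raise_index (m - l) ks)" "qs = (k + l) # qs'"
    by blast
  with Cons.IH[of qs' "m - l"] show ?case by simp
qed

lemma keys_raise_index:
  assumes "qs \<in> keys (raise_index m ks)" "is_index ks"
  shows "is_index qs \<and> length qs = length ks"
proof -
  have "list_all2 (\<le>) ks qs" using assms(1) by (rule raise_index_le)
  thus ?thesis using assms(2) by (induction rule: list_all2_induct) auto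
qed

text \<open>Differentiation lowers the head \<open>Suc k + l\<close> to \<open>k + l\<close> but
  keeps the binomial weight belonging to \<open>Suc k\<close>. Pascal's rule rewrites this weight as
  the correct one for \<open>k\<close> plus that of a raising by one unit less.\<close>

lemma raise_index_lower:
  "(\<Sum>l\<le>m. real ((k + l) choose l) * ev (\<lambda>qs. f ((k + l) # qs)) (raise_index (m - l) ks)) =
     ev f (raise_index m (k # ks)) + (if m = 0 then 0 else ev f (raise_index (m - 1) (Suc k # ks)))"
proof -
  define X where "X l = ev (\<lambda>qs. f ((k + l) # qs)) (raise_index (m - l) ks)" for l
  have pascal: "real ((k + l) choose l) = real ((k + l - 1) choose l) +
      (if l = 0 then 0 else real ((k + l - 1) choose (l - 1)))" for l
    by (cases l; cases k) (auto simp flip: of_nat_add)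
  have "(\<Sum>l\<le>m. real ((k + l) choose l) * X l) = (\<Sum>l\<le>m. real ((k + l - 1) choose l) * X l)
     + (\<Sum>l\<le>m. if l = 0 then 0 else real ((k + l - 1) choose (l - 1)) * X l)"
    by (subst pascal) (auto simp: algebra_simps sum.distrib intro!: sum.cong)
  also have "(\<Sum>l\<le>m. real ((k + l - 1) choose l) * X l) = ev f (raise_index m (k # ks))"
    by (simp add: ev_raise_index_Cons X_def)
  also have "(\<Sum>l\<le>m. if l = 0 then 0 else real ((k + l - 1) choose (l - 1)) * X l) =
      (if m = 0 then 0 else ev f (raise_index (m - 1) (Suc k # ks)))"
  proof (cases m)
    case (Suc n)
    show ?thesis
      unfolding Suc sum.atMost_Suc_shift
      by (simp add: ev_raise_index_Cons X_def Suc)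
  qed simp
  finally show ?thesis by (simp only: X_def)
qed

definition Lraise :: "nat \<Rightarrow> nat list \<Rightarrow> real \<Rightarrow> real" where
  "Lraise m ks u = ev (\<lambda>qs. Lis qs u) (raise_index m ks)"

lemma ev_has_derivative:
  assumes "\<And>a. a \<in> keys v \<Longrightarrow> (f a has_real_derivative f' a) (at u)"
  shows "((\<lambda>u. ev (\<lambda>a. f a u) v) has_real_derivative ev f' v) (at u)"
  unfolding ev_def by (intro DERIV_sum DERIV_cmult assms)

text \<open>In the generating function over \<open>m\<close>, the extra summand is
  \<open>t / u\<close> times the function itself; the factor \<open>u powr (- t)\<close> hidden in
  \<open>LL\<close> is there to remove it.\<close>

lemma Lraise_deriv:
  assumes "is_index ks" "0 < u" "u < 1"
  shows "(Lraise m (Suc k # ks) has_real_derivative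
     (if k = 0 then Lraise m ks u / (1 - u) else Lraise m (k # ks) u / u)
      + (if m = 0 then 0 else Lraise (m - 1) (Suc k # ks) u / u)) (at u)"
proof -
  \<comment> \<open>A head 0 marks the derivative of a component 1, so one functional
    \<open>D\<close> covers both differentiation rules.\<close>
  define D where "D qs = (if hd qs = 0 then Lis (tl qs) u / (1 - u) else Lis qs u / u)" for qs
  have D: "ev D (raise_index j (Suc i # ks)) = Lraise j (Suc i # ks) u / u" for i j
    by (simp add: D_def Lraise_def ev_raise_index_Cons ev_fun_divide sum_divide_distrib )
  have "((\<lambda>u. \<Sum>l\<le>m. real ((Suc k + l - 1) choose l) * ev (\<lambda>qs. Lis ((Suc k + l) # qs) u) (raise_index (m - l) ks))
     has_real_derivative (\<Sum>l\<le>m. real ((Suc k + l - 1) choose l) *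
        ev (\<lambda>qs. D ((k + l) # qs)) (raise_index (m - l) ks))) (at u)"
  proof (intro DERIV_sum DERIV_cmult ev_has_derivative)
    fix l qs assume "qs \<in> keys (raise_index (m - l) ks)"
    hence "is_index qs" using keys_raise_index assms by blast
    thus "(Lis ((Suc k + l) # qs) has_real_derivative D ((k + l) # qs)) (at u)"
      using Lis_deriv_1[of qs u] Lis_deriv_Suc[of "k + l" qs u] assms(2,3)
      by (cases "k + l = 0") (simp_all add: D_def)
  qed
  also have "(\<Sum>l\<le>m. real ((Suc k + l - 1) choose l) * ev (\<lambda>qs. D ((k + l) # qs)) (raise_index (m - l) ks)) =
      ev D (raise_index m (k # ks)) + (if m = 0 then 0 else Lraise (m - 1) (Suc k # ks) u / u)"
    using raise_index_lower[of k D m ks] by (simp add: D)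
  also have "ev D (raise_index m (k # ks)) = (if k = 0 then Lraise m ks u / (1 - u) else Lraise m (k # ks) u / u)"
  proof (cases k)
    case 0
    \<comment> \<open>For head 0 only \<open>l = 0\<close> survives: \<open>l - 1 choose l\<close>
      is 0 for positive \<open>l\<close>, and truncated subtraction makes it 1 for
      \<open>l = 0\<close>.\<close>
    have "ev D (raise_index m (0 # ks)) = (\<Sum>l\<le>m. if l = 0 then ev (\<lambda>qs. D (0 # qs)) (raise_index m ks) else 0)"
      unfolding ev_raise_index_Cons by (intro sum.cong) auto
    thus ?thesis by (simp add: 0 D_def Lraise_def ev_fun_divide )
  qed (use D in simp)
  finally show ?thesis
    by (simp add: Lraise_def[abs_def] ev_raise_index_Cons )
qed

text \<open>Iterated integrals for words with leading letters \<open>x\<close>: in generating functions, these letters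
  amount to replacing \<open>n\<close> by \<open>n - t\<close> in all denominators and multiplying by \<open>u powr (- t)\<close>.\<close>

definition LL :: "nat \<Rightarrow> nat list \<Rightarrow> real \<Rightarrow> real" where
  "LL m ks u = (\<Sum>j\<le>m. ln u ^ (m - j) / fact (m - j) * ((- 1) ^ j * Lraise j ks u))"

lemma ln_power_deriv:
  assumes "u > 0"
  shows "((\<lambda>u. ln u ^ Suc m / fact (Suc m)) has_real_derivative ln u ^ m / fact m / u) (at u)"
proof -
  have "((\<lambda>u. ln u ^ Suc m / fact (Suc m)) has_real_derivative
      real (Suc m) * (1 / u * ln u ^ (Suc m - Suc 0)) / fact (Suc m)) (at u)"
    using assms by (intro DERIV_cdivide DERIV_power DERIV_ln_divide)
  moreover have "real (Suc m) * (1 / u * ln u ^ (Suc m - Suc 0)) / fact (Suc m) = ln u ^ m / fact m / u"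
    by (simp add: fact_Suc del: of_nat_Suc)
  ultimately show ?thesis by (simp only:)
qed

text \<open>The correction terms \<open>L (j - 1) u / u\<close> cancel against the derivatives of
  the powers of \<open>ln u\<close>, because neighbouring summands carry opposite signs.\<close>

lemma LL_deriv_aux:
  fixes L M :: "nat \<Rightarrow> real \<Rightarrow> real"
  assumes "\<And>j. (L j has_real_derivative M j u + (if j = 0 then 0 else L (j - 1) u / u)) (at u)" "u > 0"
  shows "((\<lambda>u. \<Sum>j\<le>m. ln u ^ (m - j) / fact (m - j) * ((- 1) ^ j * L j u)) has_real_derivative
          (\<Sum>j\<le>m. ln u ^ (m - j) / fact (m - j) * ((- 1) ^ j * M j u))) (at u)"
proof -
  define T where "T i = ln u ^ i / fact i" for i
  have T: "((\<lambda>u. ln u ^ i / fact i) has_real_derivative (if i = 0 then 0 else T (i - 1) / u)) (at u)" for i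
  proof (cases i)
    case (Suc j)
    thus ?thesis using ln_power_deriv[OF assms(2), of j] by (simp add: T_def del: fact_Suc power_Suc)
  qed simp
  have "((\<lambda>u. \<Sum>j\<le>m. ln u ^ (m - j) / fact (m - j) * ((- 1) ^ j * L j u)) has_real_derivative
      (\<Sum>j\<le>m. (if m - j = 0 then 0 else T (m - j - 1) / u) * ((- 1) ^ j * L j u)
        + ((- 1) ^ j * (M j u + (if j = 0 then 0 else L (j - 1) u / u))) * T (m - j))) (at u)"
    unfolding T_def[of "m - _"] by (intro DERIV_sum DERIV_mult T DERIV_cmult assms)
  also have "(\<Sum>j\<le>m. (if m - j = 0 then 0 else T (m - j - 1) / u) * ((- 1) ^ j * L j u)
        + ((- 1) ^ j * (M j u + (if j = 0 then 0 else L (j - 1) u / u))) * T (m - j)) =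
     (\<Sum>j\<le>m. (if m - j = 0 then 0 else T (m - j - 1) / u) * ((- 1) ^ j * L j u))
      + (\<Sum>j\<le>m. T (m - j) * ((- 1) ^ j * M j u))
      + (\<Sum>j\<le>m. if j = 0 then 0 else T (m - j) * ((- 1) ^ j * (L (j - 1) u / u)))"
    unfolding sum.distrib[symmetric] by (intro sum.cong) (auto simp: algebra_simps)
  also have "(\<Sum>j\<le>m. if j = 0 then 0 else T (m - j) * ((- 1) ^ j * (L (j - 1) u / u))) =
      - (\<Sum>j\<le>m. (if m - j = 0 then 0 else T (m - j - 1) / u) * ((- 1) ^ j * L j u))"
  proof (cases m)
    case (Suc n)
    have "(\<Sum>j\<le>n. T (n - j) * ((- 1) ^ Suc j * (L j u / u))) =
        - (\<Sum>j\<le>n. (if Suc n - j = 0 then 0 else T (Suc n - j - 1) / u) * ((- 1) ^ j * L j u))"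
      unfolding sum_negf[symmetric] by (intro sum.cong) (auto simp: Suc_diff_le)
    thus ?thesis unfolding Suc by (subst sum.atMost_Suc_shift) simp
  qed simp
  finally show ?thesis by (simp add: T_def)
qed

lemma LL_deriv:
  assumes "is_index ks" "0 < u" "u < 1"
  shows "(LL m (Suc k # ks) has_real_derivative (if k = 0 then LL m ks u / (1 - u) else LL m (k # ks) u / u)) (at u)"
  using LL_deriv_aux[where L = "\<lambda>j. Lraise j (Suc k # ks)"
      and M = "\<lambda>j u. if k = 0 then Lraise j ks u / (1 - u) else Lraise j (k # ks) u / u",
      OF Lraise_deriv[OF assms] assms(2), of m]
  by (cases "k = 0") (simp_all add: LL_def[abs_def] sum_divide_distrib)

lemma LL_Nil: "LL m [] u = ln u ^ m / fact m"
proof -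
  have "LL m [] u = (\<Sum>j\<le>m. if j = 0 then ln u ^ m / fact m else 0)"
    unfolding LL_def by (intro sum.cong) (auto simp: Lraise_def)
  thus ?thesis by simp
qed

lemma LL_deriv_Nil:
  assumes "0 < u"
  shows "(LL (Suc m) [] has_real_derivative LL m [] u / u) (at u)"
  unfolding LL_Nil[abs_def] using assms by (rule ln_power_deriv)

text \<open>The iterated integral of the word from 0 to \<open>u\<close>, the last letter being
  integrated last. Leading letters \<open>x\<close>, whose integrals diverge at 0, are regularized
  to powers of \<open>ln u\<close>.\<close>

definition Li :: "letter list \<Rightarrow> real \<Rightarrow> real" where
  "Li w = LL (fst (parse w)) (snd (parse w))"

fun form :: "letter \<Rightarrow> real \<Rightarrow> real" where
  "form Letter_x u = 1 / u"
| "form Letter_y u = 1 / (1 - u)"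

lemma Li_Nil [simp]: "Li [] u = 1"
  by (simp add: Li_def LL_Nil)

lemma Li_deriv:
  assumes "0 < u" "u < 1"
  shows "(Li (w @ [a]) has_real_derivative form a u * Li w u) (at u)"
proof -
  have ind: "is_index (snd (parse w))" by (rule parse_is_index)
  show ?thesis
  proof (cases "(parse w, a)" rule: parse_step.cases)
    case (1 m)
    thus ?thesis using LL_deriv_Nil[OF assms(1), of m] by (auto simp: Li_def)
  next
    case (2 m k ks)
    thus ?thesis using LL_deriv[of ks u m k] ind assms by (auto simp: Li_def)
  next
    case (3 m ks)
    thus ?thesis using LL_deriv[of ks u m 0] ind assms by (auto simp: Li_def)
  qed
qed

section \<open>The shuffle product formula\<close>

lemma snd_parse_eq_Nil_iff: "snd (parse w) = [] \<longleftrightarrow> Letter_y \<notin> set w"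
proof (induction w rule: rev_induct)
  case (snoc a w)
  thus ?case by (cases "(parse w, a)" rule: parse_step.cases) auto
qed simp

lemma Li_replicate_x: "Letter_y \<notin> set w \<Longrightarrow> Li w u = ln u ^ length w / fact (length w)"
proof -
  assume "Letter_y \<notin> set w"
  hence "w = replicate (length w) Letter_x"
    by (intro replicate_length_same[symmetric]) (metis letter.exhaust)
  hence "parse w = (length w, [])" by (metis parse_replicate_x)
  thus ?thesis by (simp add: Li_def LL_Nil)
qed

section \<open>Behaviour at the end points of the interval\<close>

lemma u_times_ln_power: "((\<lambda>u. u * ln u ^ p) \<longlongrightarrow> (0::real)) (at_right 0)"
proof -
  have "filterlim (\<lambda>u::real. - ln u) at_top (at_right 0)"
    by (simp add: filterlim_uminus_at_top ln_at_0)
  from exp_decay_negligible[OF this, of 1 p]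
  have "((\<lambda>u::real. (- 1) ^ p * (exp (ln u) * (- ln u) ^ p)) \<longlongrightarrow> (- 1) ^ p * 0) (at_right 0)"
    by (intro tendsto_mult tendsto_const) simp
  moreover have "eventually (\<lambda>u::real. (- 1) ^ p * (exp (ln u) * (- ln u) ^ p) = u * ln u ^ p) (at_right 0)"
    using eventually_at_right_less[of 0]
  proof eventually_elim
    case (elim u)
    have "(- 1) ^ p * (- ln u) ^ p = ln u ^ p" by (simp flip: power_mult_distrib)
    thus ?case using elim by (simp add: mult.left_commute)
  qed
  ultimately show ?thesis by (simp add: tendsto_cong)
qed

lemma Lis_ln_power_at_0:
  assumes "is_index (k # ks)"
  shows "((\<lambda>u. Lis (k # ks) u * ln u ^ p) \<longlongrightarrow> 0) (at_right 0)"
proof (rule Lim_null_comparison)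
  have "((\<lambda>u. 2 * \<bar>u * ln u ^ p\<bar>) \<longlongrightarrow> 2 * 0) (at_right (0::real))"
    by (intro tendsto_mult tendsto_const tendsto_rabs_zero u_times_ln_power)
  thus "((\<lambda>u. 2 * \<bar>u * ln u ^ p\<bar>) \<longlongrightarrow> 0) (at_right (0::real))" by simp
  have "eventually (\<lambda>u::real. u \<in> {0<..<1/2}) (at_right 0)"
    by (rule eventually_at_right_real) simp
  thus "\<forall>\<^sub>F u in at_right 0. norm (Lis (k # ks) u * ln u ^ p) \<le> 2 * \<bar>u * ln u ^ p\<bar>"
  proof eventually_elim
    case (elim u)
    hence u: "0 < u" "u < 1" "1 - u \<ge> 1/2" by auto
    have "Lis (k # ks) u \<le> u / (1 - u)" using Lis_bounds[OF assms u(1,2)] by simp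
    also have "\<dots> \<le> u / (1/2)" using u by (intro divide_left_mono) auto
    finally have "\<bar>Lis (k # ks) u\<bar> \<le> 2 * \<bar>u\<bar>" using Lis_bounds(1)[OF assms u(1,2)] u by simp
    hence "\<bar>Lis (k # ks) u\<bar> * \<bar>ln u ^ p\<bar> \<le> 2 * \<bar>u\<bar> * \<bar>ln u ^ p\<bar>" by (rule mult_right_mono) simp
    thus ?case by (simp add: abs_mult)
  qed
qed

lemma LL_ln_power_at_0:
  assumes "is_index ks" "ks \<noteq> []"
  shows "((\<lambda>u. LL m ks u * ln u ^ p) \<longlongrightarrow> 0) (at_right 0)"
proof -
  have *: "((\<lambda>u. Lraise j ks u * ln u ^ p) \<longlongrightarrow> 0) (at_right 0)" for j p
  proof -
    have "((\<lambda>u. \<Sum>qs\<in>keys (raise_index j ks). of_rat (coefficient (raise_index j ks) qs) *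
        (Lis qs u * ln u ^ p)) \<longlongrightarrow> (\<Sum>qs\<in>keys (raise_index j ks).
         of_rat (coefficient (raise_index j ks) qs) * 0)) (at_right 0)"
    proof (intro tendsto_sum tendsto_mult tendsto_const)
      fix qs assume "qs \<in> keys (raise_index j ks)"
      hence "is_index qs" "qs \<noteq> []" using keys_raise_index[of qs j ks] assms by auto
      thus "((\<lambda>u. Lis qs u * ln u ^ p) \<longlongrightarrow> 0) (at_right 0)"
        using Lis_ln_power_at_0[of "hd qs" "tl qs" p] by simp
    qed
    thus ?thesis by (simp add: Lraise_def ev_def sum_distrib_right mult.assoc)
  qed
  have "((\<lambda>u. \<Sum>j\<le>m. (- 1) ^ j / fact (m - j) * (Lraise j ks u * ln u ^ (m - j + p))) \<longlongrightarrow>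
      (\<Sum>j\<le>m. (- 1) ^ j / fact (m - j) * 0)) (at_right 0)"
    by (intro tendsto_sum tendsto_mult tendsto_const *)
  moreover have "(\<Sum>j\<le>m. (- 1) ^ j / fact (m - j) * (Lraise j ks u * ln u ^ (m - j + p))) = LL m ks u * ln u ^ p" for u
    unfolding LL_def sum_distrib_right by (intro sum.cong refl) (simp only: power_add, simp)
  ultimately show ?thesis by simp
qed

lemma Li_ln_power_at_0:
  "Letter_y \<in> set w \<Longrightarrow> ((\<lambda>u. Li w u * ln u ^ p) \<longlongrightarrow> 0) (at_right 0)"
  unfolding Li_def using parse_is_index snd_parse_eq_Nil_iff by (intro LL_ln_power_at_0) auto

lemma Li_mult_at_0:
  assumes "Letter_y \<in> set v"
  shows "((\<lambda>u. Li v u * Li w u) \<longlongrightarrow> 0) (at_right 0)"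
proof (cases "Letter_y \<in> set w")
  case True
  thus ?thesis
    using tendsto_mult[OF Li_ln_power_at_0[OF assms, of 0] Li_ln_power_at_0[OF True, of 0]] by simp
next
  case False
  thus ?thesis
    using tendsto_divide[OF Li_ln_power_at_0[OF assms, of "length w"] tendsto_const[of "fact (length w)"]]
    by (simp add: Li_replicate_x)
qed

lemma Li_replicate_x_at_1:
  assumes "Letter_y \<notin> set w" "w \<noteq> []"
  shows "(Li w \<longlongrightarrow> 0) (at_left 1)"
proof -
  have "((\<lambda>u::real. ln u ^ length w / fact (length w)) \<longlongrightarrow> ln 1 ^ length w / fact (length w)) (at_left 1)"
    by (intro tendsto_intros) auto
  moreover have "Li w = (\<lambda>u. ln u ^ length w / fact (length w))" using assms by (auto simp: Li_replicate_x)
  ultimately show ?thesis using assms by (simp add: power_0_left)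
qed

lemma tendsto_ev:
  assumes "\<And>a. a \<in> keys v \<Longrightarrow> (f a \<longlongrightarrow> 0) F"
  shows "((\<lambda>u. ev (\<lambda>a. f a u) v) \<longlongrightarrow> 0) F"
proof -
  have "((\<lambda>u. ev (\<lambda>a. f a u) v) \<longlongrightarrow> (\<Sum>a\<in>keys v. of_rat (coefficient v a) * 0)) F"
    unfolding ev_def by (intro tendsto_sum tendsto_mult tendsto_const assms)
  thus ?thesis by simp
qed

text \<open>By the last-letter recursion and induction, both sides have the same derivative, so they
  differ by a constant, which a limit at an end point shows to be 0.\<close>

lemma Li_shuffle:
  assumes "0 < u" "u < 1"
  shows "ev (\<lambda>w. Li w u) (shuffle_word v w) = Li v u * Li w u"
  using assms
proof (induction v w arbitrary: u rule: double_rev_induct)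
  case (snoc v a w b)
  define F where "F u = Li (v @ [a]) u * Li (w @ [b]) u - ev (\<lambda>x. Li x u) (shuffle_word (v @ [a]) (w @ [b]))" for u
  have "(F has_real_derivative 0) (at u)" if u: "0 < u" "u < 1" for u
  proof -
    have "(F has_real_derivative (form a u * Li v u * Li (w @ [b]) u + form b u * Li w u * Li (v @ [a]) u
      - (ev (\<lambda>x. form a u * Li x u) (shuffle_word v (w @ [b]))
         + ev (\<lambda>x. form b u * Li x u) (shuffle_word (v @ [a]) w)))) (at u)"
      unfolding F_def[abs_def] ev_shuffle_snoc
      by (intro DERIV_diff DERIV_mult DERIV_add ev_has_derivative Li_deriv u)
    also have "form a u * Li v u * Li (w @ [b]) u + form b u * Li w u * Li (v @ [a]) u
      - (ev (\<lambda>x. form a u * Li x u) (shuffle_word v (w @ [b]))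
         + ev (\<lambda>x. form b u * Li x u) (shuffle_word (v @ [a]) w)) = 0"
      by (simp only: ev_fun_mult snoc.IH(1)[OF u] snoc.IH(3)[OF u]) (simp add: algebra_simps)
    finally show ?thesis .
  qed
  hence "\<exists>c. \<forall>u\<in>{0<..<1}. F u = c"
    by (intro has_field_derivative_zero_constant) (auto intro: has_field_derivative_at_within)
  then obtain c where c: "\<And>u. 0 < u \<Longrightarrow> u < 1 \<Longrightarrow> F u = c" by auto
  have set_keys: "set x = set (v @ [a]) \<union> set (w @ [b])" if "x \<in> keys (shuffle_word (v @ [a]) (w @ [b]))" for x
    using arg_cong[OF mset_shuffle_word[OF that], of set_mset] by simp
  have "c = 0"
  \<comment> \<open>Words containing \<open>y\<close> vanish at 0 even against powers of
    \<open>ln u\<close>. Words in \<open>x\<close> alone are powers of \<open>ln u\<close>,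
    unbounded at 0, so for them the constant is read off at 1.\<close>
  proof (cases "Letter_y \<in> set (v @ [a]) \<union> set (w @ [b])")
    case True
    have prod: "((\<lambda>u. Li (v @ [a]) u * Li (w @ [b]) u) \<longlongrightarrow> 0) (at_right 0)"
    proof (cases "Letter_y \<in> set (v @ [a])")
      case True
      thus ?thesis by (rule Li_mult_at_0)
    next
      case False
      hence "Letter_y \<in> set (w @ [b])" using True by simp
      thus ?thesis by (subst mult.commute) (rule Li_mult_at_0)
    qed
    have "((\<lambda>u. ev (\<lambda>x. Li x u) (shuffle_word (v @ [a]) (w @ [b]))) \<longlongrightarrow> 0) (at_right 0)"
    proof (rule tendsto_ev)
      fix x assume "x \<in> keys (shuffle_word (v @ [a]) (w @ [b]))"
      hence "Letter_y \<in> set x" using True set_keys by simp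
      from Li_ln_power_at_0[OF this, of 0] show "(Li x \<longlongrightarrow> 0) (at_right 0)" by simp
    qed
    from tendsto_diff[OF prod this] have "(F \<longlongrightarrow> 0) (at_right 0)" by (simp add: F_def[abs_def])
    moreover have "eventually (\<lambda>u. F u = c) (at_right 0)"
      using eventually_at_right_real[OF zero_less_one] by eventually_elim (rule c; simp)
    ultimately have "((\<lambda>_. c) \<longlongrightarrow> 0) (at_right (0::real))" by (rule Lim_transform_eventually)
    thus ?thesis by (simp add: tendsto_const_iff)
  next
    case False
    have prod: "((\<lambda>u. Li (v @ [a]) u * Li (w @ [b]) u) \<longlongrightarrow> 0 * 0) (at_left 1)"
    proof (rule tendsto_mult)
      show "(Li (v @ [a]) \<longlongrightarrow> 0) (at_left 1)"
        by (rule Li_replicate_x_at_1) (use False in simp_all)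
      show "(Li (w @ [b]) \<longlongrightarrow> 0) (at_left 1)"
        by (rule Li_replicate_x_at_1) (use False in simp_all)
    qed
    have "((\<lambda>u. ev (\<lambda>x. Li x u) (shuffle_word (v @ [a]) (w @ [b]))) \<longlongrightarrow> 0) (at_left 1)"
    proof (rule tendsto_ev)
      fix x assume "x \<in> keys (shuffle_word (v @ [a]) (w @ [b]))"
      hence x: "set x = set (v @ [a]) \<union> set (w @ [b])" by (rule set_keys)
      show "(Li x \<longlongrightarrow> 0) (at_left 1)"
      proof (rule Li_replicate_x_at_1)
        show "Letter_y \<notin> set x" unfolding x by (rule False)
        have "set x \<noteq> {}" unfolding x by simp
        thus "x \<noteq> []" by simp
      qed
    qed
    from tendsto_diff[OF prod this] have "(F \<longlongrightarrow> 0) (at_left 1)" by (simp add: F_def[abs_def])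
    moreover have "eventually (\<lambda>u. F u = c) (at_left 1)"
      using eventually_at_left_real[OF zero_less_one] by eventually_elim (rule c; simp)
    ultimately have "((\<lambda>_. c) \<longlongrightarrow> 0) (at_left (1::real))" by (rule Lim_transform_eventually)
    thus ?thesis by (simp add: tendsto_const_iff)
  qed
  with c[OF snoc.prems] show ?case by (simp add: F_def)
qed simp_all

section \<open>Asymptotic behaviour of multiple polylogarithms\<close>

text \<open>The divergent quantity is the polylogarithm of the index (1) itself, so that the
  regularized value at (1) is 0.\<close>

definition Lam :: "real \<Rightarrow> real" where
  "Lam u = - ln (1 - u)"

abbreviation polylog_limit :: "(real \<Rightarrow> real) \<Rightarrow> real \<Rightarrow> bool" where
  "polylog_limit \<equiv> reg_limit (at_left 1) Lam"

lemma Lam_at_top: "filterlim Lam at_top (at_left 1)"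
  unfolding Lam_def[abs_def] by real_asymp

lemma Lam_props:
  assumes "0 \<le> u" "u < 1"
  shows "Lam u \<ge> 0" "exp (- Lam u) = 1 - u" "exp (Lam u / 2) = 1 / sqrt (1 - u)"
    "exp (- (1/2) * Lam u) = sqrt (1 - u)"
proof -
  show "Lam u \<ge> 0" using assms by (simp add: Lam_def)
  show "exp (- Lam u) = 1 - u" using assms by (simp add: Lam_def)
  have e: "exp (ln (1 - u) / 2) = sqrt (1 - u)"
    using assms by (simp add: ln_sqrt[symmetric])
  show "exp (- (1/2) * Lam u) = sqrt (1 - u)" using e by (simp add: Lam_def)
  have "exp (Lam u / 2) = inverse (exp (ln (1 - u) / 2))" by (simp add: Lam_def exp_minus[symmetric])
  thus "exp (Lam u / 2) = 1 / sqrt (1 - u)" using e by (simp add: inverse_eq_divide)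
qed

text \<open>The bound \<open>K / sqrt (1 - u)\<close> is integrable up to 1. Concretely,
  \<open>2 * K * sqrt (1 - u)\<close> added to \<open>f\<close> or to \<open>- f\<close> is
  nonincreasing, which makes \<open>f\<close> Cauchy along a sequence tending to 1.\<close>

lemma limit_of_derivative_bound:
  fixes f f' :: "real \<Rightarrow> real"
  assumes deriv: "\<And>u. 1/2 \<le> u \<Longrightarrow> u < 1 \<Longrightarrow> (f has_real_derivative f' u) (at u)"
    and bound: "\<And>u. 1/2 \<le> u \<Longrightarrow> u < 1 \<Longrightarrow> \<bar>f' u\<bar> \<le> K / sqrt (1 - u)"
  shows "\<exists>c. \<forall>u\<in>{1/2..<1}. \<bar>f u - c\<bar> \<le> 2 * K * sqrt (1 - u)"
proof -
  have sqrt_deriv: "((\<lambda>u. sqrt (1 - u)) has_real_derivative - (1 / (2 * sqrt (1 - u)))) (at u)" if "u < 1" for u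
    using that by (auto intro!: derivative_eq_intros simp: field_simps)
  have le: "g v - g u \<le> 2 * K * sqrt (1 - u) - 2 * K * sqrt (1 - v)"
    if uv: "1/2 \<le> u" "u \<le> v" "v < 1"
      and g: "\<And>u. 1/2 \<le> u \<Longrightarrow> u < 1 \<Longrightarrow> (g has_real_derivative g' u) (at u)"
        "\<And>u. 1/2 \<le> u \<Longrightarrow> u < 1 \<Longrightarrow> g' u \<le> K / sqrt (1 - u)" for u v and g g' :: "real \<Rightarrow> real"
  proof -
    have "g u + 2 * K * sqrt (1 - u) \<ge> g v + 2 * K * sqrt (1 - v)"
    proof (rule DERIV_nonpos_imp_nonincreasing[OF uv(2)])
      fix x assume x: "u \<le> x" "x \<le> v"
      have "((\<lambda>u. g u + 2 * K * sqrt (1 - u)) has_real_derivative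
          g' x + 2 * K * - (1 / (2 * sqrt (1 - x)))) (at x)"
        using x uv by (intro DERIV_add DERIV_cmult g sqrt_deriv) auto
      moreover have "g' x + 2 * K * - (1 / (2 * sqrt (1 - x))) \<le> 0"
        using g(2)[of x] x uv by simp
      ultimately show "\<exists>y. ((\<lambda>u. g u + 2 * K * sqrt (1 - u)) has_real_derivative y) (at x) \<and> y \<le> 0" by blast
    qed
    thus ?thesis by simp
  qed
  have diff: "\<bar>f v - f u\<bar> \<le> 2 * K * sqrt (1 - u) - 2 * K * sqrt (1 - v)"
    if uv: "1/2 \<le> u" "u \<le> v" "v < 1" for u v
  proof -
    have "f v - f u \<le> 2 * K * sqrt (1 - u) - 2 * K * sqrt (1 - v)"
      by (rule le[OF uv deriv]) (use bound in \<open>auto simp: abs_le_iff\<close>)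
    moreover have "- f v - - f u \<le> 2 * K * sqrt (1 - u) - 2 * K * sqrt (1 - v)"
      by (rule le[OF uv DERIV_minus[OF deriv]]) (use bound in \<open>auto simp: abs_le_iff\<close>)
    ultimately show ?thesis by (simp add: abs_le_iff)
  qed
  define x where "x n = 1 - 1 / real (n + 2)" for n
  have x: "1/2 \<le> x n" "x n < 1" for n by (auto simp: x_def field_simps)
  have x_lim: "x \<longlonglongrightarrow> 1" unfolding x_def[abs_def] by real_asymp
  have "(\<lambda>n. 2 * K * sqrt (1 - x n)) \<longlonglongrightarrow> 2 * K * sqrt (1 - 1)"
    by (intro tendsto_intros x_lim)
  hence cauchy: "Cauchy (\<lambda>n. 2 * K * sqrt (1 - x n))" by (rule LIMSEQ_imp_Cauchy)
  have "Cauchy (\<lambda>n. f (x n))"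
  proof (rule metric_CauchyI)
    fix e :: real assume "e > 0"
    then obtain M where M: "\<And>m n. m \<ge> M \<Longrightarrow> n \<ge> M \<Longrightarrow>
        dist (2 * K * sqrt (1 - x m)) (2 * K * sqrt (1 - x n)) < e"
      using metric_CauchyD[OF cauchy] by blast
    have "dist (f (x m)) (f (x n)) \<le> dist (2 * K * sqrt (1 - x m)) (2 * K * sqrt (1 - x n))" for m n
    proof (cases "x m \<le> x n")
      case True
      show ?thesis using diff[OF x(1) True x(2)] unfolding dist_real_def by linarith
    next
      case False
      hence "x n \<le> x m" by simp
      from diff[OF x(1) this x(2)] show ?thesis unfolding dist_real_def by linarith
    qed
    thus "\<exists>M. \<forall>m\<ge>M. \<forall>n\<ge>M. dist (f (x m)) (f (x n)) < e" using M by (meson le_less_trans)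
  qed
  then obtain c where c: "(\<lambda>n. f (x n)) \<longlonglongrightarrow> c" using Cauchy_convergent convergent_def by blast
  have "\<bar>f u - c\<bar> \<le> 2 * K * sqrt (1 - u)" if u: "1/2 \<le> u" "u < 1" for u
  proof (rule tendsto_upperbound)
    show "(\<lambda>n. \<bar>f u - f (x n)\<bar>) \<longlonglongrightarrow> \<bar>f u - c\<bar>" by (intro tendsto_intros c)
    have "0 \<le> K / sqrt (1 - 1/2)" by (rule order.trans[OF abs_ge_zero bound]) simp_all
    hence K: "K \<ge> 0" by (simp add: zero_le_divide_iff)
    have "eventually (\<lambda>n. x n > u) sequentially" using order_tendstoD(1)[OF x_lim] u by blast
    thus "\<forall>\<^sub>F n in sequentially. \<bar>f u - f (x n)\<bar> \<le> 2 * K * sqrt (1 - u)"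
    proof eventually_elim
      case (elim n)
      have "2 * K * sqrt (1 - x n) \<ge> 0" using K x[of n] by simp
      thus ?case using diff[of u "x n"] elim u x[of n] by (simp add: abs_minus_commute)
    qed
  qed simp
  thus ?thesis by (intro exI[of _ c]) auto
qed

lemma Lis_expansion_step_convergent:
  assumes "is_index (k # ks)"
    and "\<And>u. 1/2 \<le> u \<Longrightarrow> u < 1 \<Longrightarrow> \<bar>Lis (k # ks) u - poly p (Lam u)\<bar> \<le> K * sqrt (1 - u)"
  shows "\<exists>c K. \<forall>u\<in>{1/2..<1}. \<bar>Lis (Suc k # ks) u - c\<bar> \<le> K * sqrt (1 - u)"
proof -
  have "0 \<le> K * sqrt (1 - 1/2)" by (rule order.trans[OF abs_ge_zero assms(2)]) simp_all
  hence K: "K \<ge> 0" by (simp add: zero_le_mult_iff)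
  obtain C where C: "C \<ge> 0" "\<And>x. x \<ge> 0 \<Longrightarrow> \<bar>poly p x\<bar> \<le> C * exp (x / 4)"
    using poly_le_exp by blast
  have "\<exists>c. \<forall>u\<in>{1/2..<1}. \<bar>Lis (Suc k # ks) u - c\<bar> \<le> 2 * (2 * (C + K)) * sqrt (1 - u)"
  proof (rule limit_of_derivative_bound)
    fix u :: real assume u: "1/2 \<le> u" "u < 1"
    show "(Lis (Suc k # ks) has_real_derivative Lis (k # ks) u / u) (at u)"
      using u by (intro Lis_deriv_Suc assms) auto
    have L: "Lam u \<ge> 0" "exp (Lam u / 2) = 1 / sqrt (1 - u)" using u Lam_props[of u] by auto
    have s: "0 < sqrt (1 - u)" "sqrt (1 - u) \<le> 1" using u by auto
    have "\<bar>poly p (Lam u)\<bar> \<le> C * exp (Lam u / 4)" by (rule C(2)[OF L(1)])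
    also have "\<dots> \<le> C * exp (Lam u / 2)" using L(1) C(1) by (intro mult_left_mono) auto
    finally have 1: "\<bar>poly p (Lam u)\<bar> \<le> C * (1 / sqrt (1 - u))" unfolding L(2) .
    have "sqrt (1 - u) \<le> 1 / sqrt (1 - u)" using s by (simp add: pos_le_divide_eq u less_imp_le)
    hence 2: "K * sqrt (1 - u) \<le> K * (1 / sqrt (1 - u))" using K by (intro mult_left_mono)
    have "\<bar>Lis (k # ks) u\<bar> \<le> (C + K) / sqrt (1 - u)"
      using 1 2 assms(2)[OF u] by (simp add: add_divide_distrib)
    hence "\<bar>Lis (k # ks) u\<bar> / u \<le> ((C + K) / sqrt (1 - u)) / (1/2)"
      using u by (intro frac_le) auto
    thus "\<bar>Lis (k # ks) u / u\<bar> \<le> 2 * (C + K) / sqrt (1 - u)"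
      using u by (simp add: field_simps)
  qed
  thus ?thesis by blast
qed

text \<open>As \<open>Lam\<close> has derivative \<open>1 / (1 - u)\<close>, an antiderivative
  \<open>P\<close> of \<open>p\<close> reproduces the main term, and the error is
  \<open>K * sqrt (1 - u) / (1 - u)\<close>, still integrable.\<close>

lemma Lis_expansion_step_divergent:
  assumes "is_index ks"
    and "\<And>u. 1/2 \<le> u \<Longrightarrow> u < 1 \<Longrightarrow> \<bar>Lis ks u - poly p (Lam u)\<bar> \<le> K * sqrt (1 - u)"
  shows "\<exists>q K. \<forall>u\<in>{1/2..<1}. \<bar>Lis (1 # ks) u - poly q (Lam u)\<bar> \<le> K * sqrt (1 - u)"
proof -
  obtain P where P: "pderiv P = p" using poly_antiderivative by blast
  have "\<exists>c. \<forall>u\<in>{1/2..<1}. \<bar>(Lis (1 # ks) u - poly P (Lam u)) - c\<bar> \<le> 2 * K * sqrt (1 - u)"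
  proof (rule limit_of_derivative_bound)
    fix u :: real assume u: "1/2 \<le> u" "u < 1"
    have "(Lam has_real_derivative 1 / (1 - u)) (at u)"
      unfolding Lam_def[abs_def] using u by (auto intro!: derivative_eq_intros)
    from DERIV_chain2[OF poly_DERIV this, of P]
    have "((\<lambda>u. poly P (Lam u)) has_real_derivative poly p (Lam u) * (1 / (1 - u))) (at u)"
      unfolding P .
    thus "((\<lambda>u. Lis (1 # ks) u - poly P (Lam u)) has_real_derivative
        Lis ks u / (1 - u) - poly p (Lam u) * (1 / (1 - u))) (at u)"
      using u by (intro DERIV_diff Lis_deriv_1 assms) auto
    have s: "sqrt (1 - u) > 0" "sqrt (1 - u) * sqrt (1 - u) = 1 - u" using u by auto
    have "\<bar>Lis ks u / (1 - u) - poly p (Lam u) * (1 / (1 - u))\<bar> = \<bar>Lis ks u - poly p (Lam u)\<bar> / (1 - u)"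
      using u by (simp add: diff_divide_distrib[symmetric])
    also have "\<dots> \<le> K * sqrt (1 - u) / (1 - u)"
      using u assms(2)[OF u] by (intro divide_right_mono) auto
    also have "\<dots> = K * sqrt (1 - u) / (sqrt (1 - u) * sqrt (1 - u))" by (simp only: s(2))
    also have "\<dots> = K / sqrt (1 - u)"
      using s(1) by (rule less_imp_neq[symmetric, THEN nonzero_mult_divide_mult_cancel_right])
    finally show "\<bar>Lis ks u / (1 - u) - poly p (Lam u) * (1 / (1 - u))\<bar> \<le> K / sqrt (1 - u)" .
  qed
  then obtain c where c: "\<forall>u\<in>{1/2..<1}. \<bar>(Lis (1 # ks) u - poly P (Lam u)) - c\<bar> \<le> 2 * K * sqrt (1 - u)" ..
  have "poly (P + [:c:]) (Lam u) = poly P (Lam u) + c" for u by simp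
  thus ?thesis
    using c by (intro exI[of _ "P + [:c:]"] exI[of _ "2 * K"]) (auto simp: algebra_simps)
qed

lemma Lis_expansion:
  assumes "is_index ks"
  shows "\<exists>p K. \<forall>u\<in>{1/2..<1}. \<bar>Lis ks u - poly p (Lam u)\<bar> \<le> K * sqrt (1 - u)"
  using assms
proof (induction ks)
  case Nil
  show ?case by (intro exI[of _ 1] exI[of _ 0]) auto
next
  case (Cons k ks)
  hence "1 \<le> k" "is_index ks" by auto
  from this(1) show ?case
  proof (induction k rule: dec_induct)
    case base
    from Cons.IH[OF \<open>is_index ks\<close>] obtain p K where
      "\<forall>u\<in>{1/2..<1}. \<bar>Lis ks u - poly p (Lam u)\<bar> \<le> K * sqrt (1 - u)" by blast
    hence "\<And>u. 1/2 \<le> u \<Longrightarrow> u < 1 \<Longrightarrow> \<bar>Lis ks u - poly p (Lam u)\<bar> \<le> K * sqrt (1 - u)" by auto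
    from Lis_expansion_step_divergent[OF \<open>is_index ks\<close> this] show ?case by blast
  next
    case (step k)
    from step.IH obtain p K where
      "\<forall>u\<in>{1/2..<1}. \<bar>Lis (k # ks) u - poly p (Lam u)\<bar> \<le> K * sqrt (1 - u)" by blast
    hence "\<And>u. 1/2 \<le> u \<Longrightarrow> u < 1 \<Longrightarrow> \<bar>Lis (k # ks) u - poly p (Lam u)\<bar> \<le> K * sqrt (1 - u)"
      by auto
    from Lis_expansion_step_convergent[OF _ this] step.hyps \<open>is_index ks\<close>
    obtain c K where "\<forall>u\<in>{1/2..<1}. \<bar>Lis (Suc k # ks) u - c\<bar> \<le> K * sqrt (1 - u)" by auto
    thus ?case by (intro exI[of _ "[:c:]"] exI[of _ K]) simp
  qed
qed

lemma eventually_near_1: "eventually (\<lambda>u::real. u \<in> {1/2..<1}) (at_left 1)"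
  using eventually_at_left_real[of "1/2" "1::real"] by (auto elim!: eventually_mono)

lemma at_left_1_neq_bot: "at_left (1::real) \<noteq> bot"
  by simp

section \<open>Regularized values at 1 and the character on all words\<close>

definition zeta_sh_rev :: "nat list \<Rightarrow> real" where
  "zeta_sh_rev ks = (THE c. polylog_limit (Lis ks) c)"

lemma reg_limit_zeta_sh_rev:
  assumes "is_index ks"
  shows "polylog_limit (Lis ks) (zeta_sh_rev ks)"
proof -
  from Lis_expansion[OF assms] obtain p K
    where K: "\<forall>u\<in>{1/2..<1}. \<bar>Lis ks u - poly p (Lam u)\<bar> \<le> K * sqrt (1 - u)" by auto
  have "polylog_limit (Lis ks) (poly p 0)"
  proof (rule reg_limit_strong[OF exp_decay_negligible[OF Lam_at_top, of "1/2"]])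
    show "\<forall>\<^sub>F u in at_left 1. \<bar>Lis ks u - poly p (Lam u)\<bar> \<le> K * \<bar>exp (- (1 / 2) * Lam u)\<bar>"
      using eventually_near_1
    proof eventually_elim
      case (elim u)
      thus ?case using K Lam_props(4)[of u] by simp
    qed
  qed simp
  hence "\<exists>!c. polylog_limit (Lis ks) c"
    using reg_limit_unique[OF at_left_1_neq_bot Lam_at_top] by blast
  thus ?thesis unfolding zeta_sh_rev_def by (rule theI')
qed

text \<open>Near 1, \<open>ln u\<close> has order \<open>1 - u\<close>, that is,
  \<open>exp (- Lam u)\<close>. Positive powers of \<open>ln u\<close> therefore drop out of
  \<open>LL\<close>, and only its summand \<open>j = m\<close> contributes to the regularized
  value.\<close>

lemma reg_limit_ln: "polylog_limit ln 0"
proof -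
  have "polylog_limit ln (poly 0 0)"
  proof (rule reg_limit_strong[OF exp_decay_negligible[OF Lam_at_top, of 1]])
    show "\<forall>\<^sub>F u in at_left 1. \<bar>ln u - poly 0 (Lam u)\<bar> \<le> 2 * \<bar>exp (- 1 * Lam u)\<bar>"
      using eventually_near_1
    proof eventually_elim
      case (elim u)
      hence u: "1/2 \<le> u" "u < 1" by auto
      have "ln (1 / u) \<le> 1 / u - 1" using u by (intro ln_le_minus_one) auto
      hence "- ln u \<le> (1 - u) / u" using u by (simp add: ln_div field_simps)
      also have "\<dots> \<le> (1 - u) / (1/2)" using u by (intro divide_left_mono) auto
      finally show ?case using u Lam_props(2)[of u] by simp
    qed
  qed simp
  thus ?thesis by simp
qed

lemma reg_limit_power: "reg_limit F L f c \<Longrightarrow> reg_limit F L (\<lambda>x. f x ^ n) (c ^ n)"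
  by (induction n) (auto intro: reg_limit_const reg_limit_mult)

text \<open>This is \<open>Z\<close> of the overview, written down by its explicit formula; that it
  is the regularized limit of \<open>Li\<close>, and hence a character, is shown below.\<close>

definition zeta_word :: "letter list \<Rightarrow> real" where
  "zeta_word w = (- 1) ^ fst (parse w) * ev zeta_sh_rev (raise_index (fst (parse w)) (snd (parse w)))"

lemma reg_limit_LL:
  assumes "is_index ks"
  shows "polylog_limit (LL m ks) ((- 1) ^ m * ev zeta_sh_rev (raise_index m ks))"
proof -
  define z where "z j = ev zeta_sh_rev (raise_index j ks)" for j
  have raise: "polylog_limit (Lraise j ks) (z j)" for j
    unfolding Lraise_def[abs_def] z_def
    using keys_raise_index assms by (intro reg_limit_ev reg_limit_zeta_sh_rev) blast
  have "polylog_limit (\<lambda>u. \<Sum>j\<le>m. (1 / fact (m - j) * ln u ^ (m - j)) * ((- 1) ^ j * Lraise j ks u))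
      (\<Sum>j\<le>m. (1 / fact (m - j) * 0 ^ (m - j)) * ((- 1) ^ j * z j))"
    by (intro reg_limit_sum reg_limit_mult reg_limit_const reg_limit_power reg_limit_ln raise)
  also have "(\<Sum>j\<le>m. (1 / fact (m - j) * 0 ^ (m - j)) * ((- 1) ^ j * z j)) =
      (\<Sum>j\<le>m. if j = m then (- 1) ^ m * z m else 0)"
    by (intro sum.cong) auto
  also have "\<dots> = (- 1) ^ m * z m" by simp
  finally show ?thesis by (simp add: LL_def[abs_def] z_def)
qed

lemma reg_limit_zeta_word: "polylog_limit (Li w) (zeta_word w)"
  unfolding Li_def zeta_word_def by (intro reg_limit_LL parse_is_index)

lemma zeta_word_shuffle: "ev zeta_word (shuffle_word v w) = zeta_word v * zeta_word w"
proof (rule reg_limit_unique[OF at_left_1_neq_bot Lam_at_top])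
  show "polylog_limit (\<lambda>u. Li v u * Li w u) (zeta_word v * zeta_word w)"
    by (intro reg_limit_mult reg_limit_zeta_word)
  have "polylog_limit (\<lambda>u. ev (\<lambda>x. Li x u) (shuffle_word v w)) (ev zeta_word (shuffle_word v w))"
    by (intro reg_limit_ev reg_limit_zeta_word)
  moreover have "\<forall>\<^sub>F u in at_left 1. ev (\<lambda>x. Li x u) (shuffle_word v w) = Li v u * Li w u"
    using eventually_near_1 by eventually_elim (rule Li_shuffle; simp)
  ultimately show "polylog_limit (\<lambda>u. Li v u * Li w u) (ev zeta_word (shuffle_word v w))"
    by (rule reg_limit_cong)
qed

lemma Lis_1:
  assumes "0 \<le> u" "u < 1"
  shows "(\<lambda>n. u ^ Suc n / real (Suc n)) sums Lam u"
proof -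
  have "(\<lambda>n. - ((- (- u)) ^ n) / of_nat n) sums ln (1 + (- u))"
    using assms by (intro ln_series') auto
  hence "(\<lambda>n. u ^ n / real n) sums Lam u"
    using sums_minus by (fastforce simp: Lam_def)
  from sums_split_initial_segment[OF this, of 1] show ?thesis by simp
qed

lemma abel_limit:
  fixes a :: "nat \<Rightarrow> real"
  assumes "summable (\<lambda>n. \<bar>a n\<bar>)"
  shows "((\<lambda>u. suminf (\<lambda>n. a n * u ^ Suc n)) \<longlongrightarrow> suminf a) (at_left 1)"
proof -
  have lim: "((\<lambda>u::real. a n * u ^ Suc n) \<longlongrightarrow> a n) (at_left 1)" for n
  proof -
    have "((\<lambda>u::real. a n * u ^ Suc n) \<longlongrightarrow> a n * 1 ^ Suc n) (at_left 1)"
      by (intro tendsto_intros)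
    thus ?thesis by simp
  qed
  have "\<bar>a n * u ^ Suc n\<bar> \<le> \<bar>a n\<bar>" if "u \<in> {1/2..<1}" for n u
    using that mult_left_mono[of "u ^ Suc n" 1 "\<bar>a n\<bar>"]
    by (simp add: abs_mult power_le_one mult_le_one del: power_Suc)
  hence "\<forall>\<^sub>F (n, u) in sequentially \<times>\<^sub>F at_left 1. norm (a n * u ^ Suc n) \<le> \<bar>a n\<bar>"
    unfolding eventually_prod_filter case_prod_conv
    using eventually_near_1 by (intro exI[of _ "\<lambda>_. True"] exI[of _ "\<lambda>u. u \<in> {1/2..<1}"]) auto
  with tannerys_theorem[where a = "\<lambda>n u. a n * u ^ Suc n" and M = "\<lambda>n. \<bar>a n\<bar>", OF lim] assms at_left_1_neq_bot
  show ?thesis by blast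
qed

lemma zeta_sh_rev_admissible:
  assumes "admissible ks"
  shows "zeta_sh_rev (rev ks) = mzv ks"
proof (rule reg_limit_tendsto[OF at_left_1_neq_bot Lam_at_top reg_limit_zeta_sh_rev])
  show "is_index (rev ks)" using assms by (simp add: admissible_def)
  show "(Lis (rev ks) \<longlongrightarrow> mzv ks) (at_left 1)"
  proof (cases ks rule: rev_cases)
    case Nil
    have "Lis [] = (\<lambda>u. 1)" by auto
    thus ?thesis by (simp add: Nil)
  next
    case (snoc ls k)
    let ?a = "\<lambda>n. hs (rev ls) n / real (Suc n) ^ k"
    have nonneg: "?a n \<ge> 0" for n by (simp add: hs_nonneg)
    have "hs (rev ks) \<longlonglongrightarrow> mzv ks" using mzv_expansion[OF assms] by blast
    moreover have "hs (rev ks) = (\<lambda>N. \<Sum>n<N. ?a n)" by (rule ext) (simp add: snoc)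
    ultimately have sums: "?a sums mzv ks" by (simp add: sums_def)
    have "((\<lambda>u. suminf (\<lambda>n. ?a n * u ^ Suc n)) \<longlongrightarrow> suminf ?a) (at_left 1)"
      using sums_summable[OF sums] nonneg by (intro abel_limit) (simp only: abs_of_nonneg)
    moreover have "Lis (rev ks) = (\<lambda>u. suminf (\<lambda>n. ?a n * u ^ Suc n))" by (rule ext) (simp add: snoc Lis.simps)
    ultimately show ?thesis using sums_unique[OF sums] by simp
  qed
qed

text \<open>Both regularizations of \<open>(k\<^sub>1, \<dots>, k\<^sub>r, 1)\<close> with an admissible \<open>k\<close> are given by the same series.\<close>

lemma zeta_regularizations_agree:
  assumes "admissible ks"
  shows "zeta_harm (ks @ [1]) = zeta_sh_rev (1 # rev ks)"
proof -
  from mzv_expansion[OF assms] obtain K where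
    K: "\<And>N. \<bar>hs (rev ks) N - mzv ks\<bar> \<le> K / sqrt (real (Suc N))" by blast
  have ind: "is_index (rev ks)" using assms by (simp add: admissible_def)
  \<comment> \<open>Removing the limit from the numerators leaves an absolutely convergent series.
    The removed part is \<open>mzv ks\<close> times \<open>harm N\<close> in one case and times
    \<open>Lam u\<close> in the other, which is linear without constant term in both.\<close>
  define a where "a n = (hs (rev ks) n - mzv ks) / real (Suc n)" for n
  define c where "c = suminf a"
  have "\<bar>a n\<bar> \<le> K / (real (Suc n) * sqrt (real (Suc n)))" for n
    using divide_right_mono[OF K[of n], of "real (Suc n)"] by (simp add: a_def mult.commute)
  from sum_tail_bound(1)[OF this] have summable: "summable (\<lambda>n. \<bar>a n\<bar>)" .
  have "zeta_harm (ks @ [1]) = poly [:c, mzv ks:] 0"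
  proof (rule reg_limit_eqI[OF sequentially_bot harm_at_top reg_limit_zeta_harm])
    show "is_index (ks @ [1])" using ind by simp
    have "(\<lambda>N. \<Sum>n<N. a n) \<longlonglongrightarrow> c"
      unfolding c_def using summable_LIMSEQ[OF summable_rabs_cancel[OF summable]] .
    moreover have "(\<Sum>n<N. a n) = hs (1 # rev ks) N - mzv ks * harm N" for N
      unfolding hs_1[symmetric] a_def by (simp add: diff_divide_distrib sum_subtractf sum_distrib_left)
    ultimately have "(\<lambda>N. hs (1 # rev ks) N - mzv ks * harm N - c) \<longlonglongrightarrow> 0"
      by (simp add: LIM_zero)
    thus "(\<lambda>N. hs (rev (ks @ [1])) N - poly [:c, mzv ks:] (harm N)) \<longlonglongrightarrow> 0"
      by (simp add: algebra_simps del: hs.simps)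
  qed
  moreover have "zeta_sh_rev (1 # rev ks) = poly [:c, mzv ks:] 0"
  proof (rule reg_limit_eqI[OF at_left_1_neq_bot Lam_at_top reg_limit_zeta_sh_rev])
    show "is_index (1 # rev ks)" using ind by simp
    have lim: "((\<lambda>u. suminf (\<lambda>n. a n * u ^ Suc n)) \<longlongrightarrow> c) (at_left 1)"
      unfolding c_def by (rule abel_limit[OF summable])
    have "\<forall>\<^sub>F u in at_left 1. suminf (\<lambda>n. a n * u ^ Suc n) = Lis (1 # rev ks) u - mzv ks * Lam u"
      using eventually_near_1
    proof eventually_elim
      case (elim u)
      hence u: "0 \<le> u" "u < 1" "\<bar>u\<bar> < 1" by auto
      have "(\<lambda>n. hs (rev ks) n / real (Suc n) ^ 1 * u ^ Suc n) sums Lis (1 # rev ks) u"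
        unfolding Lis.simps using u ind by (intro summable_sums Lis_summable) auto
      from sums_diff[OF this sums_mult[OF Lis_1[OF u(1,2)], of "mzv ks"]]
      have "(\<lambda>n. a n * u ^ Suc n) sums (Lis (1 # rev ks) u - mzv ks * Lam u)"
        by (simp add: a_def diff_divide_distrib left_diff_distrib of_nat_Suc power_Suc)
      thus ?case using sums_unique by fastforce
    qed
    from Lim_transform_eventually[OF lim this]
    have "((\<lambda>u. Lis (1 # rev ks) u - mzv ks * Lam u - c) \<longlongrightarrow> 0) (at_left 1)"
      by (simp add: LIM_zero)
    thus "((\<lambda>u. Lis (1 # rev ks) u - poly [:c, mzv ks:] (Lam u)) \<longlongrightarrow> 0) (at_left 1)"
      by (simp add: algebra_simps)
  qed
  ultimately show ?thesis by simp
qed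

section \<open>The shuffle regularization\<close>

lemma zeta_word_replicate_x:
  assumes "is_index ks"
  shows "zeta_word (replicate m Letter_x @ word_of_index ks) =
     (- 1) ^ m * ev zeta_sh_rev (raise_index m (rev ks))"
  by (simp add: zeta_word_def parse_word_of_index[OF assms])

lemma raise_index_0: "raise_index 0 ks = basis ks"
  by (induction ks) (auto intro: ev_eqI simp: raise_index.simps)

lemma zeta_word_of_index: "is_index ks \<Longrightarrow> zeta_word (word_of_index ks) = zeta_sh_rev (rev ks)"
  using zeta_word_replicate_x[of ks 0] by (simp add: raise_index_0)

lemma zeta_sh_rev_1: "zeta_sh_rev [1] = 0"
proof (rule reg_limit_unique[OF at_left_1_neq_bot Lam_at_top reg_limit_zeta_sh_rev])
  have "\<forall>\<^sub>F u in at_left 1. Lam u = Lis [1] u"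
    using eventually_near_1
  proof eventually_elim
    case (elim u)
    thus ?case using sums_unique[OF Lis_1[of u]] by (simp add: Lis.simps)
  qed
  thus "polylog_limit (Lis [1]) 0"
    by (rule reg_limit_cong[OF reg_limit_base])
qed simp

lemma zeta_reg_Shuffle: "is_index ks \<Longrightarrow> zeta_reg Shuffle ks = zeta_sh_rev (rev ks)"
proof (rule reg_map_eqI[where z = "\<lambda>ks. zeta_sh_rev (rev ks)"])
  fix v w :: "nat list \<Rightarrow>\<^sub>0 rat" assume vw: "v \<in> index_space" "w \<in> index_space"
  have *: "ev (\<lambda>ks. zeta_sh_rev (rev ks)) v = ev zeta_word (to_words v)" if "v \<in> index_space" for v
    unfolding to_words_ev using that
    by (intro ev_cong) (simp add: index_space_def zeta_word_of_index)
  have "shuffle_prod v w \<in> index_space"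
    unfolding shuffle_prod_eq by (rule from_words_in_index_space)
  moreover from this have "ev (\<lambda>ks. zeta_sh_rev (rev ks)) (shuffle_prod v w) =
      ev (\<lambda>ks. zeta_sh_rev (rev ks)) v * ev (\<lambda>ks. zeta_sh_rev (rev ks)) w"
    by (simp only: * vw to_words_shuffle_prod ev_product_character zeta_word_shuffle)
  ultimately show "reg_prod Shuffle v w \<in> index_space \<and>
      ev (\<lambda>ks. zeta_sh_rev (rev ks)) (reg_prod Shuffle v w) =
      ev (\<lambda>ks. zeta_sh_rev (rev ks)) v * ev (\<lambda>ks. zeta_sh_rev (rev ks)) w"
    by simp
qed (use regularizable_shuffle zeta_sh_rev_admissible zeta_sh_rev_1 in auto)

section \<open>Shuffle products of alternating words\<close>

fun alt :: "'a \<Rightarrow> 'a \<Rightarrow> nat \<Rightarrow> 'a list" where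
  "alt a b 0 = []"
| "alt a b (Suc n) = a # alt b a n"

text \<open>The arbitrary function \<open>f\<close> allows leading letters to be split off: they are
  absorbed into \<open>f\<close>, and a sum of the same kind remains.\<close>

definition shuffle_sum :: "complex \<Rightarrow> (nat \<Rightarrow> 'a list) \<Rightarrow> (nat \<Rightarrow> 'a list) \<Rightarrow> nat \<Rightarrow> ('a list \<Rightarrow> real) \<Rightarrow> complex" where
  "shuffle_sum \<beta> u v n f = (\<Sum>j\<le>n. \<beta> ^ j * of_real (ev f (shuffle_word (u (n - j)) (v j))))"

lemma shuffle_sum_0: "shuffle_sum \<beta> (alt a b) (alt c d) 0 f = of_real (f [])"
  by (simp add: shuffle_sum_def)

text \<open>The first letter of a shuffle comes from one of the two factors; if it comes from the
  second, \<open>j\<close> drops by one, whence the factor \<open>\<beta>\<close>.\<close>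

lemma shuffle_sum_Suc:
  "shuffle_sum \<beta> (alt a b) (alt c d) (Suc n) f =
     shuffle_sum \<beta> (alt b a) (alt c d) n (\<lambda>w. f (a # w))
   + \<beta> * shuffle_sum \<beta> (alt a b) (alt d c) n (\<lambda>w. f (c # w))"
proof -
  define P where "P j = complex_of_real (ev (\<lambda>w. f (a # w)) (shuffle_word (alt b a (n - j)) (alt c d j)))" for j
  define Q where "Q j = complex_of_real (ev (\<lambda>w. f (c # w)) (shuffle_word (alt a b (n - j)) (alt d c j)))" for j
  have split_term: "complex_of_real (ev f (shuffle_word (alt a b (Suc n - j)) (alt c d j))) =
      (if j \<le> n then P j else 0) + (if j = 0 then 0 else Q (j - 1))" if "j \<le> Suc n" for j
  proof (cases j)
    case 0
    thus ?thesis by (simp add: P_def)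
  next
    case (Suc i)
    show ?thesis
    proof (cases "j \<le> n")
      case True
      hence "Suc n - j = Suc (n - j)" "n - i = Suc (n - j)" using Suc by auto
      thus ?thesis using True Suc by (simp add: P_def Q_def)
    next
      case False
      hence "i = n" "j = Suc n" using that Suc by auto
      thus ?thesis by (simp add: Q_def)
    qed
  qed
  have "shuffle_sum \<beta> (alt a b) (alt c d) (Suc n) f =
      (\<Sum>j\<le>Suc n. (if j \<le> n then \<beta> ^ j * P j else 0) + (if j = 0 then 0 else \<beta> ^ j * Q (j - 1)))"
    unfolding shuffle_sum_def by (intro sum.cong refl, subst split_term) (auto simp: algebra_simps)
  also have "\<dots> = (\<Sum>j\<le>Suc n. if j \<le> n then \<beta> ^ j * P j else 0) + (\<Sum>j\<le>Suc n. if j = 0 then 0 else \<beta> ^ j * Q (j - 1))"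
    by (rule sum.distrib)
  also have "(\<Sum>j\<le>Suc n. if j \<le> n then \<beta> ^ j * P j else 0) = (\<Sum>j\<le>n. \<beta> ^ j * P j)"
    by simp
  also have "(\<Sum>j\<le>Suc n. if j = 0 then 0 else \<beta> ^ j * Q (j - 1)) = \<beta> * (\<Sum>j\<le>n. \<beta> ^ j * Q j)"
    by (subst sum.atMost_Suc_shift) (simp add: sum_distrib_left mult.assoc)
  finally show ?thesis by (simp add: shuffle_sum_def P_def Q_def)
qed

text \<open>For \<open>\<beta> = \<i>\<close>, i.e. \<open>\<beta>\<^sup>2 = -1\<close>, the contributions in which the two alternating words get
  out of step cancel, and only words with the periodic pattern \<open>yyxx\<close> survive.\<close>

definition mixed_sum :: "'a \<Rightarrow> 'a \<Rightarrow> nat \<Rightarrow> ('a list \<Rightarrow> real) \<Rightarrow> complex" where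
  "mixed_sum a b n f = shuffle_sum \<i> (alt a b) (alt b a) n f + \<i> * shuffle_sum \<i> (alt b a) (alt a b) n f"

abbreviation alt_sum :: "'a \<Rightarrow> 'a \<Rightarrow> nat \<Rightarrow> ('a list \<Rightarrow> real) \<Rightarrow> complex" where
  "alt_sum a b \<equiv> shuffle_sum \<i> (alt a b) (alt a b)"

lemma alt_sum_Suc:
  "alt_sum a b (Suc n) f = mixed_sum b a n (\<lambda>w. f (a # w))"
  by (simp add: shuffle_sum_Suc mixed_sum_def)

text \<open>Words starting with \<open>a\<close> occur with weights 1 and \<open>\<i> * \<i>\<close>
  and cancel; words starting with \<open>b\<close> occur twice with weight
  \<open>\<i>\<close>.\<close>

lemma mixed_sum_Suc:
  "mixed_sum a b (Suc n) f = 2 * \<i> * alt_sum a b n (\<lambda>w. f (b # w))"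
proof -
  have "\<i> * (\<i> * z) = - z" for z by (simp add: mult.assoc[symmetric])
  thus ?thesis by (simp add: mixed_sum_def shuffle_sum_Suc algebra_simps)
qed

lemma mixed_sum_0: "mixed_sum a b 0 f = (1 + \<i>) * of_real (f [])"
  by (simp add: mixed_sum_def shuffle_sum_0 algebra_simps)

lemma alt_sum_2:
  "alt_sum a b (Suc (Suc n)) f =
     2 * \<i> * alt_sum b a n (\<lambda>w. f (a # a # w))"
  by (simp add: alt_sum_Suc mixed_sum_Suc)

text \<open>Two doubled letters contribute \<open>2 * \<i>\<close> each; their product is the -4 of
  the final formula.\<close>

lemma alt_sum_4:
  "alt_sum a b (4 + n) f =
     - 4 * alt_sum a b n (\<lambda>w. f ([a, a, b, b] @ w))"
proof -
  have "4 + n = Suc (Suc (Suc (Suc n)))" by simp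
  moreover have "2 * \<i> * (2 * \<i> * z) = - 4 * z" for z
    by (simp add: mult.assoc[symmetric] mult.left_commute[of \<i> 2])
  ultimately show ?thesis by (simp only: alt_sum_2 append.simps)
qed

definition periodic :: "'a \<Rightarrow> 'a \<Rightarrow> nat \<Rightarrow> 'a list" where
  "periodic a b n = concat (replicate n [a, a, b, b])"

lemma alt_sum_periodic:
  "alt_sum a b (4 * n + r) f =
     (- 4) ^ n * alt_sum a b r (\<lambda>w. f (periodic a b n @ w))"
proof (induction n arbitrary: f)
  case (Suc n)
  have "4 * Suc n + r = 4 + (4 * n + r)" by simp
  thus ?case by (simp only: alt_sum_4 Suc.IH) (simp add: periodic_def)
qed (simp add: periodic_def)

text \<open>After whole periods are removed, the lengths 0, 1, 2, 3 leave the factors 1, 1 + i, 2i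
  and -2 + 2i. The listed real and imaginary parts are chosen so that two of the four residues
  vanish, which makes the series below supported on even exponents.\<close>

lemma alt_sum_Re_Im:
  "Re (alt_sum a b (2 * (2 * n)) f) = (- 4) ^ n * f (periodic a b n)"
  "Im (alt_sum a b (2 * (2 * n)) f) = 0"
  "Re (alt_sum a b (2 * (2 * n) + 1) f) = (- 4) ^ n * f (periodic a b n @ [a])"
  "Im (alt_sum a b (2 * (2 * n) + 1) f) = (- 4) ^ n * f (periodic a b n @ [a])"
  "Re (alt_sum a b (2 * (2 * n + 1)) f) = 0"
  "Re (alt_sum a b (2 * (2 * n + 1) + 1) f) + Im (alt_sum a b (2 * (2 * n + 1) + 1) f) = 0"
proof -
  have 1: "alt_sum a b 1 f = (1 + \<i>) * of_real (f [a])" for f :: "'a list \<Rightarrow> real" and a b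
    using alt_sum_Suc[of a b 0 f] by (simp add: mixed_sum_0)
  have 2: "alt_sum a b 2 f = 2 * \<i> * of_real (f [a, a])" for f :: "'a list \<Rightarrow> real"
    using alt_sum_2[of a b 0 f] by (simp add: shuffle_sum_0 numeral_2_eq_2)
  have 3: "alt_sum a b 3 f = 2 * \<i> * ((1 + \<i>) * of_real (f [a, a, b]))" for f :: "'a list \<Rightarrow> real"
    using alt_sum_2[of a b 1 f] 1[of b a "\<lambda>w. f (a # a # w)"] by (simp add: numeral_3_eq_3)
  have c: "(- 4 :: complex) ^ n = of_real ((- 4) ^ n)" by simp
  have eqs: "2 * (2 * n) = 4 * n" "2 * (2 * n + 1) = 4 * n + 2" "4 * n + 2 + 1 = 4 * n + 3" by simp_all
  show "Re (alt_sum a b (2 * (2 * n)) f) = (- 4) ^ n * f (periodic a b n)" "Im (alt_sum a b (2 * (2 * n)) f) = 0"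
    unfolding eqs using alt_sum_periodic[of a b n 0 f] by (simp_all add: shuffle_sum_0 c del: of_real_power)
  show "Re (alt_sum a b (2 * (2 * n) + 1) f) = (- 4) ^ n * f (periodic a b n @ [a])"
    "Im (alt_sum a b (2 * (2 * n) + 1) f) = (- 4) ^ n * f (periodic a b n @ [a])"
    "Re (alt_sum a b (2 * (2 * n + 1)) f) = 0"
    "Re (alt_sum a b (2 * (2 * n + 1) + 1) f) + Im (alt_sum a b (2 * (2 * n + 1) + 1) f) = 0"
    unfolding eqs alt_sum_periodic 1 2 3 c by (simp_all del: of_real_power)
qed

text \<open>Commutativity exchanges \<open>j\<close> and \<open>n - j\<close>, which have opposite
  parity for odd \<open>n\<close>, so the sum equals its own negative.\<close>

lemma shuffle_sum_antisym:
  assumes "odd n"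
  shows "shuffle_sum (- 1) (alt a b) (alt a b) n f = 0"
proof -
  have "shuffle_sum (- 1) (alt a b) (alt a b) n f =
     (\<Sum>j\<le>n. (- 1) ^ (n - j) * of_real (ev f (shuffle_word (alt a b j) (alt a b (n - j)))))"
    unfolding shuffle_sum_def
    by (rule sum.reindex_bij_witness[of _ "\<lambda>j. n - j" "\<lambda>j. n - j"]) auto
  also have "\<dots> = (\<Sum>j\<le>n. - ((- 1) ^ j * of_real (ev f (shuffle_word (alt a b (n - j)) (alt a b j)))))"
  proof (intro sum.cong refl)
    fix j assume j: "j \<in> {..n}"
    have "(- 1) ^ (n - j) = - ((- 1) ^ j :: complex)"
      using j assms by (cases "even j") auto
    thus "(- 1) ^ (n - j) * complex_of_real (ev f (shuffle_word (alt a b j) (alt a b (n - j)))) =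
      - ((- 1) ^ j * of_real (ev f (shuffle_word (alt a b (n - j)) (alt a b j))))"
      by (simp add: ev_shuffle_commute[of f "alt a b j"])
  qed
  also have "\<dots> = - shuffle_sum (- 1) (alt a b) (alt a b) n f"
    unfolding shuffle_sum_def by (rule sum_negf)
  finally show ?thesis by simp
qed

text \<open>Splitting off the first letter leaves two sums of equal alternating words of odd total
  length, both zero by antisymmetry.\<close>

lemma shuffle_sum_antipode:
  assumes "even n" "n > 0"
  shows "shuffle_sum (- 1) (alt a b) (alt b a) n f = 0"
proof -
  from assms obtain m where "n = Suc m" "odd m" by (cases n) auto
  thus ?thesis by (simp add: shuffle_sum_Suc shuffle_sum_antisym)
qed

section \<open>Generating functions\<close>

lemma sum_atMost_even: "(\<Sum>j\<le>2 * M. g j) = (\<Sum>k\<le>M. g (2 * k)) + (\<Sum>k<M. g (2 * k + 1))"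
  for g :: "nat \<Rightarrow> 'b :: ab_group_add"
  by (induction M) (auto simp: algebra_simps)

lemma sum_atMost_odd: "(\<Sum>j\<le>2 * M + 1. g j) = (\<Sum>k\<le>M. g (2 * k)) + (\<Sum>k\<le>M. g (2 * k + 1))"
  for g :: "nat \<Rightarrow> 'b :: ab_group_add"
  by (induction M) (auto simp: algebra_simps)

definition even_gf :: "(nat \<Rightarrow> letter list) \<Rightarrow> real fps" where
  "even_gf u = Abs_fps (\<lambda>k. zeta_word (u (2 * k)))"

definition odd_gf :: "(nat \<Rightarrow> letter list) \<Rightarrow> real fps" where
  "odd_gf u = Abs_fps (\<lambda>k. zeta_word (u (2 * k + 1)))"

definition fps_reflect :: "real fps \<Rightarrow> real fps" where
  "fps_reflect F = Abs_fps (\<lambda>k. (- 1) ^ k * fps_nth F k)"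

lemma fps_reflect_mult: "fps_reflect (F * G) = fps_reflect F * fps_reflect G"
proof (rule fps_ext)
  fix n
  have "(- 1) ^ n * (\<Sum>i=0..n. fps_nth F i * fps_nth G (n - i)) =
      (\<Sum>i=0..n. ((- 1) ^ i * fps_nth F i) * ((- 1) ^ (n - i) * fps_nth G (n - i)))"
    unfolding sum_distrib_left
  proof (intro sum.cong refl)
    fix i assume "i \<in> {0..n}"
    hence "(- 1 :: real) ^ n = (- 1) ^ i * (- 1) ^ (n - i)" by (simp flip: power_add)
    thus "(- 1) ^ n * (fps_nth F i * fps_nth G (n - i)) = (- 1) ^ i * fps_nth F i * ((- 1) ^ (n - i) * fps_nth G (n - i))"
      by simp
  qed
  thus "fps_nth (fps_reflect (F * G)) n = fps_nth (fps_reflect F * fps_reflect G) n"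
    by (simp add: fps_reflect_def fps_mult_nth)
qed

lemma fps_nth_mult_reflect:
  "fps_nth (F * fps_reflect G) n = (\<Sum>k\<le>n. (- 1) ^ k * (fps_nth F (n - k) * fps_nth G k))"
  by (subst mult.commute, subst fps_mult_nth) (simp add: fps_reflect_def atLeast0AtMost mult_ac)

lemma shuffle_sum_zeta_word:
  "shuffle_sum \<beta> u v n zeta_word = (\<Sum>j\<le>n. \<beta> ^ j * of_real (zeta_word (u (n - j)) * zeta_word (v j)))"
  by (simp add: shuffle_sum_def zeta_word_shuffle)

lemma power_i_even: "\<i> ^ (2 * k) = of_real ((- 1) ^ k)"
  by (simp add: power_mult)

text \<open>Even powers of \<open>\<i>\<close> are real and odd ones imaginary, with signs (-1)^k in
  both cases, which is the reflection of the second series. For even total length the lengths are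
  both even or both odd; two odd ones add up to two more than their halves account for, whence
  \<open>fps_X\<close>.\<close>

lemma shuffle_sum_even:
  "shuffle_sum \<i> u v (2 * M) zeta_word =
     Complex (fps_nth (even_gf u * fps_reflect (even_gf v)) M)
             (fps_nth (fps_X * (odd_gf u * fps_reflect (odd_gf v))) M)"
proof -
  let ?g = "\<lambda>j. \<i> ^ j * of_real (zeta_word (u (2 * M - j)) * zeta_word (v j))"
  have "(\<Sum>k\<le>M. ?g (2 * k)) = of_real (fps_nth (even_gf u * fps_reflect (even_gf v)) M)"
    unfolding fps_nth_mult_reflect of_real_sum power_i_even of_real_mult[symmetric]
    by (intro sum.cong refl) (simp add: even_gf_def diff_mult_distrib2 mult.assoc)
  moreover have "(\<Sum>k<M. ?g (2 * k + 1)) = \<i> * of_real (fps_nth (fps_X * (odd_gf u * fps_reflect (odd_gf v))) M)"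
  proof (cases M)
    case (Suc N)
    have "(\<Sum>k<M. ?g (2 * k + 1)) = (\<Sum>k\<le>N. \<i> * of_real ((- 1) ^ k * (fps_nth (odd_gf u) (N - k) * fps_nth (odd_gf v) k)))"
    proof (intro sum.cong)
      fix k assume "k \<in> {..N}"
      hence "2 * M - (2 * k + 1) = 2 * (N - k) + 1" using Suc by auto
      moreover have "\<i> ^ (2 * k + 1) = \<i> * of_real ((- 1) ^ k)" by (simp add: power_i_even del: of_real_power)
      ultimately show "?g (2 * k + 1) = \<i> * of_real ((- 1) ^ k * (fps_nth (odd_gf u) (N - k) * fps_nth (odd_gf v) k))"
        by (simp add: odd_gf_def mult.assoc del: of_real_power)
    qed (use Suc in auto)
    thus ?thesis by (simp add: Suc fps_nth_mult_reflect sum_distrib_left[symmetric])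
  qed simp
  ultimately show ?thesis
    unfolding shuffle_sum_zeta_word sum_atMost_even by (simp add: Complex_eq)
qed

lemma shuffle_sum_odd:
  "shuffle_sum \<i> u v (2 * M + 1) zeta_word =
     Complex (fps_nth (odd_gf u * fps_reflect (even_gf v)) M)
             (fps_nth (even_gf u * fps_reflect (odd_gf v)) M)"
proof -
  let ?g = "\<lambda>j. \<i> ^ j * of_real (zeta_word (u (2 * M + 1 - j)) * zeta_word (v j))"
  have "(\<Sum>k\<le>M. ?g (2 * k)) = of_real (fps_nth (odd_gf u * fps_reflect (even_gf v)) M)"
    unfolding fps_nth_mult_reflect of_real_sum power_i_even of_real_mult[symmetric]
  proof (intro sum.cong refl)
    fix k assume "k \<in> {..M}"
    hence "2 * M + 1 - 2 * k = 2 * (M - k) + 1" by auto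
    thus "complex_of_real ((- 1) ^ k * (zeta_word (u (2 * M + 1 - 2 * k)) * zeta_word (v (2 * k)))) =
      of_real ((- 1) ^ k * (fps_nth (odd_gf u) (M - k) * fps_nth (even_gf v) k))"
      by (simp add: even_gf_def odd_gf_def)
  qed
  moreover have "(\<Sum>k\<le>M. ?g (2 * k + 1)) = \<i> * of_real (fps_nth (even_gf u * fps_reflect (odd_gf v)) M)"
    unfolding fps_nth_mult_reflect of_real_sum sum_distrib_left
  proof (intro sum.cong refl)
    fix k assume "k \<in> {..M}"
    hence "2 * M + 1 - (2 * k + 1) = 2 * (M - k)" by auto
    moreover have "\<i> ^ (2 * k + 1) = \<i> * of_real ((- 1) ^ k)" by (simp add: power_i_even del: of_real_power)
    ultimately show "?g (2 * k + 1) = \<i> * of_real ((- 1) ^ k * (fps_nth (even_gf u) (M - k) * fps_nth (odd_gf v) k))"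
      by (simp add: even_gf_def odd_gf_def mult.assoc del: of_real_power)
  qed
  ultimately show ?thesis
    unfolding shuffle_sum_zeta_word sum_atMost_odd by (simp add: Complex_eq)
qed

text \<open>One step in the exponent stands for two letters, so a period of four letters advances it
  by two.\<close>

definition sparse :: "(nat \<Rightarrow> real) \<Rightarrow> real fps" where
  "sparse s = Abs_fps (\<lambda>m. if even m then (- 4) ^ (m div 2) * s (m div 2) else 0)"

lemma sparse_nth:
  "fps_nth (sparse s) (2 * n) = (- 4) ^ n * s n" "fps_nth (sparse s) (2 * n + 1) = 0"
  by (simp_all add: sparse_def)

lemma sparse_mult: "sparse s * sparse t = sparse (\<lambda>n. \<Sum>a\<le>n. s a * t (n - a))"
proof (rule fps_ext)
  fix m
  show "fps_nth (sparse s * sparse t) m = fps_nth (sparse (\<lambda>n. \<Sum>a\<le>n. s a * t (n - a))) m"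
  proof (cases "even m")
    case True
    then obtain n where m: "m = 2 * n" by (elim evenE)
    have "fps_nth (sparse s * sparse t) m =
        (\<Sum>a\<le>n. fps_nth (sparse s) (2 * a) * fps_nth (sparse t) (2 * n - 2 * a))
      + (\<Sum>a<n. fps_nth (sparse s) (2 * a + 1) * fps_nth (sparse t) (2 * n - (2 * a + 1)))"
      unfolding fps_mult_nth m atLeast0AtMost by (rule sum_atMost_even)
    also have "\<dots> = (\<Sum>a\<le>n. (- 4) ^ n * (s a * t (n - a)))"
    proof -
      have "fps_nth (sparse s) (2 * a) * fps_nth (sparse t) (2 * n - 2 * a) = (- 4) ^ n * (s a * t (n - a))"
        if "a \<le> n" for a
      proof -
        have "(- 4 :: real) ^ n = (- 4) ^ a * (- 4) ^ (n - a)" using that by (simp flip: power_add)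
        thus ?thesis unfolding diff_mult_distrib2[symmetric] sparse_nth by simp
      qed
      thus ?thesis unfolding sparse_nth(2) by simp
    qed
    also have "\<dots> = fps_nth (sparse (\<lambda>n. \<Sum>a\<le>n. s a * t (n - a))) m"
      unfolding m sparse_nth by (rule sum_distrib_left[symmetric])
    finally show ?thesis .
  next
    case False
    have "fps_nth (sparse s) i * fps_nth (sparse t) (m - i) = 0" if "i \<le> m" for i
      using False that by (auto simp: sparse_def)
    hence "fps_nth (sparse s * sparse t) m = 0" unfolding fps_mult_nth by (intro sum.neutral) auto
    thus ?thesis using False by (simp add: sparse_def)
  qed
qed

abbreviation alt_y :: "nat \<Rightarrow> letter list" where "alt_y \<equiv> alt Letter_y Letter_x"
abbreviation alt_x :: "nat \<Rightarrow> letter list" where "alt_x \<equiv> alt Letter_x Letter_y"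
abbreviation per :: "nat \<Rightarrow> letter list" where "per \<equiv> periodic Letter_y Letter_x"

text \<open>The generating functions of \<open>(yx)\<^sup>k\<close>, \<open>(yx)\<^sup>k y\<close>, \<open>x(yx)\<^sup>k\<close> and \<open>(xy)\<^sup>k\<close>; a prime denotes the
  substitution \<open>q \<mapsto> -q\<close>.\<close>

definition "gA = even_gf alt_y"
definition "gB = odd_gf alt_y"
definition "gC = odd_gf alt_x"
definition "gD = even_gf alt_x"
definition "gA' = fps_reflect gA"
definition "gB' = fps_reflect gB"
definition "gC' = fps_reflect gC"
definition "gD' = fps_reflect gD"

lemmas gf_defs = gA_def gB_def gC_def gD_def gA'_def gB'_def gC'_def gD'_def

lemmas yy_even = shuffle_sum_even[of alt_y alt_y, folded gf_defs]
  and yy_odd = shuffle_sum_odd[of alt_y alt_y, folded gf_defs]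
  and xx_even = shuffle_sum_even[of alt_x alt_x, folded gf_defs]
  and xx_odd = shuffle_sum_odd[of alt_x alt_x, folded gf_defs]
  and yx_even = shuffle_sum_even[of alt_y alt_x, folded gf_defs]
  and yx_odd = shuffle_sum_odd[of alt_y alt_x, folded gf_defs]
  and xy_even = shuffle_sum_even[of alt_x alt_y, folded gf_defs]
  and xy_odd = shuffle_sum_odd[of alt_x alt_y, folded gf_defs]

lemma fps_eq_sparseI:
  assumes "\<And>n. fps_nth F (2 * n) = c * ((- 4) ^ n * s n)" "\<And>n. fps_nth F (2 * n + 1) = 0"
  shows "F = fps_const c * sparse s"
proof (rule fps_ext)
  fix M show "fps_nth F M = fps_nth (fps_const c * sparse s) M"
    by (cases "even M"; elim evenE oddE) (simp_all only: assms fps_mult_left_const_nth sparse_nth mult_zero_right)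
qed

lemma Re_Im_2i: "Re (2 * \<i> * z) = - 2 * Im z" "Im (2 * \<i> * z) = 2 * Re z"
  by simp_all

section \<open>Quadratic relations between the generating functions\<close>

lemma gf_AA: "gA * gA' = sparse (\<lambda>n. zeta_word (per n))"
proof -
  have nth: "fps_nth (gA * gA') M = Re (alt_sum Letter_y Letter_x (2 * M) zeta_word)" for M
    by (simp add: yy_even)
  have "gA * gA' = fps_const 1 * sparse (\<lambda>n. zeta_word (per n))"
    by (rule fps_eq_sparseI) (simp_all only: nth alt_sum_Re_Im mult_1)
  thus ?thesis by simp
qed

text \<open>Odd total length: real and imaginary part agree for even exponents and cancel for odd
  ones, so their sum has the sparse form.\<close>

lemma gf_Y: "gB * gA' + gA * gB' = fps_const 2 * sparse (\<lambda>n. zeta_word (per n @ [Letter_y]))"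
proof -
  have nth: "fps_nth (gB * gA' + gA * gB') M =
      Re (alt_sum Letter_y Letter_x (2 * M + 1) zeta_word) + Im (alt_sum Letter_y Letter_x (2 * M + 1) zeta_word)" for M
    unfolding yy_odd by simp
  show ?thesis by (rule fps_eq_sparseI; unfold nth alt_sum_Re_Im) (simp_all only: mult_2)
qed

text \<open>Splitting the first letter off a mixed sum of odd length produces the leading
  \<open>x\<close> and the factor \<open>2 * \<i>\<close>, which turns an imaginary part into twice
  a real part.\<close>

lemma gf_AC: "gA * gC' + gC * gA' = fps_const 2 * sparse (\<lambda>n. zeta_word (Letter_x # per n))"
proof -
  have nth: "fps_nth (gA * gC' + gC * gA') M =
      2 * Re (alt_sum Letter_y Letter_x (2 * M) (\<lambda>w. zeta_word (Letter_x # w)))" for M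
  proof -
    have "fps_nth (gA * gC' + gC * gA') M = Im (mixed_sum Letter_y Letter_x (2 * M + 1) zeta_word)"
      unfolding mixed_sum_def yx_odd xy_odd by simp
    thus ?thesis by (simp only: Suc_eq_plus1[symmetric] mixed_sum_Suc Re_Im_2i)
  qed
  show ?thesis by (rule fps_eq_sparseI) (simp_all only: nth alt_sum_Re_Im mult_zero_right)
qed

lemma fps_eq_X_sparse_shiftI:
  assumes "fps_nth F 0 = 0" "\<And>M. fps_nth F (Suc M) = G M"
    "\<And>n. G (2 * n) = c * ((- 4) ^ n * s n)" "\<And>n. G (2 * n + 1) = 0"
  shows "F = fps_const c * (fps_X * sparse s)"
proof (rule fps_ext)
  fix M show "fps_nth F M = fps_nth (fps_const c * (fps_X * sparse s)) M"
  proof (cases M)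
    case (Suc N)
    thus ?thesis using assms(2-4) sparse_nth[of s] by (cases "even N"; elim evenE oddE) simp_all
  qed (use assms(1) in simp)
qed

text \<open>Alternating words starting with \<open>x\<close> produce a leading \<open>xx\<close>;
  what follows is an alternating sum starting with \<open>y\<close> again.\<close>

lemma gf_CC: "fps_X * (gC * gC') = fps_const 2 * (fps_X * sparse (\<lambda>n. zeta_word (Letter_x # Letter_x # per n)))"
proof (rule fps_eq_X_sparse_shiftI)
  fix M
  have "fps_nth (fps_X * (gC * gC')) (Suc M) = Im (alt_sum Letter_x Letter_y (2 * Suc M) zeta_word)"
    unfolding xx_even by simp
  thus "fps_nth (fps_X * (gC * gC')) (Suc M) =
      2 * Re (alt_sum Letter_y Letter_x (2 * M) (\<lambda>w. zeta_word (Letter_x # Letter_x # w)))"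
    by (simp only: mult_Suc_right add_2_eq_Suc alt_sum_2 Re_Im_2i)
qed (simp_all only: alt_sum_Re_Im mult_zero_right, simp)

lemma Im_minus_Re_2i: "Im (2 * \<i> * z) - Re (2 * \<i> * z) = 2 * (Re z + Im z)"
  by simp

lemma gf_DC: "gD * gC' - gC * gD' =
    fps_const 4 * (fps_X * sparse (\<lambda>n. zeta_word (Letter_x # Letter_x # per n @ [Letter_y])))"
proof (rule fps_eq_X_sparse_shiftI)
  let ?z = "\<lambda>M. alt_sum Letter_x Letter_y (2 * M + 1) zeta_word"
  let ?w = "\<lambda>M. alt_sum Letter_y Letter_x (2 * M + 1) (\<lambda>w. zeta_word (Letter_x # Letter_x # w))"
  have nth: "fps_nth (gD * gC' - gC * gD') M = Im (?z M) - Re (?z M)" for M unfolding xx_odd by simp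
  show "fps_nth (gD * gC' - gC * gD') 0 = 0"
    unfolding nth by (simp add: alt_sum_Suc mixed_sum_0)
  show "fps_nth (gD * gC' - gC * gD') (Suc M) = 2 * (Re (?w M) + Im (?w M))" for M
    by (simp only: nth mult_Suc_right add_2_eq_Suc add_Suc alt_sum_2 Im_minus_Re_2i)
qed (simp_all only: alt_sum_Re_Im, simp_all)

text \<open>In a mixed sum of even length \<open>2 * M + 2\<close>, one leading \<open>x\<close>
  splits off. The difference of imaginary and real part is taken because multiplication by
  \<open>2 * \<i>\<close> turns it into the sum that vanishes for odd \<open>M\<close>.\<close>

lemma gf_X1: "gD * gA' - gA * gD' + fps_X * (gB * gC') + fps_X * (gC * gB') =
    fps_const 4 * (fps_X * sparse (\<lambda>n. zeta_word (Letter_x # per n @ [Letter_y])))" (is "?F = _")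
proof (rule fps_eq_X_sparse_shiftI)
  let ?z = "\<lambda>M. mixed_sum Letter_y Letter_x (2 * M) zeta_word"
  let ?w = "\<lambda>M. alt_sum Letter_y Letter_x (2 * M + 1) (\<lambda>w. zeta_word (Letter_x # w))"
  have nth: "fps_nth ?F M = Im (?z M) - Re (?z M)" for M
    unfolding mixed_sum_def yx_even xy_even by (simp del: fps_X_mult_nth)
  show "fps_nth ?F 0 = 0" unfolding nth by (simp add: mixed_sum_0)
  show "fps_nth ?F (Suc M) = 2 * (Re (?w M) + Im (?w M))" for M
  proof -
    have "2 * Suc M = Suc (2 * M + 1)" by simp
    thus ?thesis by (simp only: nth mixed_sum_Suc Im_minus_Re_2i)
  qed
qed (simp_all only: alt_sum_Re_Im, simp_all)

lemma zeta_word_Nil [simp]: "zeta_word [] = 1"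
  using zeta_word_of_index[of "[]"] zeta_sh_rev_admissible[of "[]"] by simp

text \<open>The antipode relation in even length, sorted by the parity of \<open>j\<close>; it will
  serve to eliminate \<open>gB\<close> and \<open>gD\<close>.\<close>

lemma gf_det: "gA * gD - fps_X * (gB * gC) = 1"
proof (rule fps_ext)
  fix M
  let ?g = "\<lambda>j. (- 1) ^ j * (zeta_word (alt_y (2 * M - j)) * zeta_word (alt_x j))"
  have sum_eq: "(\<Sum>j\<le>2 * M. ?g j) = (if M = 0 then 1 else 0)"
  proof (cases "M = 0")
    case False
    hence "shuffle_sum (- 1) alt_y alt_x (2 * M) zeta_word = 0" by (intro shuffle_sum_antipode) auto
    moreover have "shuffle_sum (- 1) alt_y alt_x (2 * M) zeta_word = of_real (\<Sum>j\<le>2 * M. ?g j)"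
      unfolding shuffle_sum_zeta_word by simp
    ultimately show ?thesis using False by (simp only: of_real_eq_0_iff) simp
  qed simp
  have "(\<Sum>k\<le>M. ?g (2 * k)) = fps_nth (gD * gA) M"
    unfolding fps_mult_nth atLeast0AtMost
    by (intro sum.cong) (auto simp: gf_defs even_gf_def diff_mult_distrib2)
  moreover have "(\<Sum>k<M. ?g (2 * k + 1)) = - fps_nth (fps_X * (gB * gC)) M"
  proof (cases M)
    case (Suc N)
    have "(\<Sum>k<M. ?g (2 * k + 1)) = (\<Sum>k\<le>N. - (fps_nth gC k * fps_nth gB (N - k)))"
    proof (intro sum.cong)
      fix k assume "k \<in> {..N}"
      hence "2 * M - (2 * k + 1) = 2 * (N - k) + 1" using Suc by auto
      thus "?g (2 * k + 1) = - (fps_nth gC k * fps_nth gB (N - k))"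
        by (simp add: gf_defs odd_gf_def)
    qed (use Suc in auto)
    also have "\<dots> = - fps_nth (gC * gB) N"
      unfolding fps_mult_nth atLeast0AtMost by (rule sum_negf)
    finally show ?thesis by (simp add: Suc mult.commute)
  qed simp
  ultimately have "fps_nth (gD * gA) M - fps_nth (fps_X * (gB * gC)) M = (if M = 0 then 1 else 0)"
    using sum_eq unfolding sum_atMost_even by simp
  thus "fps_nth (gA * gD - fps_X * (gB * gC)) M = fps_nth 1 M"
    by (simp add: mult.commute[of gA] del: fps_X_mult_nth)
qed

text \<open>The same relation at -q; the reflection of \<open>fps_X\<close> changes the sign in the
  middle.\<close>

lemma gf_det': "gA' * gD' + fps_X * (gB' * gC') = 1"
proof -
  have "fps_reflect fps_X = - fps_X"
    by (rule fps_ext) (simp add: fps_reflect_def)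
  hence "gA' * gD' + fps_X * (gB' * gC') = fps_reflect (gA * gD) - fps_reflect (fps_X * (gB * gC))"
    by (simp add: gf_defs fps_reflect_mult)
  also have "\<dots> = fps_reflect (gA * gD - fps_X * (gB * gC))"
    by (rule fps_ext) (simp add: fps_reflect_def algebra_simps del: fps_X_mult_nth)
  also have "\<dots> = 1" unfolding gf_det by (rule fps_ext) (simp add: fps_reflect_def)
  finally show ?thesis .
qed

text \<open>With the sparse series abstracted to variables, this is pure ring arithmetic:
  \<open>gB\<close> and \<open>gD\<close> can be grouped into the two determinants, which equal
  1.\<close>

lemma gf_product_identity_2:
  assumes AA: "gA * gA' = U0" and Y: "gB * gA' + gA * gB' = fps_const 2 * Y"
    and CC: "fps_X * (gC * gC') = fps_const 2 * (fps_X * U2)"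
    and DC: "gD * gC' - gC * gD' = fps_const 4 * (fps_X * X2)"
  shows "fps_const 4 * (fps_X * (Y * U2 - U0 * X2)) = gA * gC - gA' * gC'"
proof -
  have c: "fps_const 4 = (fps_const 2 * fps_const 2 :: real fps)" by simp
  have "fps_const 4 * (fps_X * (Y * U2 - U0 * X2)) =
      (fps_const 2 * Y) * (fps_const 2 * (fps_X * U2)) - U0 * (fps_const 4 * (fps_X * X2))"
    by (simp add: c algebra_simps del: fps_const_mult)
  also have "\<dots> = (gB * gA' + gA * gB') * (fps_X * (gC * gC')) - gA * gA' * (gD * gC' - gC * gD')"
    unfolding assms ..
  also have "\<dots> = gA * gC * (gA' * gD' + fps_X * (gB' * gC')) - gA' * gC' * (gA * gD - fps_X * (gB * gC))"
    by (simp add: algebra_simps)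
  also have "\<dots> = gA * gC - gA' * gC'" unfolding gf_det gf_det' by simp
  finally show ?thesis .
qed

lemma gf_product_identity_1:
  assumes AA: "gA * gA' = U0" and Y: "gB * gA' + gA * gB' = fps_const 2 * Y"
    and AC: "gA * gC' + gC * gA' = fps_const 2 * U1"
    and X1: "gD * gA' - gA * gD' + fps_X * (gB * gC') + fps_X * (gC * gB') = fps_const 4 * (fps_X * X1)"
  shows "fps_const 4 * (fps_X * (U0 * X1 - Y * U1)) = gA' * gA' - gA * gA"
proof -
  have c: "fps_const 4 = (fps_const 2 * fps_const 2 :: real fps)" by simp
  have "fps_const 4 * (fps_X * (U0 * X1 - Y * U1)) =
      U0 * (fps_const 4 * (fps_X * X1)) - fps_X * ((fps_const 2 * Y) * (fps_const 2 * U1))"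
    by (simp add: c algebra_simps del: fps_const_mult)
  also have "\<dots> = gA * gA' * (gD * gA' - gA * gD' + fps_X * (gB * gC') + fps_X * (gC * gB'))
      - fps_X * ((gB * gA' + gA * gB') * (gA * gC' + gC * gA'))"
    unfolding assms ..
  also have "\<dots> = gA' * gA' * (gA * gD - fps_X * (gB * gC)) - gA * gA * (gA' * gD' + fps_X * (gB' * gC'))"
    by (simp add: algebra_simps)
  also have "\<dots> = gA' * gA' - gA * gA" unfolding gf_det gf_det' by simp
  finally show ?thesis .
qed

text \<open>Comparison of the coefficients at the odd exponent \<open>2 * n + 1\<close>, which the
  factor \<open>fps_X\<close> shifts to \<open>2 * n\<close> on the sparse side.\<close>

lemma convolution_identity_2:
  "(\<Sum>a\<le>n. zeta_word (per a @ [Letter_y]) * zeta_word (Letter_x # Letter_x # per (n - a))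
         - zeta_word (per a) * zeta_word (Letter_x # Letter_x # per (n - a) @ [Letter_y])) =
   (\<Sum>i\<le>2 * n + 1. zeta_word (alt_y (2 * i)) * zeta_word (alt_x (2 * (2 * n + 1 - i) + 1))) / (2 * (- 4) ^ n)"
proof -
  have "fps_nth (fps_const 4 * (fps_X * (sparse (\<lambda>n. zeta_word (per n @ [Letter_y])) *
        sparse (\<lambda>n. zeta_word (Letter_x # Letter_x # per n)) -
        sparse (\<lambda>n. zeta_word (per n)) *
        sparse (\<lambda>n. zeta_word (Letter_x # Letter_x # per n @ [Letter_y]))))) (2 * n + 1) =
     fps_nth (gA * gC - gA' * gC') (2 * n + 1)"
    unfolding gf_product_identity_2[OF gf_AA gf_Y gf_CC gf_DC] ..
  \<comment> \<open>At an odd exponent the reflected product has the opposite sign, so the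
    difference doubles; 2 against 4 leaves the denominator \<open>2 * (- 4) ^ n\<close>.\<close>
  also have "gA' * gC' = fps_reflect (gA * gC)" by (simp add: gf_defs fps_reflect_mult)
  finally have "4 * ((- 4) ^ n * (\<Sum>a\<le>n. zeta_word (per a @ [Letter_y]) * zeta_word (Letter_x # Letter_x # per (n - a))
         - zeta_word (per a) * zeta_word (Letter_x # Letter_x # per (n - a) @ [Letter_y]))) =
     2 * fps_nth (gA * gC) (2 * n + 1)"
    by (simp add: sparse_mult sparse_nth(1) fps_reflect_def sum_subtractf right_diff_distrib)
  moreover have "fps_nth (gA * gC) (2 * n + 1) =
     (\<Sum>i\<le>2 * n + 1. zeta_word (alt_y (2 * i)) * zeta_word (alt_x (2 * (2 * n + 1 - i) + 1)))"
    unfolding fps_mult_nth atLeast0AtMost by (simp add: gf_defs even_gf_def odd_gf_def del: sum.atMost_Suc alt.simps)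
  ultimately show ?thesis by (simp add: field_simps del: sum.atMost_Suc alt.simps)
qed

lemma convolution_identity_1:
  "(\<Sum>a\<le>n. zeta_word (per a) * zeta_word (Letter_x # per (n - a) @ [Letter_y])
         - zeta_word (per a @ [Letter_y]) * zeta_word (Letter_x # per (n - a))) =
   - (\<Sum>i\<le>2 * n + 1. zeta_word (alt_y (2 * i)) * zeta_word (alt_y (2 * (2 * n + 1 - i)))) / (2 * (- 4) ^ n)"
proof -
  have "fps_nth (fps_const 4 * (fps_X * (sparse (\<lambda>n. zeta_word (per n)) *
        sparse (\<lambda>n. zeta_word (Letter_x # per n @ [Letter_y])) -
        sparse (\<lambda>n. zeta_word (per n @ [Letter_y])) *
        sparse (\<lambda>n. zeta_word (Letter_x # per n))))) (2 * n + 1) =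
     fps_nth (gA' * gA' - gA * gA) (2 * n + 1)"
    unfolding gf_product_identity_1[OF gf_AA gf_Y gf_AC gf_X1] ..
  also have "gA' * gA' = fps_reflect (gA * gA)" by (simp add: gf_defs fps_reflect_mult)
  finally have "4 * ((- 4) ^ n * (\<Sum>a\<le>n. zeta_word (per a) * zeta_word (Letter_x # per (n - a) @ [Letter_y])
         - zeta_word (per a @ [Letter_y]) * zeta_word (Letter_x # per (n - a)))) =
     - 2 * fps_nth (gA * gA) (2 * n + 1)"
    by (simp add: sparse_mult sparse_nth(1) fps_reflect_def sum_subtractf right_diff_distrib)
  moreover have "fps_nth (gA * gA) (2 * n + 1) =
     (\<Sum>i\<le>2 * n + 1. zeta_word (alt_y (2 * i)) * zeta_word (alt_y (2 * (2 * n + 1 - i))))"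
    unfolding fps_mult_nth atLeast0AtMost by (simp add: gf_defs even_gf_def odd_gf_def del: sum.atMost_Suc alt.simps)
  ultimately show ?thesis by (simp add: field_simps del: sum.atMost_Suc alt.simps)
qed

section \<open>The values \<open>\<zeta>({2}\<^sup>k)\<close>\<close>

text \<open>The truncated sums are the elementary symmetric polynomials of the reciprocal squares up
  to N, whose generating function is this product.\<close>

lemma hs_2_sums: "(\<lambda>j. hs (replicate j 2) N * x ^ j) sums (\<Prod>k=1..N. 1 + x / real k ^ 2)"
proof (induction N)
  case 0
  have "(\<lambda>j. hs (replicate j 2) 0 * x ^ j) = (\<lambda>j. if j = 0 then 1 else 0)"
  proof
    fix j show "hs (replicate j 2) 0 * x ^ j = (if j = 0 then 1 else 0)" by (cases j) auto
  qed
  thus ?case using sums_single[of 0 "\<lambda>_. 1::real"] by simp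
next
  case (Suc N)
  define c where "c = x / real (Suc N) ^ 2"
  define g where "g j = (case j of 0 \<Rightarrow> 0 | Suc i \<Rightarrow> c * (hs (replicate i 2) N * x ^ i))" for j
  have "g sums (c * (\<Prod>k=1..N. 1 + x / real k ^ 2))"
    by (rule sums_Suc_imp) (use sums_mult[OF Suc, of c] in \<open>simp_all add: g_def\<close>)
  from sums_add[OF Suc this]
  have "(\<lambda>j. hs (replicate j 2) N * x ^ j + g j) sums ((1 + c) * (\<Prod>k=1..N. 1 + x / real k ^ 2))"
    by (simp add: algebra_simps)
  moreover have "hs (replicate j 2) (Suc N) * x ^ j = hs (replicate j 2) N * x ^ j + g j" for j
    by (cases j) (simp_all add: g_def c_def algebra_simps del: of_nat_Suc)
  ultimately show ?case by (simp add: c_def mult.commute del: of_nat_Suc)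
qed

lemma sum_inverse_squares_le: "(\<Sum>n<N. 1 / real (Suc n) ^ 2) \<le> 2"
proof -
  have "(\<Sum>n<Suc N. 1 / real (Suc n) ^ 2) \<le> 2 - 1 / real (Suc N)" for N
  proof (induction N)
    case (Suc N)
    have "1 / real (Suc (Suc N)) ^ 2 \<le> 1 / (real (Suc N) * real (Suc (Suc N)))"
      unfolding power2_eq_square by (intro divide_left_mono mult_right_mono mult_pos_pos) auto
    also have "\<dots> = 1 / real (Suc N) - 1 / real (Suc (Suc N))"
      by (simp add: field_simps)
    finally have "1 / real (Suc (Suc N)) ^ 2 \<le> 1 / real (Suc N) - 1 / real (Suc (Suc N))" .
    thus ?case using Suc by (subst sum.lessThan_Suc) linarith
  qed simp
  from this[of N] have "(\<Sum>n<Suc N. 1 / real (Suc n) ^ 2) \<le> 2"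
    by (rule order.trans) simp
  thus ?thesis by (rule order.trans[rotated]) simp
qed

text \<open>Uniform in \<open>N\<close>: each further 2 costs at most the sum of the reciprocal
  squares. It provides the geometric majorant for exchanging limit and series.\<close>

lemma hs_2_le: "hs (replicate j 2) N \<le> 2 ^ j"
proof (induction j arbitrary: N)
  case (Suc j)
  have "hs (replicate (Suc j) 2) N = (\<Sum>n<N. hs (replicate j 2) n / real (Suc n) ^ 2)" by simp
  also have "\<dots> \<le> (\<Sum>n<N. 2 ^ j * (1 / real (Suc n) ^ 2))"
  proof (rule sum_mono)
    fix n
    show "hs (replicate j 2) n / real (Suc n) ^ 2 \<le> 2 ^ j * (1 / real (Suc n) ^ 2)"
      using divide_right_mono[OF Suc[of n], of "real (Suc n) ^ 2"] by simp
  qed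
  also have "\<dots> = 2 ^ j * (\<Sum>n<N. 1 / real (Suc n) ^ 2)" by (simp only: sum_distrib_left)
  also have "\<dots> \<le> 2 ^ j * 2" by (intro mult_left_mono sum_inverse_squares_le) simp
  finally show ?case by simp
qed simp

lemma hs_2_tendsto: "hs (replicate j 2) \<longlonglongrightarrow> mzv (replicate j 2)"
  using hs_tendsto_mzv[of "replicate j 2" "2 ^ j"] hs_2_le by simp

lemma mzv_2_bounds: "0 \<le> mzv (replicate j 2)" "mzv (replicate j 2) \<le> 2 ^ j"
proof -
  show "0 \<le> mzv (replicate j 2)"
    by (rule tendsto_lowerbound[OF hs_2_tendsto]) (auto simp: hs_nonneg)
  show "mzv (replicate j 2) \<le> 2 ^ j"
    by (rule tendsto_upperbound[OF hs_2_tendsto]) (auto simp: hs_2_le)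
qed

text \<open>Letting N tend to infinity in the product gives Euler's product for the sine at
  \<open>x = - (z ^ 2)\<close>; its coefficients are then compared with those of the sine
  series.\<close>

lemma mzv_2: "mzv (replicate k 2) = pi ^ (2 * k) / fact (2 * k + 1)"
proof -
  define e where "e j = mzv (replicate j 2)" for j
  define p where "p j = pi ^ (2 * j) / fact (2 * j + 1)" for j
  have summable_M: "summable (\<lambda>j. 2 ^ j * \<bar>x\<bar> ^ j)" if "\<bar>x\<bar> < 1/4" for x :: real
    unfolding power_mult_distrib[symmetric] using that by (intro summable_geometric) auto
  have e_summable: "summable (\<lambda>j. e j * x ^ j)" if "\<bar>x\<bar> < 1/4" for x
  proof (rule summable_comparison_test'[OF summable_M[OF that], of 0])
    show "norm (e j * x ^ j) \<le> 2 ^ j * \<bar>x\<bar> ^ j" for j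
      using mzv_2_bounds[of j] by (auto simp: abs_mult power_abs e_def intro!: mult_right_mono)
  qed
  have e_lim: "suminf (\<lambda>j. e j * (- (z ^ 2)) ^ j) = sin (pi * z) / (pi * z)" if z: "0 < z" "z < 1/2" for z :: real
  proof -
    define x where "x = - (z ^ 2)"
    have "z ^ 2 < (1/2) ^ 2" using z by (intro power_strict_mono) auto
    hence x: "\<bar>x\<bar> < 1/4" by (simp add: x_def power2_eq_square)
    have "\<forall>\<^sub>F (j, N) in sequentially \<times>\<^sub>F sequentially. norm (hs (replicate j 2) N * x ^ j) \<le> 2 ^ j * \<bar>x\<bar> ^ j"
    proof (intro always_eventually allI, clarify)
      fix j N
      show "norm (hs (replicate j 2) N * x ^ j) \<le> 2 ^ j * \<bar>x\<bar> ^ j"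
        using hs_2_le[of j N] hs_nonneg[of "replicate j 2" N]
        by (auto simp: abs_mult power_abs intro!: mult_right_mono)
    qed
    moreover have "(\<lambda>N. hs (replicate j 2) N * x ^ j) \<longlonglongrightarrow> e j * x ^ j" for j
      unfolding e_def by (intro tendsto_mult hs_2_tendsto tendsto_const)
    ultimately have "(\<lambda>N. suminf (\<lambda>j. hs (replicate j 2) N * x ^ j)) \<longlonglongrightarrow> suminf (\<lambda>j. e j * x ^ j)"
      using tannerys_theorem[where a = "\<lambda>j N. hs (replicate j 2) N * x ^ j" and b = "\<lambda>j. e j * x ^ j"
          and M = "\<lambda>j. 2 ^ j * \<bar>x\<bar> ^ j" and F = sequentially] summable_M[OF x] by auto
    also have "(\<lambda>N. suminf (\<lambda>j. hs (replicate j 2) N * x ^ j)) = (\<lambda>N. \<Prod>k=1..N. 1 - (z ^ 2) / of_nat k ^ 2)"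
    proof
      fix N
      show "suminf (\<lambda>j. hs (replicate j 2) N * x ^ j) = (\<Prod>k=1..N. 1 - z ^ 2 / of_nat k ^ 2)"
        using sums_unique[OF hs_2_sums[of N x]] by (simp add: x_def)
    qed
    finally have "suminf (\<lambda>j. e j * x ^ j) = sin (pi * z) / (pi * z)"
      using LIMSEQ_unique[OF sin_product_formula_real'[of z]] z by auto
    thus ?thesis by (simp add: x_def)
  qed
  have p_sums: "(\<lambda>j. p j * (- (z ^ 2)) ^ j) sums (sin (pi * z) / (pi * z))" if "z \<noteq> 0" for z :: real
  proof -
    have "(\<lambda>j. ((- 1) ^ j / fact (2 * j + 1) * (pi * z) ^ (2 * j + 1)) / (pi * z)) sums (sin (pi * z) / (pi * z))"
      by (intro sums_divide sin_paired)
    moreover have "((- 1) ^ j / fact (2 * j + 1) * (pi * z) ^ (2 * j + 1)) / (pi * z) = p j * (- (z ^ 2)) ^ j" for j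
    proof -
      have "(pi * z) ^ (2 * j + 1) = (pi * z) * (pi ^ (2 * j) * (z ^ 2) ^ j)"
        by (simp add: power_mult_distrib power_mult[of z])
      moreover have "(- (z ^ 2)) ^ j = (- 1) ^ j * (z ^ 2) ^ j" by (rule power_minus)
      ultimately show ?thesis using that by (simp add: p_def del: fact_Suc)
    qed
    ultimately show ?thesis by simp
  qed
  have p_summable: "summable (\<lambda>j. p j * x ^ j)" for x
  proof -
    have "summable (\<lambda>j. p j * (- (\<bar>x\<bar> + 1)) ^ j)"
      using sums_summable[OF p_sums[of "sqrt (\<bar>x\<bar> + 1)"]] by (simp add: add_nonneg_eq_0_iff)
    from powser_inside[OF this, of x] show ?thesis by simp
  qed
  define f where "f x = suminf (\<lambda>j. (e j - p j) * x ^ j)" for x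
  have f_sums: "(\<lambda>j. (e j - p j) * (x - 0) ^ j) sums f x" if "norm (x - 0) < 1/4" for x
    unfolding f_def using that summable_diff[OF e_summable p_summable, of x x]
    by (simp add: left_diff_distrib summable_sums)
  have f_0: "f 0 = 0"
    using sums_unique[OF f_sums[of 0]] by (simp add: e_def p_def)
  have f_eq: "f (- (z ^ 2)) = 0" if z: "0 < z" "z < 1/2" for z
  proof -
    have "z ^ 2 < (1/2) ^ 2" using z by (intro power_strict_mono) auto
    hence x: "\<bar>- (z ^ 2)\<bar> < 1/4" by (simp add: power2_eq_square)
    have "f (- (z ^ 2)) = suminf (\<lambda>j. e j * (- (z ^ 2)) ^ j) - suminf (\<lambda>j. p j * (- (z ^ 2)) ^ j)"
      unfolding f_def left_diff_distrib
      by (rule suminf_diff[symmetric]) (use e_summable[OF x] p_summable in auto)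
    also have "suminf (\<lambda>j. p j * (- (z ^ 2)) ^ j) = sin (pi * z) / (pi * z)"
      using sums_unique[OF p_sums[of z]] z by simp
    finally show ?thesis using e_lim[OF z] by simp
  qed
  have "e k = p k"
  proof (cases "k = 0")
    case True
    thus ?thesis by (simp add: e_def p_def)
  next
    case False
    show ?thesis
    proof (rule ccontr)
      assume "e k \<noteq> p k"
      \<comment> \<open>A series vanishing at 0 with a nonzero coefficient at some
        \<open>k > 0\<close> has no other zero near 0, whereas \<open>f\<close> vanishes at every
        \<open>- (z ^ 2)\<close> with small \<open>z\<close>.\<close>
      then obtain s where s: "0 < s" "\<And>z. z \<in> cball 0 s - {0} \<Longrightarrow> f z \<noteq> 0"
        using powser_0_nonzero[of "1/4" 0 "\<lambda>j. e j - p j" f k] f_sums f_0 False by auto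
      define z where "z = min (1/4) (sqrt s)"
      have z: "0 < z" "z < 1/2" "z \<le> sqrt s" using s(1) by (auto simp: z_def)
      have "z ^ 2 \<le> sqrt s ^ 2" using z by (intro power_mono) auto
      hence "- (z ^ 2) \<in> cball 0 s - {0}" using z s(1) by simp
      from s(2)[OF this] f_eq[OF z(1,2)] show False by simp
    qed
  qed
  thus ?thesis by (simp add: e_def p_def)
qed

section \<open>The space of multiple zeta values\<close>

interpretation rat_real: module "\<lambda>(q::rat) (x::real). of_rat q * x"
  by unfold_locales (simp_all add: algebra_simps of_rat_add of_rat_mult)

lemma mzv_in_space: "admissible ks \<Longrightarrow> mzv ks \<in> mzv_space"
  unfolding mzv_space_def by (intro rat_real.span_base) blast

lemma mzv_space_add: "x \<in> mzv_space \<Longrightarrow> y \<in> mzv_space \<Longrightarrow> x + y \<in> mzv_space"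
  unfolding mzv_space_def by (rule rat_real.span_add)

lemma mzv_space_scale: "x \<in> mzv_space \<Longrightarrow> of_rat q * x \<in> mzv_space"
  unfolding mzv_space_def by (rule rat_real.span_scale)

lemma mzv_space_0: "0 \<in> mzv_space"
  unfolding mzv_space_def by (rule rat_real.span_zero)

lemma mzv_space_sum: "(\<And>i. i \<in> I \<Longrightarrow> f i \<in> mzv_space) \<Longrightarrow> sum f I \<in> mzv_space"
  unfolding mzv_space_def by (rule rat_real.span_sum)

lemma mzv_space_mult_mzv:
  assumes "z \<in> mzv_space" "admissible ks"
  shows "mzv ks * z \<in> mzv_space"
  using assms(1) unfolding mzv_space_def
proof (induction rule: rat_real.span_induct_alt)
  case base
  show ?case using mzv_space_0 by (simp add: mzv_space_def)
next
  case (step q x y)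
  then obtain ls where ls: "x = mzv ls" "admissible ls" by auto
  have "mzv ks * x = ev mzv (harmonic_index ks ls)"
    using mzv_product[OF assms(2) ls(2)] ls(1) by simp
  also have "\<dots> \<in> mzv_space"
    unfolding ev_def using admissible_harmonic_index[OF assms(2) ls(2)]
    by (intro mzv_space_sum mzv_space_scale mzv_in_space)
  finally have "of_rat q * (mzv ks * x) + mzv ks * y \<in> mzv_space"
    using step by (intro mzv_space_add mzv_space_scale) (simp_all add: mzv_space_def)
  thus ?case by (simp add: mzv_space_def algebra_simps)
qed

lemma ideal_add: "x \<in> pi_squared_ideal \<Longrightarrow> y \<in> pi_squared_ideal \<Longrightarrow> x + y \<in> pi_squared_ideal"
  unfolding pi_squared_ideal_def using mzv_space_add by (force simp flip: distrib_left)

lemma ideal_scale: "x \<in> pi_squared_ideal \<Longrightarrow> of_rat q * x \<in> pi_squared_ideal"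
  unfolding pi_squared_ideal_def using mzv_space_scale by (force simp: mult.left_commute)

lemma ideal_0: "0 \<in> pi_squared_ideal"
  unfolding pi_squared_ideal_def using mzv_space_0 by force

lemma ideal_minus: "x \<in> pi_squared_ideal \<Longrightarrow> - x \<in> pi_squared_ideal"
  using ideal_scale[of x "-1"] by simp

lemma ideal_diff: "x \<in> pi_squared_ideal \<Longrightarrow> y \<in> pi_squared_ideal \<Longrightarrow> x - y \<in> pi_squared_ideal"
  using ideal_add[OF _ ideal_minus, of x y] by simp

lemma ideal_sum: "(\<And>i. i \<in> I \<Longrightarrow> f i \<in> pi_squared_ideal) \<Longrightarrow> sum f I \<in> pi_squared_ideal"
  by (induction I rule: infinite_finite_induct) (auto intro: ideal_add ideal_0)

lemma admissible_replicate_2: "admissible (replicate k 2)"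
  by (cases k) (simp_all add: replicate_snoc del: replicate.simps(2))

text \<open>By the explicit value, \<open>mzv (replicate k 2)\<close> is a rational multiple of pi^2
  times the value with one 2 fewer; the remaining product stays in \<open>mzv_space\<close> by the
  harmonic product.\<close>

lemma mzv_2_mult_in_ideal:
  assumes "k > 0" "z \<in> mzv_space"
  shows "mzv (replicate k 2) * z \<in> pi_squared_ideal"
proof -
  from assms(1) obtain j where k: "k = Suc j" by (cases k) auto
  define q :: rat where "q = fact (2 * j + 1) / fact (2 * k + 1)"
  have "real_of_rat (fact n) = fact n" for n
    by (metis of_nat_fact of_rat_of_nat_eq)
  hence "mzv (replicate k 2) = pi\<^sup>2 * (of_rat q * mzv (replicate j 2))"
    unfolding mzv_2 q_def k by (simp add: of_rat_divide power_add power2_eq_square del: fact_Suc)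
  moreover have "of_rat q * (mzv (replicate j 2) * z) \<in> mzv_space"
    by (intro mzv_space_scale mzv_space_mult_mzv assms admissible_replicate_2)
  ultimately show ?thesis
    unfolding pi_squared_ideal_def by (auto simp: mult.assoc)
qed

section \<open>Indices consisting of twos and one other component\<close>

definition insert_sum :: "(nat list \<Rightarrow> real) \<Rightarrow> nat \<Rightarrow> nat \<Rightarrow> real" where
  "insert_sum f m k = (\<Sum>i<k. f (replicate i 2 @ m # replicate (k - Suc i) 2))"

lemma insert_sum_Suc:
  "insert_sum f m (Suc k) = f (m # replicate k 2) + insert_sum (\<lambda>qs. f (2 # qs)) m k"
  unfolding insert_sum_def by (subst sum.lessThan_Suc_shift) simp

text \<open>The single component either enters one of the \<open>k + 1\<close> gaps between the twos
  or merges with one of the \<open>k\<close> twos.\<close>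

lemma ev_harmonic_insert:
  "ev (\<lambda>ms. f (rev ms)) (harmonic_index (replicate k 2) [m]) =
     insert_sum f m (Suc k) + insert_sum f (m + 2) k"
proof (induction k arbitrary: f)
  case 0
  thus ?case by (simp add: insert_sum_def)
next
  case (Suc k)
  have snoc: "replicate (Suc k) (2::nat) = replicate k 2 @ [2]" by (rule replicate_snoc)
  have "ev (\<lambda>ms. f (rev ms)) (harmonic_index (replicate (Suc k) 2) [m]) =
      ev (\<lambda>ms. f (2 # rev ms)) (harmonic_index (replicate k 2) [m])
    + f ((2 + m) # replicate k 2) + f (m # replicate (Suc k) 2)"
    unfolding snoc using harmonic_index_snoc[of "replicate k 2" 2 "[]" m] by (simp flip: snoc)
  also have "\<dots> = insert_sum f m (Suc (Suc k)) + insert_sum f (m + 2) (Suc k)"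
    using Suc[of "\<lambda>qs. f (2 # qs)"]
    unfolding insert_sum_Suc[of f m "Suc k"] insert_sum_Suc[of f "m + 2" k] by (simp add: add.commute)
  finally show ?case .
qed

text \<open>Modulo pi^2 the product with a nonempty string of twos vanishes, so trading one 2 for an
  increase of \<open>m\<close> by 2 only changes the sign. After \<open>k\<close> trades a single
  zeta value is left.\<close>

lemma insert_sum_mzv:
  assumes "m \<ge> 2"
  shows "insert_sum (\<lambda>qs. mzv (rev qs)) m (Suc k) - (- 1) ^ k * mzv [m + 2 * k] \<in> pi_squared_ideal"
  using assms
proof (induction k arbitrary: m)
  case 0
  thus ?case by (simp add: insert_sum_def ideal_0)
next
  case (Suc k)
  have m: "admissible [m]" using Suc.prems by (simp add: admissible_def)
  have "mzv (replicate (Suc k) 2) * mzv [m] =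
      insert_sum (\<lambda>qs. mzv (rev qs)) m (Suc (Suc k)) + insert_sum (\<lambda>qs. mzv (rev qs)) (m + 2) (Suc k)"
    using mzv_product[OF admissible_replicate_2 m] ev_harmonic_insert[of "\<lambda>qs. mzv (rev qs)" "Suc k" m]
    by (simp del: replicate.simps)
  hence "insert_sum (\<lambda>qs. mzv (rev qs)) m (Suc (Suc k)) - (- 1) ^ Suc k * mzv [m + 2 * Suc k] =
      mzv (replicate (Suc k) 2) * mzv [m]
      - (insert_sum (\<lambda>qs. mzv (rev qs)) (m + 2) (Suc k) - (- 1) ^ k * mzv [m + 2 + 2 * k])"
    by simp
  also have "\<dots> \<in> pi_squared_ideal"
    using Suc.prems by (intro ideal_diff mzv_2_mult_in_ideal mzv_in_space m Suc.IH) auto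
  finally show ?case .
qed

text \<open>The factor is the binomial coefficient \<open>(2 + 1 - 1) choose 1\<close> of the one
  raised component.\<close>

lemma ev_raise_index_replicate_2:
  "ev f (raise_index 1 (replicate k 2)) = 2 * insert_sum f 3 k"
proof (induction k arbitrary: f)
  case (Suc k)
  have "ev f (raise_index 1 (replicate (Suc k) 2)) =
      ev (\<lambda>qs. f (2 # qs)) (raise_index 1 (replicate k 2)) + 2 * f (3 # replicate k 2)"
    unfolding replicate_Suc ev_raise_index_Cons by (simp add: raise_index_0 numeral_2_eq_2 numeral_3_eq_3 eval_nat_numeral)
  thus ?case unfolding Suc.IH insert_sum_Suc by simp
qed (simp add: insert_sum_def)

section \<open>Symmetric multiple zeta values of \<open>({1,3}\<^sup>n, 1)\<close>\<close>

lemma finite_compositions: "finite {ls :: nat list. length ls = r \<and> sum_list ls = m}"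
proof (rule finite_subset)
  show "{ls. length ls = r \<and> sum_list ls = m} \<subseteq> {ls. set ls \<subseteq> {..m} \<and> length ls = r}"
    using member_le_sum_list by fastforce
qed (rule finite_lists_length_eq, simp)

lemma ev_raise_index:
  "(\<Sum>ls | length ls = length ks \<and> sum_list ls = m.
      f (map2 (+) ks ls) * (\<Prod>i<length ks. real ((ks ! i + ls ! i - 1) choose (ls ! i)))) =
   ev (\<lambda>qs. f (rev qs)) (raise_index m (rev ks))"
proof (induction ks arbitrary: m f rule: rev_induct)
  case Nil
  have "{ls :: nat list. length ls = length [] \<and> sum_list ls = m} = (if m = 0 then {[]} else {})" by auto
  thus ?case by simp
next
  case (snoc k ks)
  let ?S = "\<lambda>r m. {ls :: nat list. length ls = r \<and> sum_list ls = m}"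
  let ?P = "\<lambda>ks ls. \<Prod>i<length ks. real ((ks ! i + ls ! i - 1) choose (ls ! i))"
  have bij: "bij_betw (\<lambda>(l, ls). ls @ [l]) (Sigma {..m} (\<lambda>l. ?S (length ks) (m - l))) (?S (length (ks @ [k])) m)"
  proof (rule bij_betw_imageI)
    show "inj_on (\<lambda>(l, ls). ls @ [l]) (Sigma {..m} (\<lambda>l. ?S (length ks) (m - l)))" by (auto simp: inj_on_def)
    show "(\<lambda>(l, ls). ls @ [l]) ` (Sigma {..m} (\<lambda>l. ?S (length ks) (m - l))) = ?S (length (ks @ [k])) m"
    proof (intro equalityI subsetI)
      fix ms assume ms: "ms \<in> ?S (length (ks @ [k])) m"
      then obtain ls l where "ms = ls @ [l]" by (cases ms rule: rev_cases) auto
      thus "ms \<in> (\<lambda>(l, ls). ls @ [l]) ` (Sigma {..m} (\<lambda>l. ?S (length ks) (m - l)))"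
        using ms by (intro image_eqI[of _ _ "(l, ls)"]) auto
    qed auto
  qed
  have "(\<Sum>ls\<in>?S (length (ks @ [k])) m. f (map2 (+) (ks @ [k]) ls) * ?P (ks @ [k]) ls) =
      (\<Sum>(l, ls)\<in>Sigma {..m} (\<lambda>l. ?S (length ks) (m - l)).
         f (map2 (+) (ks @ [k]) (ls @ [l])) * ?P (ks @ [k]) (ls @ [l]))"
    using sum.reindex_bij_betw[OF bij, of "\<lambda>ls. f (map2 (+) (ks @ [k]) ls) * ?P (ks @ [k]) ls"]
    by (simp add: case_prod_unfold)
  also have "\<dots> = (\<Sum>l\<le>m. \<Sum>ls\<in>?S (length ks) (m - l).
         f (map2 (+) (ks @ [k]) (ls @ [l])) * ?P (ks @ [k]) (ls @ [l]))"
    by (intro sum.Sigma[symmetric]) (auto intro: finite_compositions)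
  also have "\<dots> = (\<Sum>l\<le>m. real ((k + l - 1) choose l) *
      (\<Sum>ls\<in>?S (length ks) (m - l). f (map2 (+) ks ls @ [k + l]) * ?P ks ls))"
    unfolding sum_distrib_left
    by (intro sum.cong refl) (auto simp: nth_append intro!: prod.cong)
  also have "\<dots> = ev (\<lambda>qs. f (rev qs)) (raise_index m (rev (ks @ [k])))"
    using snoc[of "\<lambda>qs. f (qs @ [k + _])"] by (simp add: ev_raise_index_Cons)
  finally show ?case .
qed

lemma zeta_reg_shift_eq:
  "zeta_reg_shift b m ks = ev (\<lambda>qs. zeta_reg b (rev qs)) (raise_index m (rev ks))"
  unfolding zeta_reg_shift_def by (rule ev_raise_index)

text \<open>For a reversed index: the original does not end in two ones. Raising components cannot
  leave this class, and on it both regularizations agree.\<close>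

definition almost_admissible :: "nat list \<Rightarrow> bool" where
  "almost_admissible ks \<longleftrightarrow> is_index ks \<and> (2 \<le> length ks \<longrightarrow> 2 \<le> hd ks \<or> 2 \<le> ks ! 1)"

lemma zeta_reg_almost_admissible:
  assumes "almost_admissible qs"
  shows "zeta_reg b (rev qs) = zeta_sh_rev qs"
proof (cases b)
  case Shuffle
  thus ?thesis using assms by (simp add: zeta_reg_Shuffle almost_admissible_def)
next
  case Harmonic
  have ind: "is_index (rev qs)" using assms by (simp add: almost_admissible_def)
  have "zeta_harm (rev qs) = zeta_sh_rev qs"
  proof (cases "admissible (rev qs)")
    case True
    thus ?thesis using zeta_harm_admissible[OF True] zeta_sh_rev_admissible[OF True] by simp
  next
    case False
    then obtain k ks where qs: "qs = k # ks" by (cases qs) auto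
    hence k: "k = 1" using False ind by auto
    have "admissible (rev ks)"
      using assms unfolding qs k by (cases ks) (auto simp: almost_admissible_def)
    thus ?thesis using zeta_regularizations_agree[of "rev ks"] by (simp add: qs k)
  qed
  thus ?thesis using ind by (simp add: Harmonic zeta_reg_Harmonic)
qed

lemma zeta_reg_shift_almost_admissible:
  assumes "almost_admissible (rev ks)"
  shows "zeta_reg_shift b m ks = (- 1) ^ m * zeta_word (replicate m Letter_x @ word_of_index ks)"
proof -
  have ind: "is_index ks" using assms by (simp add: almost_admissible_def)
  have "almost_admissible qs" if "qs \<in> keys (raise_index m (rev ks))" for qs
  proof -
    have le: "list_all2 (\<le>) (rev ks) qs" using that by (rule raise_index_le)
    have "is_index qs" using keys_raise_index[OF that] ind by simp
    moreover have "2 \<le> hd qs \<or> 2 \<le> qs ! 1" if "2 \<le> length qs"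
    proof -
      have len: "length (rev ks) = length qs" using le by (rule list_all2_lengthD)
      have "rev ks ! 0 \<le> qs ! 0" "rev ks ! 1 \<le> qs ! 1"
        by (rule list_all2_nthD[OF le]; use that len in linarith)+
      moreover have "hd (rev ks) = rev ks ! 0" "hd qs = qs ! 0"
        using that len by (auto intro!: hd_conv_nth)
      ultimately show ?thesis using assms that len unfolding almost_admissible_def by auto
    qed
    ultimately show ?thesis by (simp add: almost_admissible_def)
  qed
  hence "zeta_reg_shift b m ks = ev zeta_sh_rev (raise_index m (rev ks))"
    unfolding zeta_reg_shift_eq by (intro ev_cong zeta_reg_almost_admissible)
  also have "\<dots> = (- 1) ^ m * zeta_word (replicate m Letter_x @ word_of_index ks)"
    by (simp add: zeta_word_replicate_x[OF ind] flip: power_add mult.assoc)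
  finally show ?thesis .
qed

section \<open>The pieces of ({1,3}^n,1) and their words\<close>

definition one_three :: "nat \<Rightarrow> nat list" where
  "one_three n = concat (replicate n [1, 3])"

lemma one_three_Suc: "one_three (Suc n) = 1 # 3 # one_three n"
  by (simp add: one_three_def)

lemma one_three_add: "one_three (m + n) = one_three m @ one_three n"
  by (simp add: one_three_def replicate_add)

lemma one_three_snoc: "one_three (Suc n) = one_three n @ [1, 3]"
  using one_three_add[of n 1] by (simp add: one_three_def)

lemma word_of_one_three: "word_of_index (one_three n) = per n"
  by (induction n) (simp_all add: one_three_def periodic_def word_of_index_Cons numeral_3_eq_3)

text \<open>Being a palindrome, the index has reversed tails of the same two shapes as its initial
  pieces.\<close>

lemma rev_one_three_1: "rev (one_three n @ [1]) = one_three n @ [1]"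
proof (induction n)
  case (Suc n)
  have "rev (one_three (Suc n) @ [1]) = rev (one_three n @ [1]) @ [3, 1]"
    by (simp add: one_three_Suc)
  also have "\<dots> = one_three (Suc n) @ [1]" unfolding Suc by (simp add: one_three_snoc)
  finally show ?case .
qed (simp add: one_three_def)

lemma rev_tl_one_three_1: "rev (tl (one_three n @ [1])) = one_three n"
proof (cases n)
  case (Suc m)
  have "tl (one_three (Suc m) @ [1]) = 3 # one_three m @ [1]" by (simp add: one_three_Suc)
  hence "rev (tl (one_three n @ [1])) = rev (one_three m @ [1]) @ [3]" by (simp add: Suc)
  also have "\<dots> = one_three n" unfolding rev_one_three_1 by (simp add: Suc one_three_snoc)
  finally show ?thesis .
qed (simp add: one_three_def)

lemma sum_list_one_three: "sum_list (one_three n) = 4 * n"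
  by (induction n) (simp_all add: one_three_def)

lemma length_one_three: "length (one_three n) = 2 * n"
  by (induction n) (simp_all add: one_three_def)

lemma almost_admissible_one_three:
  "almost_admissible (rev (one_three n))" "almost_admissible (rev (one_three n @ [1]))"
proof -
  have ind: "is_index (one_three n)" by (induction n) (simp_all add: one_three_def)
  have "one_three n = [] \<or> (\<exists>m. one_three n = one_three m @ [1, 3])"
    using one_three_snoc by (cases n) (auto simp: one_three_def)
  thus "almost_admissible (rev (one_three n))" "almost_admissible (rev (one_three n @ [1]))"
    using ind by (auto simp: almost_admissible_def)
qed

lemma take_drop_one_three:
  assumes "a \<le> n"
  shows "take (2 * a) (one_three n @ [1]) = one_three a"
    "drop (2 * a) (one_three n @ [1]) = one_three (n - a) @ [1]"
    "take (2 * a + 1) (one_three n @ [1]) = one_three a @ [1]"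
    "rev (drop (2 * a + 1) (one_three n @ [1])) = one_three (n - a)"
    "sum_list (drop (2 * a + 1) (one_three n @ [1])) = 4 * (n - a)"
proof -
  have eq: "one_three n @ [1] = one_three a @ one_three (n - a) @ [1]"
    using one_three_add[of a "n - a"] assms by simp
  show 1: "take (2 * a) (one_three n @ [1]) = one_three a"
    "drop (2 * a) (one_three n @ [1]) = one_three (n - a) @ [1]"
    unfolding eq by (simp_all add: length_one_three)
  have "take 1 (one_three (n - a) @ [1]) = [1]"
    by (cases "n - a") (simp_all add: one_three_def)
  thus "take (2 * a + 1) (one_three n @ [1]) = one_three a @ [1]"
    unfolding take_add 1 by simp
  have "drop (2 * a + 1) xs = tl (drop (2 * a) xs)" for xs :: "nat list"
    by (simp add: drop_Suc tl_drop)
  hence "drop (2 * a + 1) (one_three n @ [1]) = tl (one_three (n - a) @ [1])"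
    by (simp only: 1)
  thus *: "rev (drop (2 * a + 1) (one_three n @ [1])) = one_three (n - a)"
    by (simp only: rev_tl_one_three_1)
  have "sum_list (drop (2 * a + 1) (one_three n @ [1])) = sum_list (rev (drop (2 * a + 1) (one_three n @ [1])))"
    by (rule sum_list_rev[symmetric])
  thus "sum_list (drop (2 * a + 1) (one_three n @ [1])) = 4 * (n - a)"
    unfolding * sum_list_one_three .
qed

text \<open>A cut at \<open>2 * a\<close> leaves a tail of odd weight
  \<open>4 * (n - a) + 1\<close>, hence the minus sign; a cut at \<open>2 * a + 1\<close> leaves the
  even weight \<open>4 * (n - a)\<close>.\<close>

lemma zeta_S_hat_one_three_nth:
  "fps_nth (zeta_S_hat b (one_three n @ [1])) m = (- 1) ^ m *
     (\<Sum>a\<le>n. zeta_word (per a @ [Letter_y]) * zeta_word (replicate m Letter_x @ per (n - a))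
           - zeta_word (per a) * zeta_word (replicate m Letter_x @ per (n - a) @ [Letter_y]))"
proof -
  let ?ks = "one_three n @ [1]"
  define T where "T i = (- 1) ^ sum_list (drop i ?ks) * zeta_reg b (take i ?ks) * zeta_reg_shift b m (rev (drop i ?ks))" for i
  have reg: "zeta_reg b (one_three a) = zeta_word (per a)"
    "zeta_reg b (one_three a @ [1]) = zeta_word (per a @ [Letter_y])" for a
  proof -
    have *: "zeta_reg b ks = zeta_word (word_of_index ks)" if "almost_admissible (rev ks)" for ks
      using zeta_reg_almost_admissible[OF that, of b] zeta_word_of_index[of ks] that
      by (simp add: almost_admissible_def)
    show "zeta_reg b (one_three a) = zeta_word (per a)"
      using *[OF almost_admissible_one_three(1)] by (simp add: word_of_one_three)
    show "zeta_reg b (one_three a @ [1]) = zeta_word (per a @ [Letter_y])"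
      using *[OF almost_admissible_one_three(2)] by (simp add: word_of_one_three word_of_index_Cons)
  qed
  have shift: "zeta_reg_shift b m (one_three a) = (- 1) ^ m * zeta_word (replicate m Letter_x @ per a)"
    "zeta_reg_shift b m (one_three a @ [1]) = (- 1) ^ m * zeta_word (replicate m Letter_x @ per a @ [Letter_y])" for a
    using zeta_reg_shift_almost_admissible[OF almost_admissible_one_three(1), of b m a]
      zeta_reg_shift_almost_admissible[OF almost_admissible_one_three(2), of b m a]
    by (simp_all add: word_of_one_three word_of_index_Cons)
  have "length ?ks = 2 * n + 1" by (simp add: length_one_three)
  hence "fps_nth (zeta_S_hat b ?ks) m = (\<Sum>i\<le>2 * n + 1. T i)"
    unfolding zeta_S_hat_def T_def by (simp add: fps_sum_nth del: sum.atMost_Suc)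
  also have "\<dots> = (\<Sum>a\<le>n. T (2 * a)) + (\<Sum>a\<le>n. T (2 * a + 1))"
    by (rule sum_atMost_odd)
  also have "(\<Sum>a\<le>n. T (2 * a)) = (\<Sum>a\<le>n. - (zeta_word (per a) *
      ((- 1) ^ m * zeta_word (replicate m Letter_x @ per (n - a) @ [Letter_y]))))"
  proof (intro sum.cong refl)
    fix a assume "a \<in> {..n}"
    hence a: "a \<le> n" by simp
    have "sum_list (one_three (n - a) @ [1]) = 2 * (2 * (n - a)) + 1"
      by (simp add: sum_list_one_three)
    hence "(- 1 :: real) ^ sum_list (one_three (n - a) @ [1]) = - 1"
      by (simp only: power_add power_mult) simp
    thus "T (2 * a) = - (zeta_word (per a) *
      ((- 1) ^ m * zeta_word (replicate m Letter_x @ per (n - a) @ [Letter_y])))"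
      unfolding T_def take_drop_one_three[OF a] rev_one_three_1 reg shift by simp
  qed
  also have "(\<Sum>a\<le>n. T (2 * a + 1)) = (\<Sum>a\<le>n. zeta_word (per a @ [Letter_y]) *
      ((- 1) ^ m * zeta_word (replicate m Letter_x @ per (n - a))))"
  proof (intro sum.cong refl)
    fix a assume "a \<in> {..n}"
    hence a: "a \<le> n" by simp
    have "(- 1 :: real) ^ (4 * (n - a)) = 1" by (simp add: power_mult)
    thus "T (2 * a + 1) = zeta_word (per a @ [Letter_y]) *
      ((- 1) ^ m * zeta_word (replicate m Letter_x @ per (n - a)))"
      unfolding T_def take_drop_one_three[OF a] reg shift by simp
  qed
  finally show ?thesis
    by (simp add: sum_negf sum_subtractf sum_distrib_left right_diff_distrib mult_ac)
qed

section \<open>The two convolutions modulo pi^2\<close>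

lemma alt_y_even: "alt_y (2 * k) = word_of_index (replicate k 2)"
  by (induction k) (simp_all add: word_of_index_Cons)

lemma zeta_word_alt_y: "zeta_word (alt_y (2 * k)) = mzv (replicate k 2)"
  using zeta_word_of_index[of "replicate k 2"] zeta_sh_rev_admissible[OF admissible_replicate_2, of k]
  by (simp add: alt_y_even)

lemma insert_sum_in_space:
  assumes "m \<ge> 2"
  shows "insert_sum (\<lambda>qs. mzv (rev qs)) m k \<in> mzv_space"
  unfolding insert_sum_def
proof (intro mzv_space_sum mzv_in_space)
  fix i
  show "admissible (rev (replicate i 2 @ m # replicate (k - Suc i) 2))"
    using assms by (cases i) (auto simp: admissible_def)
qed

text \<open>The word is one leading \<open>x\<close> before the word of a string of twos, so it
  stands for minus the first derived value, in which one 2 becomes a 3.\<close>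

lemma zeta_word_alt_x: "zeta_word (alt_x (2 * k + 1)) = - 2 * insert_sum (\<lambda>qs. mzv (rev qs)) 3 k"
proof -
  have "alt_x (2 * k + 1) = replicate 1 Letter_x @ word_of_index (replicate k 2)"
    by (simp add: alt_y_even)
  hence "zeta_word (alt_x (2 * k + 1)) = - ev zeta_sh_rev (raise_index 1 (replicate k 2))"
    using zeta_word_replicate_x[of "replicate k 2" 1] by simp
  also have "\<dots> = - 2 * insert_sum zeta_sh_rev 3 k"
    by (simp only: ev_raise_index_replicate_2)
  also have "insert_sum zeta_sh_rev 3 k = insert_sum (\<lambda>qs. mzv (rev qs)) 3 k"
    unfolding insert_sum_def
  proof (intro sum.cong refl)
    fix i
    have "admissible (rev (replicate i 2 @ 3 # replicate (k - Suc i) 2))"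
      by (cases i) (auto simp: admissible_def)
    from zeta_sh_rev_admissible[OF this]
    show "zeta_sh_rev (replicate i 2 @ 3 # replicate (k - Suc i) 2) =
        mzv (rev (replicate i 2 @ 3 # replicate (k - Suc i) 2))" by simp
  qed
  finally show ?thesis .
qed

text \<open>The numbers of twos in each product add up to \<open>2 * n + 1\<close>, so at least one
  factor is divisible by pi^2.\<close>

lemma coefficient_1_in_ideal: "fps_nth (zeta_S_hat b (one_three n @ [1])) 1 \<in> pi_squared_ideal"
proof -
  define S where "S = (\<Sum>i\<le>2 * n + 1. mzv (replicate i 2) * mzv (replicate (2 * n + 1 - i) 2))"
  have "fps_nth (zeta_S_hat b (one_three n @ [1])) 1 =
     (\<Sum>a\<le>n. zeta_word (per a) * zeta_word (Letter_x # per (n - a) @ [Letter_y])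
           - zeta_word (per a @ [Letter_y]) * zeta_word (Letter_x # per (n - a)))"
    unfolding zeta_S_hat_one_three_nth by (simp add: sum_subtractf)
  also have "\<dots> = of_rat (- 1 / (2 * (- 4) ^ n)) * S"
    unfolding convolution_identity_1 zeta_word_alt_y S_def[symmetric]
    by (simp add: of_rat_divide of_rat_mult of_rat_power of_rat_minus)
  also have "\<dots> \<in> pi_squared_ideal"
    unfolding S_def
  proof (intro ideal_scale ideal_sum)
    fix i
    show "mzv (replicate i 2) * mzv (replicate (2 * n + 1 - i) 2) \<in> pi_squared_ideal"
    proof (cases "i = 0")
      case True
      have "mzv (replicate (2 * n + 1) 2) * mzv [] \<in> pi_squared_ideal"
        by (intro mzv_2_mult_in_ideal mzv_in_space) auto
      thus ?thesis by (simp add: True)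
    qed (auto intro!: mzv_2_mult_in_ideal mzv_in_space admissible_replicate_2)
  qed
  finally show ?thesis .
qed

lemma coefficient_2_in_ideal:
  "fps_nth (zeta_S_hat b (one_three n @ [1])) 2 + mzv [4 * n + 3] / (- 4) ^ n \<in> pi_squared_ideal"
proof -
  define \<tau> where "\<tau> = insert_sum (\<lambda>qs. mzv (rev qs)) 3"
  define R where "R = (\<Sum>i\<le>2 * n. mzv (replicate (Suc i) 2) * \<tau> (2 * n - i))"
  have "fps_nth (zeta_S_hat b (one_three n @ [1])) 2 =
     (\<Sum>a\<le>n. zeta_word (per a @ [Letter_y]) * zeta_word (Letter_x # Letter_x # per (n - a))
         - zeta_word (per a) * zeta_word (Letter_x # Letter_x # per (n - a) @ [Letter_y]))"
    unfolding zeta_S_hat_one_three_nth by (simp add: numeral_2_eq_2)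
  also have "\<dots> = (\<Sum>i\<le>2 * n + 1. mzv (replicate i 2) * (- 2 * \<tau> (2 * n + 1 - i))) / (2 * (- 4) ^ n)"
    unfolding convolution_identity_2 zeta_word_alt_y zeta_word_alt_x \<tau>_def ..
  \<comment> \<open>Only the summand \<open>i = 0\<close>, with the empty string of twos, can
    survive modulo pi^2; it is split off as the first term.\<close>
  also have "(\<Sum>i\<le>2 * n + 1. mzv (replicate i 2) * (- 2 * \<tau> (2 * n + 1 - i))) = - 2 * (\<tau> (2 * n + 1) + R)"
    unfolding Suc_eq_plus1[symmetric] sum.atMost_Suc_shift R_def
    by (simp add: sum_distrib_left sum_negf mult_ac del: replicate.simps(2))
  finally have eq: "fps_nth (zeta_S_hat b (one_three n @ [1])) 2 = - 2 * (\<tau> (2 * n + 1) + R) / (2 * (- 4) ^ n)" .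
  have combine: "- 2 * (t + r) / (2 * d) + m / d = - ((t - m) + r) / d" if "d \<noteq> 0" for t r m d :: real
    using that by (simp add: field_simps)
  have "fps_nth (zeta_S_hat b (one_three n @ [1])) 2 + mzv [4 * n + 3] / (- 4) ^ n =
      - ((\<tau> (2 * n + 1) - mzv [4 * n + 3]) + R) / (- 4) ^ n"
    unfolding eq by (rule combine) simp
  also have "\<dots> = of_rat (- 1 / (- 4) ^ n) * ((\<tau> (2 * n + 1) - mzv [4 * n + 3]) + R)"
  proof -
    have "real_of_rat (- 1 / (- 4) ^ n) = - 1 / (- 4) ^ n"
      by (simp add: of_rat_divide of_rat_power of_rat_minus)
    thus ?thesis by (simp only: times_divide_eq_left mult_minus1)
  qed
  also have "\<dots> \<in> pi_squared_ideal"
  proof (intro ideal_scale ideal_add)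
    \<comment> \<open>Here \<open>2 * n\<close> trades are made starting from the component 3: the
      sign is plus, and the weight is \<open>4 * n + 3\<close>.\<close>
    have "\<tau> (Suc (2 * n)) - (- 1) ^ (2 * n) * mzv [3 + 2 * (2 * n)] \<in> pi_squared_ideal"
      unfolding \<tau>_def by (rule insert_sum_mzv) simp
    thus "\<tau> (2 * n + 1) - mzv [4 * n + 3] \<in> pi_squared_ideal" by (simp add: add.commute)
    show "R \<in> pi_squared_ideal"
      unfolding R_def \<tau>_def by (intro ideal_sum mzv_2_mult_in_ideal insert_sum_in_space) auto
  qed
  finally show ?thesis .
qed

theorem corollary1p6:
  fixes b :: reg_kind and n :: nat
  shows "\<forall>j<3. fps_nth (zeta_S 3 b (concat (replicate n [1, 3]) @ [1])) j
               - fps_nth (fps_const (- ((- 4) powi (- int n)) * mzv [4 * n + 3]) * fps_X ^ 2) j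
             \<in> pi_squared_ideal"
proof (intro allI impI)
  fix j :: nat assume "j < 3"
  let ?z = "zeta_S_hat b (one_three n @ [1])"
  let ?c = "- ((- 4) powi (- int n)) * mzv [4 * n + 3]"
  have eq: "fps_nth (zeta_S 3 b (concat (replicate n [1, 3]) @ [1])) j
      - fps_nth (fps_const ?c * fps_X ^ 2) j = fps_nth ?z j - (if j = 2 then ?c else 0)"
    using \<open>j < 3\<close> by (simp add: zeta_S_def one_three_def fps_X_power_nth)
  from \<open>j < 3\<close> consider "j = 0" | "j = 1" | "j = 2" by linarith
  thus "fps_nth (zeta_S 3 b (concat (replicate n [1, 3]) @ [1])) j
      - fps_nth (fps_const ?c * fps_X ^ 2) j \<in> pi_squared_ideal"
  proof cases
    case 1
    \<comment> \<open>The constant coefficient vanishes exactly, since exchanging \<open>a\<close>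
      and \<open>n - a\<close> maps one sum to the other.\<close>
    have "(\<Sum>a\<le>n. zeta_word (per a @ [Letter_y]) * zeta_word (per (n - a))) =
        (\<Sum>a\<le>n. zeta_word (per a) * zeta_word (per (n - a) @ [Letter_y]))"
      by (rule sum.reindex_bij_witness[of _ "\<lambda>a. n - a" "\<lambda>a. n - a"]) auto
    hence "fps_nth ?z 0 = 0" unfolding zeta_S_hat_one_three_nth by (simp add: sum_subtractf)
    thus ?thesis unfolding eq using 1 ideal_0 by simp
  next
    case 2
    thus ?thesis unfolding eq using coefficient_1_in_ideal by simp
  next
    case 3
    have "- ?c = mzv [4 * n + 3] / (- 4) ^ n"
      by (simp add: power_int_minus field_simps)
    thus ?thesis unfolding eq using 3 coefficient_2_in_ideal[of b n] by simp
  qed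
qed

end
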